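(* Let $\Omega=(0,1)$, $T>0$, $u_0,v_0\in L^2(\Omega)$, $\gamma>0$ and $(m_1,m_2)\in L^2(\Omega)\times L^2(\Omega)$. Then the functional $$J_\gamma(d)=\frac12\int_\Omega\left(u(x,T;d)-m_1(x)\right)^2dx+\frac12\int_\Omega\left(v(x,T;d)-m_2(x)\right)^2dx+\frac{\gamma}{2}\|d\|^2_{H^1(\Omega)}$$ is Fréchet differentiable on $\mathcal{D}$, and its Fréchet gradient (with respect to the $H^1(\Omega)$ inner product $(f,g)_{H^1(\Omega)}=\int_\Omega fg\,dx+\int_\Omega f'g'\,dx$) at $d\in\mathcal{D}$ is $$J'_\gamma(d)=\Lambda+\gamma d,$$ where $\Lambda$ solves $$\Lambda''-\Lambda=\int_0^T q_x v_x\,dt\ \text{in }\Omega,\qquad \Lambda'(0)=\Lambda'(1)=0,$$ with $(u,v)=(u(\cdot,\cdot;d),v(\cdot,\cdot;d))$ and $(p,q)$ the weak solution of the adjoint problem $$-p_t+p_{xxxx}=0,\quad -q_t-(d(x)q_x)_x=p\ \text{in }\Omega\times(0,T),\qquad p(\cdot,T)=u(\cdot,T;d)-m_1,\ q(\cdot,T)=v(\cdot,T;d)-m_2,$$ $$p=p_{xx}=0,\ q=0\ \text{on }\partial\Omega\times(0,T).$$ That is, $J_\gamma(d+\delta d)-J_\gamma(d)=(\Lambda+\gamma d,\delta d)_{H^1(\Omega)}+O(\|\delta d\|^2_{H^1(\Omega)})$ for $d,d+\delta d\in\mathcal{D}$.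
   Context: For fixed constants $0<\alpha_0\le\alpha_1$ and $\alpha_2>0$, $\mathcal{D}=\{d\in H^1(\Omega):\ \alpha_0\le d(x)\le\alpha_1\ \forall x\in\Omega,\ \|d\|_{H^1(\Omega)}\le\alpha_2\}$. For $d\in\mathcal{D}$, $(u(\cdot,\cdot;d),v(\cdot,\cdot;d))$ is the unique weak solution of $u_t+u_{xxxx}=v$, $v_t-(d(x)v_x)_x=0$ in $\Omega\times(0,T)$, $u(\cdot,0)=u_0$, $v(\cdot,0)=v_0$, $u=u_{xx}=0$, $v=0$ on $\partial\Omega\times(0,T)$; weak solution: $(u,v)\in L^2(0,T;V_0^2(\Omega))\times L^2(0,T;H_0^1(\Omega))$, $(u_t,v_t)\in L^2(0,T;V_0^2(\Omega)^* )\times L^2(0,T;H^{-1}(\Omega))$, initial conditions, and for all $\phi\in V_0^2(\Omega)=\{z\in H^2(\Omega):z=0\text{ on }\partial\Omega\}$ and a.e. $t$: $\langle u_t,\phi\rangle+(u_{xx},\phi_{xx})=(v,\phi)$, $\langle v_t,\phi\rangle+(dv_x,\phi_x)=0$. The adjoint weak solution is defined analogously after the time reversal $t\mapsto T-t$. *)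

theory Defs
  imports "HOL-Analysis.Analysis"
begin

definition Om :: "real set" where "Om = {0<..<1}"

definition L2 :: "(real \<Rightarrow> real) set" where
  "L2 = {f. f \<in> borel_measurable (lebesgue_on Om) \<and>
            integrable (lebesgue_on Om) (\<lambda>x. (f x)\<^sup>2)}"

definition ip :: "(real \<Rightarrow> real) \<Rightarrow> (real \<Rightarrow> real) \<Rightarrow> real" where
  "ip f g = (LINT x|lebesgue_on Om. f x * g x)"

definition test_fun :: "real set \<Rightarrow> (real \<Rightarrow> real) \<Rightarrow> bool" where
  "test_fun U \<phi> \<longleftrightarrow>
     (\<forall>k x. ((deriv ^^ k) \<phi> has_real_derivative (deriv ^^ Suc k) \<phi> x) (at x)) \<and>
     (\<exists>K. compact K \<and> K \<subseteq> U \<and> (\<forall>x. x \<notin> K \<longrightarrow> \<phi> x = 0))"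

definition weak_deriv_of :: "(real \<Rightarrow> real) \<Rightarrow> (real \<Rightarrow> real) \<Rightarrow> bool" where
  "weak_deriv_of f g \<longleftrightarrow> f \<in> L2 \<and> g \<in> L2 \<and>
     (\<forall>\<phi>. test_fun Om \<phi> \<longrightarrow> ip f (deriv \<phi>) = - ip g \<phi>)"

definition H1 :: "(real \<Rightarrow> real) set" where
  "H1 = {f. \<exists>g. weak_deriv_of f g}"

definition wd :: "(real \<Rightarrow> real) \<Rightarrow> (real \<Rightarrow> real)" where
  "wd f = (SOME g. weak_deriv_of f g)"

definition H2 :: "(real \<Rightarrow> real) set" where
  "H2 = {f \<in> H1. wd f \<in> H1}"

definition bdry_zero :: "(real \<Rightarrow> real) \<Rightarrow> bool" where
  "bdry_zero f \<longleftrightarrow> (\<exists>h. continuous_on {0..1} h \<and> h 0 = 0 \<and> h 1 = 0 \<and>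
                          (AE x in lebesgue_on Om. f x = h x))"

definition H01 :: "(real \<Rightarrow> real) set" where "H01 = {f \<in> H1. bdry_zero f}"
definition V02 :: "(real \<Rightarrow> real) set" where "V02 = {f \<in> H2. bdry_zero f}"

definition ip1 :: "(real \<Rightarrow> real) \<Rightarrow> (real \<Rightarrow> real) \<Rightarrow> real" where
  "ip1 f g = ip f g + ip (wd f) (wd g)"
definition norm1 :: "(real \<Rightarrow> real) \<Rightarrow> real" where
  "norm1 f = sqrt (ip1 f f)"
definition norm2 :: "(real \<Rightarrow> real) \<Rightarrow> real" where
  "norm2 f = sqrt (ip f f + ip (wd f) (wd f) + ip (wd (wd f)) (wd (wd f)))"

definition Dset :: "real \<Rightarrow> real \<Rightarrow> real \<Rightarrow> (real \<Rightarrow> real) set" where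
  "Dset a0 a1 a2 = {d \<in> H1. (\<forall>x\<in>Om. a0 \<le> d x \<and> d x \<le> a1) \<and> norm1 d \<le> a2}"

definition L2V :: "real \<Rightarrow> (real \<Rightarrow> real) set \<Rightarrow> ((real \<Rightarrow> real) \<Rightarrow> real)
                    \<Rightarrow> (real \<Rightarrow> real \<Rightarrow> real) set" where
  "L2V T V nrm = {u. (\<lambda>(t,x). u t x) \<in> borel_measurable (lebesgue_on ({0<..<T} \<times> Om)) \<and>
                     (AE t in lebesgue_on {0<..<T}. u t \<in> V) \<and>
                     integrable (lebesgue_on {0<..<T}) (\<lambda>t. (nrm (u t))\<^sup>2)}"

definition CL2 :: "real \<Rightarrow> (real \<Rightarrow> real \<Rightarrow> real) \<Rightarrow> bool" where
  "CL2 T u \<longleftrightarrow> (\<forall>t\<in>{0..T}. u t \<in> L2) \<and>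
     (\<forall>s\<in>{0..T}. ((\<lambda>t. LINT x|lebesgue_on Om. (u t x - u s x)\<^sup>2) \<longlongrightarrow> 0) (at s within {0..T}))"

text \<open>Weak solution of  u_t + u_xxxx = F,  v_t - (d v_x)_x = G,  u(0)=a, v(0)=b,
  u = u_xx = 0, v = 0 on the boundary.  The time derivatives are understood in the
  distributional (V*-valued) sense, tested against phi in V02 and psi in C_c^infinity(0,T).\<close>
definition weak_sol :: "real \<Rightarrow> (real \<Rightarrow> real) \<Rightarrow> (real \<Rightarrow> real \<Rightarrow> real) \<Rightarrow> (real \<Rightarrow> real \<Rightarrow> real)
     \<Rightarrow> (real \<Rightarrow> real) \<Rightarrow> (real \<Rightarrow> real) \<Rightarrow> (real \<Rightarrow> real \<Rightarrow> real) \<Rightarrow> (real \<Rightarrow> real \<Rightarrow> real) \<Rightarrow> bool" where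
  "weak_sol T d F G a b u v \<longleftrightarrow>
     u \<in> L2V T V02 norm2 \<and> v \<in> L2V T H01 norm1 \<and> CL2 T u \<and> CL2 T v \<and>
     (AE x in lebesgue_on Om. u 0 x = a x) \<and> (AE x in lebesgue_on Om. v 0 x = b x) \<and>
     (\<forall>\<phi>\<in>V02. \<forall>\<psi>. test_fun {0<..<T} \<psi> \<longrightarrow>
        (LINT t|lebesgue_on {0<..<T}. ip (u t) \<phi> * deriv \<psi> t) =
        (LINT t|lebesgue_on {0<..<T}. (ip (wd (wd (u t))) (wd (wd \<phi>)) - ip (F t) \<phi>) * \<psi> t)) \<and>
     (\<forall>\<phi>\<in>V02. \<forall>\<psi>. test_fun {0<..<T} \<psi> \<longrightarrow>
        (LINT t|lebesgue_on {0<..<T}. ip (v t) \<phi> * deriv \<psi> t) =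
        (LINT t|lebesgue_on {0<..<T}. (ip (\<lambda>x. d x * wd (v t) x) (wd \<phi>) - ip (G t) \<phi>) * \<psi> t))"

definition forward_sol where
  "forward_sol T d u0 v0 u v \<longleftrightarrow> weak_sol T d v (\<lambda>t x. 0) u0 v0 u v"

text \<open>adjoint problem: -p_t + p_xxxx = 0, -q_t - (d q_x)_x = p, p(T)=pT, q(T)=qT;
  defined via time reversal t -> T - t\<close>
definition adjoint_sol where
  "adjoint_sol T d pT qT p q \<longleftrightarrow>
     weak_sol T d (\<lambda>t x. 0) (\<lambda>t. p (T - t)) pT qT (\<lambda>t. p (T - t)) (\<lambda>t. q (T - t))"

text \<open>The Tikhonov functional, evaluated with the state (u,v) belonging to d\<close>
definition Jgam :: "real \<Rightarrow> real \<Rightarrow> (real \<Rightarrow> real) \<Rightarrow> (real \<Rightarrow> real) \<Rightarrow> (real \<Rightarrow> real)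
     \<Rightarrow> (real \<Rightarrow> real \<Rightarrow> real) \<Rightarrow> (real \<Rightarrow> real \<Rightarrow> real) \<Rightarrow> real" where
  "Jgam T \<gamma> m1 m2 d u v =
     (LINT x|lebesgue_on Om. (u T x - m1 x)\<^sup>2) / 2 + (LINT x|lebesgue_on Om. (v T x - m2 x)\<^sup>2) / 2
     + \<gamma> / 2 * (norm1 d)\<^sup>2"

end

theory Submission
  imports Defs
begin

text \<open>
  Write \<open>U = u' - u\<close>, \<open>W = v' - v\<close>. Everything is read off from the sine coefficients
  \<open>(f, s\<^sub>n)\<close>, \<open>s\<^sub>n = sqrt 2 sin ((n+1) \<pi> x)\<close>: each \<open>s\<^sub>n\<close> is an admissible test function, so the
  du Bois-Reymond lemma turns the weak equations into scalar linear ODEs with integrable right-hand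
  side. For the fourth-order equation they decouple, \<open>u\<^sub>n' = v\<^sub>n - \<mu>\<^sub>n\<^sup>4 u\<^sub>n\<close> and
  \<open>p\<^sub>n' = \<mu>\<^sub>n\<^sup>4 p\<^sub>n\<close>, hence \<open>(U\<^sub>n p\<^sub>n)' = W\<^sub>n p\<^sub>n\<close>. For the second-order equation the product rule
  for \<open>W\<^sub>n q\<^sub>n\<close> is summed over \<open>n\<close>; since \<open>\<mu>\<^sub>n (f, s\<^sub>n)\<close> are the cosine coefficients of \<open>f'\<close> for \<open>f\<close>
  vanishing at both ends, Parseval's identity for the cosine basis and dominated convergence give
  Green's formula without any regularity in time.
  Adding both identities, \<open>(U(T), p(T)) + (W(T), q(T)) = - \<integral> (q\<^sub>x, \<delta> v'\<^sub>x) dt\<close>, which equals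
  \<open>(\<Lambda>, \<delta>)\<close> in \<open>H\<^sup>1\<close> up to \<open>\<integral> (q\<^sub>x, \<delta> W\<^sub>x) dt\<close>. The energy identity for \<open>W\<close>, the embedding of
  \<open>H\<^sup>1\<close> into bounded functions and Poincare's inequality bound the remainder by \<open>C \<parallel>\<delta>\<parallel>\<^sup>2\<close>.

  No joint measurability in \<open>(t, x)\<close> of \<open>wd (v t) x\<close> is available, because \<open>wd\<close> chooses a
  representative for each \<open>t\<close> separately; only the scalar functions \<open>ip (wd (v t)) h\<close> are used, which
  are limits of partial Parseval sums.
\<close>

section \<open>Smooth test functions\<close>

text \<open>The coupling is one-way: \<open>v\<close> drives \<open>u\<close> and nothing returns.
  Hence the estimate for \<open>W\<close> closes on its own, and \<open>U\<close> is controlled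
  afterwards through its source \<open>W\<close>. The remainder is quadratic because two first-order
  quantities meet in it: the sup norm of the perturbation and the space-time norm of
  \<open>W_x\<close>, itself of first order by the energy estimate. The constant must not depend on
  the perturbation, so the only norm of the perturbed solution that may enter is one bounded by the
  data: the energy identity bounds \<open>v'_x\<close> through \<open>v0\<close> and the lower bound
  \<open>a0\<close> alone. The usual route to energy and duality identities uses time derivatives in
  dual spaces and the Lions-Magenes integration by parts. Testing with one mode at a time leaves
  scalar absolutely continuous functions instead, and the continuity in time in \<open>CL2\<close>
  gives the values at times 0 and T a meaning. The adjoint source is chosen so that the two
  integrals of \<open>W p\<close> cancel when the identities are added.\<close>

definition smooth :: "(real \<Rightarrow> real) \<Rightarrow> bool" where
  "smooth f \<longleftrightarrow> (\<forall>k x. ((deriv ^^ k) f has_real_derivative (deriv ^^ Suc k) f x) (at x))"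

text \<open>All iterated derivatives of \<open>f\<close> stay in \<open>S\<close> by induction.
  Closure properties of smooth functions thus need only an invariant set, never a formula for the
  k-th derivative.\<close>

lemma smooth_coinduct:
  assumes "f \<in> S"
    and "\<And>g. g \<in> S \<Longrightarrow> \<exists>g'\<in>S. \<forall>x. (g has_real_derivative g' x) (at x)"
  shows "smooth f"
proof -
  have d: "deriv g \<in> S \<and> (\<forall>x. (g has_real_derivative deriv g x) (at x))" if g: "g \<in> S" for g
  proof -
    obtain g' where g': "g' \<in> S" "\<And>x. (g has_real_derivative g' x) (at x)"
      using assms(2)[OF g] by blast
    then have "deriv g = g'" by (intro ext DERIV_imp_deriv)
    with g' show ?thesis by simp
  qed
  have "(deriv ^^ k) f \<in> S" for k
    by (induction k) (use assms(1) d in auto)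
  with d show ?thesis unfolding smooth_def by simp
qed

lemma smooth_has_derivative: "smooth f \<Longrightarrow> (f has_real_derivative deriv f x) (at x)"
  unfolding smooth_def by (drule spec[of _ 0]) simp

lemma smooth_deriv: "smooth f \<Longrightarrow> smooth (deriv f)"
proof -
  have "(deriv ^^ k) (deriv f) = (deriv ^^ Suc k) f" for k
    by (simp only: funpow_Suc_right o_apply)
  then show "smooth f \<Longrightarrow> smooth (deriv f)" unfolding smooth_def by (metis funpow.simps(2) o_apply)
qed

lemma smooth_continuous_on: "smooth f \<Longrightarrow> continuous_on A f"
  using smooth_has_derivative by (meson DERIV_isCont continuous_at_imp_continuous_on)

lemma smooth_affine:
  assumes "smooth f" shows "smooth (\<lambda>x. f (m * x + b))"
proof (rule smooth_coinduct)
  \<comment> \<open>The factor \<open>r\<close> collects the powers of \<open>m\<close> that the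
    chain rule produces.\<close>
  let ?S = "{\<lambda>x. r * f (m * x + b) | r f. smooth f}"
  show "(\<lambda>x. f (m * x + b)) \<in> ?S"
    using assms by (auto intro!: exI[of _ 1] exI[of _ f])
  fix g assume "g \<in> ?S"
  then obtain r h where h: "smooth h" and g: "g = (\<lambda>x. r * h (m * x + b))" by blast
  have "(g has_real_derivative (r * m) * deriv h (m * x + b)) (at x)" for x
  proof -
    have "((\<lambda>x. h (m * x + b)) has_real_derivative deriv h (m * x + b) * m) (at x)"
      by (rule DERIV_chain2[OF smooth_has_derivative[OF h]]) (auto intro!: derivative_eq_intros)
    from DERIV_cmult[OF this, of r] show ?thesis by (simp add: g mult_ac)
  qed
  moreover have "(\<lambda>x. (r * m) * deriv h (m * x + b)) \<in> ?S"
    using smooth_deriv[OF h] by blast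
  ultimately show "\<exists>g'\<in>?S. \<forall>x. (g has_real_derivative g' x) (at x)"
    by (intro bexI[of _ "\<lambda>x. (r * m) * deriv h (m * x + b)"]) auto
qed

text \<open>The Leibniz rule turns one product into a sum of two, so products alone are not closed
  under differentiation; their finite sums are, and serve as invariant set in
  \<open>smooth_coinduct\<close>.\<close>

inductive_set product_sums :: "(real \<Rightarrow> real) set" where
  prod: "smooth f \<Longrightarrow> smooth g \<Longrightarrow> (\<lambda>x. f x * g x) \<in> product_sums"
| sum: "f \<in> product_sums \<Longrightarrow> g \<in> product_sums \<Longrightarrow> (\<lambda>x. f x + g x) \<in> product_sums"

lemma product_sums_deriv:
  "f \<in> product_sums \<Longrightarrow> \<exists>f'\<in>product_sums. \<forall>x. (f has_real_derivative f' x) (at x)"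
proof (induction rule: product_sums.induct)
  case (prod f g)
  have "((\<lambda>x. f x * g x) has_real_derivative (deriv f x * g x + f x * deriv g x)) (at x)" for x
    using DERIV_mult[OF smooth_has_derivative[OF prod(1)] smooth_has_derivative[OF prod(2)]]
    by (simp add: mult_ac)
  then show ?case
    using prod by (intro bexI[of _ "\<lambda>x. deriv f x * g x + f x * deriv g x"])
      (auto intro!: product_sums.intros smooth_deriv)
next
  case (sum f g)
  then obtain f' g' where "f' \<in> product_sums" "g' \<in> product_sums"
    "\<forall>x. (f has_real_derivative f' x) (at x)" "\<forall>x. (g has_real_derivative g' x) (at x)" by blast
  then show ?case
    by (intro bexI[of _ "\<lambda>x. f' x + g' x"]) (auto intro!: product_sums.sum DERIV_add)
qed

lemma smooth_const: "smooth (\<lambda>x. c)"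
  by (rule smooth_coinduct[of _ "range (\<lambda>c x. c)"]) (auto intro!: exI[of _ 0])

lemma smooth_mult: "smooth f \<Longrightarrow> smooth g \<Longrightarrow> smooth (\<lambda>x. f x * g x)"
  by (rule smooth_coinduct[OF product_sums.prod product_sums_deriv])

text \<open>Writing the sum as f * 1 + g * 1 puts it into \<open>product_sums\<close>.\<close>

lemma smooth_add: "smooth f \<Longrightarrow> smooth g \<Longrightarrow> smooth (\<lambda>x. f x + g x)"
proof (rule smooth_coinduct[OF _ product_sums_deriv])
  assume "smooth f" "smooth g"
  then show "(\<lambda>x. f x + g x) \<in> product_sums"
    using product_sums.sum[OF product_sums.prod[OF _ smooth_const[of 1]] product_sums.prod[OF _ smooth_const[of 1]]]
    by simp
qed

lemma smooth_antiderivative: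
  assumes "smooth f" "\<And>x. (F has_real_derivative f x) (at x)"
  shows "smooth F"
proof (rule smooth_coinduct[of _ "insert F {g. smooth g}"])
  fix g assume "g \<in> insert F {g. smooth g}"
  then show "\<exists>g'\<in>insert F {g. smooth g}. \<forall>x. (g has_real_derivative g' x) (at x)"
    using assms smooth_deriv smooth_has_derivative by blast
qed auto

section \<open>Flat exponentials and bump functions\<close>

lemma poly_mult_exp_tendsto_0:
  fixes c :: real assumes c: "c > 0"
  shows "((\<lambda>y. poly q y * exp (- (c * y))) \<longlongrightarrow> 0) at_top"
proof -
  have mono: "((\<lambda>y. y ^ k * exp (- (c * y))) \<longlongrightarrow> 0) at_top" for k
  proof -
    have "filterlim (\<lambda>y. c * y) at_top at_top"
      using c by (intro filterlim_tendsto_pos_mult_at_top[OF tendsto_const]) (auto simp: filterlim_ident)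
    from filterlim_compose[OF tendsto_power_div_exp_0[of k] this]
    have "((\<lambda>y. (1 / c ^ k) * ((c * y) ^ k / exp (c * y))) \<longlongrightarrow> (1 / c ^ k) * 0) at_top"
      by (intro tendsto_mult tendsto_const)
    moreover have "(1 / c ^ k) * ((c * y) ^ k / exp (c * y)) = y ^ k * exp (- (c * y))" for y
      using c by (simp add: power_mult_distrib exp_minus field_simps)
    ultimately show ?thesis by simp
  qed
  have "((\<lambda>y. \<Sum>i\<le>degree q. coeff q i * (y ^ i * exp (- (c * y)))) \<longlongrightarrow> (\<Sum>i\<le>degree q. coeff q i * 0)) at_top"
    by (intro tendsto_sum tendsto_mult tendsto_const mono)
  then show ?thesis by (simp add: poly_altdef sum_distrib_right mult.assoc)
qed

text \<open>With y = 1/x, differentiating p(y) exp(-c y) in x gives y^2 (c p - p')(y) exp(-c y),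
  which has the same form with another polynomial. At 0 the difference quotient vanishes in the
  limit because exponential decay beats every polynomial.\<close>

lemma flat_exp_has_derivative:
  fixes c :: real assumes c: "c > 0"
  defines "E \<equiv> \<lambda>p x. if x > 0 then poly p (1 / x) * exp (- (c * (1 / x))) else 0"
  shows "(E p has_real_derivative E ([:0, 0, 1:] * (smult c p - pderiv p)) x) (at x)"
proof (cases "x = 0")
  case False
  show ?thesis
  proof (cases "x > 0")
    case True
    have "((\<lambda>x. poly p (1 / x) * exp (- (c * (1 / x)))) has_real_derivative
        E ([:0, 0, 1:] * (smult c p - pderiv p)) x) (at x)"
      using True unfolding E_def
      by (auto intro!: derivative_eq_intros simp: field_simps power2_eq_square)
    then show ?thesis
      by (rule has_field_derivative_transform_within_open[where S="{0<..}"])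
        (use True in \<open>auto simp: E_def\<close>)
  next
    case x: False
    have "((\<lambda>x. 0) has_real_derivative 0) (at x)" by simp
    then show ?thesis
      unfolding E_def
      by (rule has_field_derivative_transform_within_open[where S="{..<0}" and f="\<lambda>x. 0", THEN DERIV_cong])
        (use x \<open>x \<noteq> 0\<close> in auto)
  qed
next
  case True
  have r: "((\<lambda>y. E p y / y) \<longlongrightarrow> 0) (at_right 0)"
  proof -
    \<comment> \<open>In the variable 1/x, dividing by x multiplies the polynomial by its
      variable.\<close>
    have "((\<lambda>y. poly ([:0, 1:] * p) y * exp (- (c * y))) \<longlongrightarrow> 0) at_top"
      by (rule poly_mult_exp_tendsto_0[OF c])
    from filterlim_compose[OF this filterlim_inverse_at_top_right]
    show ?thesis
      by (rule Lim_transform_eventually)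
        (auto simp: E_def eventually_at_filter field_simps intro!: always_eventually)
  qed
  have l: "((\<lambda>y. E p y / y) \<longlongrightarrow> 0) (at_left 0)"
    by (rule Lim_transform_eventually[OF tendsto_const])
      (auto simp: E_def eventually_at_filter intro!: always_eventually)
  from r l have "((\<lambda>y. E p y / y) \<longlongrightarrow> 0) (at 0)"
    by (simp add: filterlim_split_at)
  then have "((\<lambda>y. (E p y - E p 0) / (y - 0)) \<longlongrightarrow> 0) (at 0)" by (simp add: E_def)
  then show ?thesis
    unfolding True by (simp add: has_field_derivative_iff E_def)
qed

lemma smooth_flat_exp:
  fixes c :: real assumes c: "c > 0"
  shows "smooth (\<lambda>x. if x > 0 then exp (- (c * (1 / x))) else 0)"
proof (rule smooth_coinduct)
  let ?E = "\<lambda>p x. if x > 0 then poly p (1 / x) * exp (- (c * (1 / x))) else 0"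
  show "(\<lambda>x. if x > 0 then exp (- (c * (1 / x))) else 0) \<in> range ?E"
    by (rule image_eqI[of _ _ 1]) auto
  fix g assume "g \<in> range ?E"
  then obtain p where "g = ?E p" by blast
  then show "\<exists>g'\<in>range ?E. \<forall>x. (g has_real_derivative g' x) (at x)"
    using flat_exp_has_derivative[OF c, of p]
    by (intro bexI[of _ "?E ([:0, 0, 1:] * (smult c p - pderiv p))"]) auto
qed

text \<open>A nonempty compact subset of the open interval attains its infimum and supremum, so the
  support fits into some \<open>{a..b}\<close> strictly inside. For empty \<open>K\<close> the
  single point T/2 serves.\<close>

lemma test_fun_alt:
  "test_fun {0<..<T} \<phi> \<longleftrightarrow> smooth \<phi> \<and> (\<exists>a b. 0 < a \<and> b < T \<and> a \<le> b \<and> (\<forall>x. x \<notin> {a..b} \<longrightarrow> \<phi> x = 0))"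
  if "T > 0" for T
proof
  assume "test_fun {0<..<T} \<phi>"
  then obtain K where s: "smooth \<phi>" and K: "compact K" "K \<subseteq> {0<..<T}" "\<And>x. x \<notin> K \<Longrightarrow> \<phi> x = 0"
    unfolding test_fun_def smooth_def by blast
  show "smooth \<phi> \<and> (\<exists>a b. 0 < a \<and> b < T \<and> a \<le> b \<and> (\<forall>x. x \<notin> {a..b} \<longrightarrow> \<phi> x = 0))"
  proof (cases "K = {}")
    case True
    then show ?thesis using K s that by (intro conjI exI[of _ "T/2"]) auto
  next
    case False
    obtain a where a: "a \<in> K" "\<And>x. x \<in> K \<Longrightarrow> a \<le> x" using compact_attains_inf[OF K(1) False] by blast
    obtain b where b: "b \<in> K" "\<And>x. x \<in> K \<Longrightarrow> x \<le> b" using compact_attains_sup[OF K(1) False] by blast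
    have "\<forall>x. x \<notin> {a..b} \<longrightarrow> \<phi> x = 0" using K(3) a b by (metis atLeastAtMost_iff)
    then show ?thesis using s a b K(2) by (intro conjI exI[of _ a] exI[of _ b]) auto
  qed
next
  assume "smooth \<phi> \<and> (\<exists>a b. 0 < a \<and> b < T \<and> a \<le> b \<and> (\<forall>x. x \<notin> {a..b} \<longrightarrow> \<phi> x = 0))"
  then obtain a b where "smooth \<phi>" "0 < a" "b < T" "\<forall>x. x \<notin> {a..b} \<longrightarrow> \<phi> x = 0" by blast
  then show "test_fun {0<..<T} \<phi>"
    unfolding test_fun_def smooth_def by (intro conjI exI[of _ "{a..b}"]) auto
qed

text \<open>One flat exponential for each endpoint. The parameter \<open>c\<close> sets the
  steepness: as c tends to 0 the bumps approach the indicator of the open interval, always below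
  1.\<close>

definition bump :: "real \<Rightarrow> real \<Rightarrow> real \<Rightarrow> real \<Rightarrow> real" where
  "bump a b c x = (if a < x \<and> x < b then exp (- (c / (x - a))) * exp (- (c / (b - x))) else 0)"

lemma smooth_bump:
  assumes "c > 0" shows "smooth (bump a b c)"
proof -
  let ?E = "\<lambda>x::real. if x > 0 then exp (- (c * (1 / x))) else 0"
  have "bump a b c = (\<lambda>x. ?E (1 * x + (-a)) * ?E ((-1) * x + b))"
    by (auto simp: bump_def fun_eq_iff)
  moreover have "smooth (\<lambda>x. ?E (1 * x + (-a)) * ?E ((-1) * x + b))"
    by (intro smooth_mult smooth_affine[of ?E] smooth_flat_exp assms)
  ultimately show ?thesis by (simp only:)
qed

lemma bump_nonneg: "0 \<le> bump a b c x"
  by (auto simp: bump_def)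

lemma bump_le_1: "c > 0 \<Longrightarrow> bump a b c x \<le> 1"
  by (auto simp: bump_def intro!: mult_le_one)

lemma test_fun_bump:
  assumes "c > 0" "0 < a" "a < b" "b < T"
  shows "test_fun {0<..<T} (bump a b c)"
proof -
  have "\<forall>x. x \<notin> {a..b} \<longrightarrow> bump a b c x = 0" by (auto simp: bump_def)
  moreover have "T > 0" using assms by simp
  ultimately show ?thesis
    using assms smooth_bump[of c a b] test_fun_alt[of T] less_imp_le[OF assms(3)] by blast
qed

lemma bump_tendsto_indicator:
  "(\<lambda>n. bump a b (1 / real (Suc n)) x) \<longlonglongrightarrow> indicat_real {a<..<b} x"
proof (cases "a < x \<and> x < b")
  case True
  have "(\<lambda>n. (1 / real (Suc n)) / r) \<longlonglongrightarrow> 0 / r" if "r > 0" for r :: real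
    using that by (intro tendsto_divide tendsto_const LIMSEQ_Suc[OF lim_1_over_n]) auto
  then have "(\<lambda>n. exp (- ((1 / real (Suc n)) / (x - a))) * exp (- ((1 / real (Suc n)) / (b - x)))) \<longlonglongrightarrow>
      exp (- (0 / (x - a))) * exp (- (0 / (b - x)))"
    using True by (intro tendsto_mult tendsto_exp tendsto_minus) auto
  then show ?thesis using True by (simp add: bump_def)
next
  case False
  then have "bump a b c x = 0" for c by (auto simp: bump_def)
  moreover have "indicat_real {a<..<b} x = 0" using False by auto
  ultimately show ?thesis by simp
qed

section \<open>Indefinite integrals and the product rule\<close>

abbreviation Iv :: "real \<Rightarrow> real measure" where "Iv T \<equiv> lebesgue_on {0<..<T}"

lemma finite_measure_Iv: "finite_measure (Iv T)"
  by (simp add: finite_measure_lebesgue_on)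

lemma integrable_Iv_const: "integrable (Iv T) (\<lambda>x. c)"
  by (rule finite_measure.integrable_const[OF finite_measure_Iv])

lemma integrable_bounded_mult:
  fixes h k :: "'a \<Rightarrow> real"
  assumes h: "integrable M h" and k: "k \<in> borel_measurable M" and B: "AE x in M. \<bar>k x\<bar> \<le> B"
  shows "integrable M (\<lambda>x. k x * h x)"
proof (rule Bochner_Integration.integrable_bound)
  show "integrable M (\<lambda>x. B * h x)" using h by simp
  show "(\<lambda>x. k x * h x) \<in> borel_measurable M" using h k by simp
  show "AE x in M. norm (k x * h x) \<le> norm (B * h x)"
    using B by eventually_elim (auto simp: abs_mult intro!: mult_right_mono)
qed

lemma borel_measurable_Iv: "f \<in> borel_measurable borel \<Longrightarrow> f \<in> borel_measurable (Iv T)"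
  by (metis measurable_completion measurable_lborel2 measurable_restrict_space1)

lemma integrable_Iv_continuous:
  fixes f :: "real \<Rightarrow> real"
  assumes "continuous_on {0..T} f" shows "integrable (Iv T) f"
proof -
  have "integrable (lebesgue_on {0..T}) f" using assms by (rule continuous_imp_integrable_real)
  then have "set_integrable lebesgue {0..T} f"
    by (simp add: set_integrable_def integrable_restrict_space)
  then have "set_integrable lebesgue {0<..<T} f"
    by (rule set_integrable_subset) auto
  then show ?thesis by (simp add: set_integrable_def integrable_restrict_space)
qed

lemma bounded_continuous_Iv:
  fixes f :: "real \<Rightarrow> real"
  assumes "continuous_on {0..T} f"
  obtains B where "\<And>x. x \<in> {0..T} \<Longrightarrow> \<bar>f x\<bar> \<le> B"
proof -
  have "bounded (f ` {0..T})"
    using compact_continuous_image[OF assms] compact_imp_bounded by blast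
  then obtain B where "\<forall>x\<in>{0..T}. \<bar>f x\<bar> \<le> B" unfolding bounded_iff by auto
  then show ?thesis using that by blast
qed

lemma integrable_mult_continuous_Iv:
  fixes f h :: "real \<Rightarrow> real"
  assumes "continuous_on {0..T} f" "integrable (Iv T) h" shows "integrable (Iv T) (\<lambda>x. f x * h x)"
proof -
  obtain B where "\<And>x. x \<in> {0..T} \<Longrightarrow> \<bar>f x\<bar> \<le> B" using bounded_continuous_Iv[OF assms(1)] by blast
  then have "AE x in Iv T. \<bar>f x\<bar> \<le> B" by (intro AE_I2) auto
  then show ?thesis
    using integrable_bounded_mult[OF assms(2)] integrable_Iv_continuous[OF assms(1)] by blast
qed

text \<open>The indicator keeps the measure \<open>Iv T\<close> the same for all \<open>t\<close>,
  so dominated convergence and Fubini apply directly. Outside \<open>{0..T}\<close> the function is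
  continued by constants.\<close>

definition indef :: "real \<Rightarrow> (real \<Rightarrow> real) \<Rightarrow> real \<Rightarrow> real" where
  "indef T f t = (LINT s|Iv T. indicat_real {..<t} s * f s)"

lemma integrable_indicator_mult:
  fixes f :: "real \<Rightarrow> real"
  shows "integrable (Iv T) f \<Longrightarrow> A \<in> sets borel \<Longrightarrow> integrable (Iv T) (\<lambda>s. indicat_real A s * f s)"
  by (rule integrable_bounded_mult[where B=1]) (auto intro!: borel_measurable_Iv)

lemma indef_eq:
  assumes "t \<in> {0..T}" shows "indef T f t = (LINT s|Iv t. f s)"
proof -
  have "indef T f t = (LINT s|Iv T. (if s \<in> {..<t} then f s else 0))"
    unfolding indef_def by (rule Bochner_Integration.integral_cong) auto
  also have "\<dots> = integral\<^sup>L (lebesgue_on ({..<t} \<inter> {0<..<T})) f"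
    by (rule Lebesgue_Measure.integral_restrict_Int) auto
  also have "{..<t} \<inter> {0<..<T} = {0<..<t}" using assms by auto
  finally show ?thesis .
qed

lemma indef_0: "indef T f 0 = 0"
  by (simp add: indef_eq indef_def) (rule integral_eq_zero_AE, auto intro!: AE_I2)

lemma indef_T: "indef T f T = (LINT s|Iv T. f s)"
  unfolding indef_def by (rule Bochner_Integration.integral_cong) auto

text \<open>Dominated convergence with majorant |f|: the indicators converge at every point except
  the limit \<open>a\<close> itself, a null set.\<close>

lemma continuous_on_indef:
  assumes f: "integrable (Iv T) f" shows "continuous_on A (indef T f)"
  unfolding continuous_on_sequentially o_def
proof safe
  fix X :: "nat \<Rightarrow> real" and a assume X: "X \<longlonglongrightarrow> a"
  show "(\<lambda>n. indef T f (X n)) \<longlonglongrightarrow> indef T f a"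
    unfolding indef_def
  proof (rule integral_dominated_convergence[where w="\<lambda>s. \<bar>f s\<bar>"])
    show "(\<lambda>s. indicat_real {..<a} s * f s) \<in> borel_measurable (Iv T)"
      by (intro borel_measurable_integrable integrable_indicator_mult f) auto
    show "(\<lambda>s. indicat_real {..<X n} s * f s) \<in> borel_measurable (Iv T)" for n
      by (intro borel_measurable_integrable integrable_indicator_mult f) auto
    show "integrable (Iv T) (\<lambda>s. \<bar>f s\<bar>)" using f by simp
    have "AE s in lebesgue. s \<noteq> a" by (rule AE_completion) (rule AE_lborel_singleton)
    then have "AE s in Iv T. s \<noteq> a" by (subst AE_restrict_space_iff) auto
    then show "AE s in Iv T. (\<lambda>n. indicat_real {..<X n} s * f s) \<longlonglongrightarrow> indicat_real {..<a} s * f s"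
    proof eventually_elim
      fix s assume "s \<noteq> a"
      then have "\<forall>\<^sub>F n in sequentially. indicat_real {..<X n} s = indicat_real {..<a} s"
      proof (cases "s < a")
        case True
        then have "\<forall>\<^sub>F n in sequentially. s < X n" using X by (simp add: order_tendstoD)
        then show ?thesis by eventually_elim (use True in auto)
      next
        case False
        then have "\<forall>\<^sub>F n in sequentially. X n < s" using X \<open>s \<noteq> a\<close> by (simp add: order_tendstoD)
        then show ?thesis by eventually_elim (use False in auto)
      qed
      then have "\<forall>\<^sub>F n in sequentially. indicat_real {..<a} s * f s = indicat_real {..<X n} s * f s"
        by eventually_elim simp
      then show "(\<lambda>n. indicat_real {..<X n} s * f s) \<longlonglongrightarrow> indicat_real {..<a} s * f s"
        by (rule Lim_transform_eventually[OF tendsto_const])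
    qed
  qed (auto simp: indicator_def)
qed

text \<open>Fubini on the square, cut along the diagonal into the triangles s < r and r < s; the
  diagonal is negligible. This is integration by parts without any derivative.\<close>

lemma indef_mult_integrals:
  assumes f: "integrable (Iv T) f" and g: "integrable (Iv T) g"
  shows "(LINT s|Iv T. f s) * (LINT s|Iv T. g s) =
    (LINT s|Iv T. f s * indef T g s) + (LINT s|Iv T. indef T f s * g s)"
proof -
  interpret M: finite_measure "Iv T" by (rule finite_measure_Iv)
  interpret P: pair_sigma_finite "Iv T" "Iv T" ..
  have [measurable]: "f \<in> borel_measurable (Iv T)" "g \<in> borel_measurable (Iv T)" using f g by auto
  have [measurable]: "(\<lambda>x. x) \<in> borel_measurable (Iv T)" by (rule borel_measurable_Iv) simp
  have fi: "fst \<in> borel_measurable (Iv T \<Otimes>\<^sub>M Iv T)"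
    using measurable_compose[OF measurable_fst, of "\<lambda>x. x" "Iv T" borel "Iv T"] by simp
  have sn: "snd \<in> borel_measurable (Iv T \<Otimes>\<^sub>M Iv T)"
    using measurable_compose[OF measurable_snd, of "\<lambda>x. x" "Iv T" borel "Iv T"] by simp
  have ind: "(\<lambda>z. indicat_real {..<snd z} (fst z)) \<in> borel_measurable (Iv T \<Otimes>\<^sub>M Iv T)"
  proof -
    have "(\<lambda>z. indicat_real {..<snd z} (fst z)) = (\<lambda>z. if fst z < snd z then 1 else 0)"
      by (auto simp: indicator_def)
    also have "\<dots> \<in> borel_measurable (Iv T \<Otimes>\<^sub>M Iv T)"
      using fi sn by measurable
    finally show ?thesis .
  qed
  let ?H = "\<lambda>s r. indicat_real {..<r} s * f s * g r"
  have int: "integrable (Iv T \<Otimes>\<^sub>M Iv T) (\<lambda>(s, r). ?H s r)"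
  proof (rule P.Fubini_integrable)
    show m: "(\<lambda>(s, r). ?H s r) \<in> borel_measurable (Iv T \<Otimes>\<^sub>M Iv T)"
      unfolding case_prod_unfold using ind by measurable
    have "integrable (Iv T) (\<lambda>s. \<bar>f s\<bar> * (LINT r|Iv T. \<bar>g r\<bar>))" using f by simp
    then show "integrable (Iv T) (\<lambda>s. LINT r|Iv T. norm ((\<lambda>(s, r). ?H s r) (s, r)))"
    proof (rule Bochner_Integration.integrable_bound)
      show "(\<lambda>s. LINT r|Iv T. norm ((\<lambda>(s, r). ?H s r) (s, r))) \<in> borel_measurable (Iv T)"
        using m by measurable
      show "AE s in Iv T. norm (LINT r|Iv T. norm ((\<lambda>(s, r). ?H s r) (s, r)))
          \<le> norm (\<bar>f s\<bar> * (LINT r|Iv T. \<bar>g r\<bar>))"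
      proof (intro AE_I2)
        fix s
        have "(LINT r|Iv T. norm (?H s r)) \<le> (LINT r|Iv T. \<bar>f s\<bar> * \<bar>g r\<bar>)"
          by (rule integral_mono') (use g in \<open>auto simp: indicator_def abs_mult\<close>)
        then show "norm (LINT r|Iv T. norm ((\<lambda>(s, r). ?H s r) (s, r)))
          \<le> norm (\<bar>f s\<bar> * (LINT r|Iv T. \<bar>g r\<bar>))"
          by (simp add: abs_mult)
      qed
    qed
    show "AE s in Iv T. integrable (Iv T) (\<lambda>r. (\<lambda>(s, r). ?H s r) (s, r))"
    proof (intro AE_I2)
      fix s
      \<comment> \<open>For fixed \<open>s\<close> the triangle is read as a condition on
        \<open>r\<close>.\<close>
      have eq: "?H s r = indicat_real {s<..} r * (f s * g r)" for r by (auto simp: indicator_def)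
      have "integrable (Iv T) (\<lambda>r. ?H s r)" unfolding eq
        by (rule integrable_indicator_mult) (use g in auto)
      then show "integrable (Iv T) (\<lambda>r. (\<lambda>(s, r). ?H s r) (s, r))" by simp
    qed
  qed
  have "(LINT r|Iv T. indef T f r * g r) = (LINT r|Iv T. LINT s|Iv T. ?H s r)"
    unfolding indef_def by simp
  also have "\<dots> = (LINT s|Iv T. LINT r|Iv T. ?H s r)"
    by (rule P.Fubini_integral[OF int])
  also have "\<dots> = (LINT s|Iv T. f s * (LINT r|Iv T. g r) - f s * indef T g s)"
  proof (rule Bochner_Integration.integral_cong[OF refl])
    fix s :: real
    have "AE r in lebesgue. r \<noteq> s" by (rule AE_completion) (rule AE_lborel_singleton)
    then have ae: "AE r in Iv T. r \<noteq> s" by (subst AE_restrict_space_iff) auto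
    have "(LINT r|Iv T. ?H s r) = (LINT r|Iv T. f s * g r - f s * (indicat_real {..<s} r * g r))"
      using ae by (intro integral_cong_AE) (auto simp: indicator_def intro!: borel_measurable_Iv)
    also have "\<dots> = f s * (LINT r|Iv T. g r) - f s * indef T g s"
      unfolding indef_def using g integrable_indicator_mult[OF g, of "{..<s}"]
      by simp
    finally show "(LINT r|Iv T. ?H s r) = f s * (LINT r|Iv T. g r) - f s * indef T g s" .
  qed
  also have "\<dots> = (LINT s|Iv T. f s) * (LINT r|Iv T. g r) - (LINT s|Iv T. f s * indef T g s)"
    using f integrable_mult_continuous_Iv[OF continuous_on_indef[OF g] f]
    by (simp add: mult_ac)
  finally show ?thesis by simp
qed

text \<open>Absolute continuity in integrated form: \<open>F\<close> has density \<open>f\<close> on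
  \<open>{0..T}\<close>. Stating F' = f this way avoids Lebesgue differentiation altogether.\<close>

definition prim :: "real \<Rightarrow> (real \<Rightarrow> real) \<Rightarrow> (real \<Rightarrow> real) \<Rightarrow> bool" where
  "prim T F f \<longleftrightarrow> integrable (Iv T) f \<and> (\<forall>t\<in>{0..T}. F t = F 0 + indef T f t)"

lemma primI:
  "integrable (Iv T) f \<Longrightarrow> (\<And>t. t \<in> {0..T} \<Longrightarrow> F t = F 0 + indef T f t) \<Longrightarrow> prim T F f"
  unfolding prim_def by blast

lemma prim_integrable: "prim T F f \<Longrightarrow> integrable (Iv T) f"
  unfolding prim_def by blast

lemma prim_eq: "prim T F f \<Longrightarrow> t \<in> {0..T} \<Longrightarrow> F t = F 0 + indef T f t"
  unfolding prim_def by blast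

lemma prim_T: "prim T F f \<Longrightarrow> T > 0 \<Longrightarrow> F T = F 0 + (LINT s|Iv T. f s)"
  using prim_eq[of T F f T] by (simp add: indef_T)

lemma prim_continuous: 
  assumes "prim T F f" shows "continuous_on {0..T} F"
proof -
  have "continuous_on {0..T} (\<lambda>t. F 0 + indef T f t)"
    by (intro continuous_intros continuous_on_indef prim_integrable[OF assms])
  then show ?thesis by (rule continuous_on_eq) (rule prim_eq[OF assms, symmetric])
qed

lemma prim_indef: "integrable (Iv T) f \<Longrightarrow> prim T (indef T f) f"
  by (rule primI) (simp_all add: indef_0)

lemma prim_cong_AE:
  assumes "prim T F f" "AE t in Iv T. f t = g t" "g \<in> borel_measurable (Iv T)"
  shows "prim T F g"
proof -
  have f: "integrable (Iv T) f" using assms(1) by (rule prim_integrable)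
  have g: "integrable (Iv T) g" using integrable_cong_AE_imp[OF f assms(3)] assms(2) by (simp add: eq_commute)
  have "indef T f t = indef T g t" for t
    unfolding indef_def using assms(2)
    by (intro integral_cong_AE borel_measurable_integrable integrable_indicator_mult f g) auto
  then have "F t = F 0 + indef T g t" if "t \<in> {0..T}" for t using prim_eq[OF assms(1) that] by simp
  then show ?thesis using g by (intro primI)
qed

lemma indef_diff:
  "integrable (Iv T) f \<Longrightarrow> integrable (Iv T) g \<Longrightarrow> indef T (\<lambda>t. f t - g t) t = indef T f t - indef T g t"
  unfolding indef_def right_diff_distrib
  by (rule Bochner_Integration.integral_diff) (auto intro!: integrable_indicator_mult)

lemma prim_diff:
  "prim T F f \<Longrightarrow> prim T G g \<Longrightarrow> prim T (\<lambda>t. F t - G t) (\<lambda>t. f t - g t)"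
proof (rule primI)
  assume F: "prim T F f" and G: "prim T G g"
  then show "integrable (Iv T) (\<lambda>t. f t - g t)" by (auto dest: prim_integrable)
  fix t assume "t \<in> {0..T}"
  then show "F t - G t = F 0 - G 0 + indef T (\<lambda>t. f t - g t) t"
    using prim_eq[OF F, of t] prim_eq[OF G, of t] indef_diff[OF prim_integrable[OF F] prim_integrable[OF G]]
    by simp
qed

text \<open>Insert F(T) = F(0) + integral of f, and likewise for G. The only nontrivial term is the
  product of two integrals, which \<open>indef_mult_integrals\<close> splits.\<close>

lemma prim_mult:
  assumes F: "prim T F f" and G: "prim T G g" and T: "T > 0"
  shows "F T * G T - F 0 * G 0 = (LINT t|Iv T. f t * G t + F t * g t)"
proof -
  have f: "integrable (Iv T) f" and g: "integrable (Iv T) g" using F G by (auto dest: prim_integrable)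
  have "F T * G T - F 0 * G 0 = F 0 * (LINT s|Iv T. g s) + (LINT s|Iv T. f s) * G 0
      + (LINT s|Iv T. f s) * (LINT s|Iv T. g s)"
    by (simp add: prim_T[OF F T] prim_T[OF G T] algebra_simps)
  also have "\<dots> = (LINT s|Iv T. F 0 * g s + f s * G 0 + (f s * indef T g s + indef T f s * g s))"
    unfolding indef_mult_integrals[OF f g]
    using f g integrable_mult_continuous_Iv[OF continuous_on_indef[OF g] f]
      integrable_mult_continuous_Iv[OF continuous_on_indef[OF f] g]
    by (simp add: mult_ac)
  also have "\<dots> = (LINT t|Iv T. f t * G t + F t * g t)"
  proof (rule Bochner_Integration.integral_cong[OF refl])
    fix x assume "x \<in> space (Iv T)"
    then have "F x = F 0 + indef T f x" "G x = G 0 + indef T g x"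
      using prim_eq[OF F, of x] prim_eq[OF G, of x] by auto
    then show "F 0 * g x + f x * G 0 + (f x * indef T g x + indef T f x * g x) = f x * G x + F x * g x"
      by (simp add: algebra_simps)
  qed
  finally show ?thesis .
qed

lemma prim_C1:
  assumes T: "T > 0" and F: "\<And>x. x \<in> {0..T} \<Longrightarrow> (F has_real_derivative f x) (at x within {0..T})"
    and f: "continuous_on {0..T} f"
  shows "prim T F f"
proof (rule primI)
  show "integrable (Iv T) f" using f by (rule integrable_Iv_continuous)
  fix t assume t: "t \<in> {0..T}"
  have "(f has_integral (F t - F 0)) {0..t}"
  proof (rule fundamental_theorem_of_calculus)
    fix x assume x: "x \<in> {0..t}"
    then have "(F has_real_derivative f x) (at x within {0..t})"
      using t by (intro DERIV_subset[OF F[of x]]) auto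
    then show "(F has_vector_derivative f x) (at x within {0..t})"
      by (simp add: has_real_derivative_iff_has_vector_derivative)
  qed (use t in auto)
  then have i: "(f has_integral (F t - F 0)) {0<..<t}" by (simp add: has_integral_Icc_iff_Ioo)
  have "integrable (Iv t) f"
    by (rule integrable_Iv_continuous, rule continuous_on_subset[OF f]) (use t in auto)
  then have "(LINT s|Iv t. f s) = F t - F 0"
    using i by (simp add: lebesgue_integral_eq_integral integral_unique)
  then show "F t = F 0 + indef T f t" using indef_eq[OF t] by simp
qed

section \<open>The du Bois-Reymond lemma\<close>

lemma test_fun_prim:
  assumes "T > 0" "test_fun {0<..<T} \<psi>"
  shows "prim T \<psi> (deriv \<psi>)" "\<psi> 0 = 0" "\<psi> T = 0" "continuous_on {0..T} \<psi>" "continuous_on {0..T} (deriv \<psi>)"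
proof -
  have s: "smooth \<psi>" using assms by (simp add: test_fun_alt)
  obtain a b where "0 < a" "b < T" "\<forall>x. x \<notin> {a..b} \<longrightarrow> \<psi> x = 0" using assms by (auto simp: test_fun_alt)
  then show "\<psi> 0 = 0" "\<psi> T = 0" by auto
  show "continuous_on {0..T} \<psi>" "continuous_on {0..T} (deriv \<psi>)"
    using s smooth_deriv smooth_continuous_on by blast+
  then show "prim T \<psi> (deriv \<psi>)"
    using smooth_has_derivative[OF s] assms(1)
    by (intro prim_C1) (auto intro: has_field_derivative_at_within)
qed

text \<open>A primitive is constant to the left and to the right of the support, and mean zero makes
  the two constants equal; subtracting that constant restores compact support.\<close>

lemma test_fun_antiderivative:
  assumes T: "T > 0" and \<phi>: "test_fun {0<..<T} \<phi>" and 0: "(LINT t|Iv T. \<phi> t) = 0"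
  obtains \<psi> where "test_fun {0<..<T} \<psi>" "deriv \<psi> = \<phi>"
proof -
  have s: "smooth \<phi>" using assms by (simp add: test_fun_alt)
  obtain a b where ab: "0 < a" "b < T" "a \<le> b" and z: "\<And>x. x \<notin> {a..b} \<Longrightarrow> \<phi> x = 0"
    using assms by (auto simp: test_fun_alt)
  have "isCont \<phi> x" for x using smooth_has_derivative[OF s] DERIV_isCont by blast
  then obtain F where "\<forall>x::real. - \<infinity> < ereal x \<longrightarrow> ereal x < \<infinity> \<longrightarrow> (F has_vector_derivative \<phi> x) (at x)"
    using einterval_antiderivative[of "-\<infinity>" "\<infinity>" \<phi>] by auto
  then have F: "(F has_real_derivative \<phi> x) (at x)" for x
    by (simp add: has_real_derivative_iff_has_vector_derivative)
  have const: "F x = F y" if "\<And>z. z \<in> {min x y<..<max x y} \<Longrightarrow> \<phi> z = 0" for x y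
  proof -
    have *: "F p = F q" if "p < q" "\<And>z. z \<in> {p<..<q} \<Longrightarrow> \<phi> z = 0" for p q
    proof -
      obtain \<xi> where "p < \<xi>" "\<xi> < q" "F q - F p = (q - p) * \<phi> \<xi>"
        using MVT2[of p q F \<phi>] F \<open>p < q\<close> by blast
      then show ?thesis using \<open>\<And>z. z \<in> {p<..<q} \<Longrightarrow> \<phi> z = 0\<close> by auto
    qed
    show ?thesis
    proof (cases x y rule: linorder_cases)
      case less
      then show ?thesis using that by (intro *) auto
    next
      case greater
      then have "F y = F x" using that by (intro *) auto
      then show ?thesis by simp
    qed simp
  qed
  have "prim T F \<phi>"
    using F T s by (intro prim_C1) (auto intro: has_field_derivative_at_within smooth_continuous_on)
  from prim_T[OF this T] 0 have FT: "F T = F 0" by simp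
  let ?\<psi> = "\<lambda>x. F x - F 0"
  have d: "(?\<psi> has_real_derivative \<phi> x) (at x)" for x
    using DERIV_diff[OF F DERIV_const[of "F 0"]] by simp
  have "?\<psi> x = 0" if "x \<notin> {a..b}" for x
  proof (cases "x < a")
    case True
    then have "F x = F 0" using ab by (intro const z) auto
    then show ?thesis by simp
  next
    case False
    then have "F x = F T" using ab that by (intro const z) auto
    then show ?thesis using FT by simp
  qed
  moreover have "smooth ?\<psi>" using smooth_antiderivative[OF s d] .
  ultimately have "test_fun {0<..<T} ?\<psi>" using ab T by (subst test_fun_alt) blast+
  moreover have "deriv ?\<psi> = \<phi>" using d by (intro ext DERIV_imp_deriv)
  ultimately show ?thesis using that by blast
qed

lemma test_fun_mult_diff:
  assumes "T > 0" "test_fun {0<..<T} \<phi>" "test_fun {0<..<T} \<eta>"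
  shows "test_fun {0<..<T} (\<lambda>x. \<phi> x - c * \<eta> x)"
proof -
  obtain a b where 1: "smooth \<phi>" "0 < a" "b < T" "a \<le> b" "\<forall>x. x \<notin> {a..b} \<longrightarrow> \<phi> x = 0"
    using assms by (auto simp: test_fun_alt)
  obtain a' b' where 2: "smooth \<eta>" "0 < a'" "b' < T" "a' \<le> b'" "\<forall>x. x \<notin> {a'..b'} \<longrightarrow> \<eta> x = 0"
    using assms by (auto simp: test_fun_alt)
  have "smooth (\<lambda>x. \<phi> x + (- c) * \<eta> x)"
    by (intro smooth_add smooth_mult smooth_const 1 2)
  moreover have "\<forall>x. x \<notin> {min a a'..max b b'} \<longrightarrow> \<phi> x - c * \<eta> x = 0"
    using 1(5) 2(5) by (auto simp: min_le_iff_disj le_max_iff_disj)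
  moreover have "0 < min a a'" "max b b' < T" "min a a' \<le> max b b'" using 1 2 by auto
  ultimately show ?thesis
    unfolding test_fun_alt[OF assms(1)] by (intro conjI exI[of _ "min a a'"] exI[of _ "max b b'"]) auto
qed

text \<open>Bump functions are admissible and converge boundedly to indicators. They need an
  interval with closure inside \<open>{0<..<T}\<close>, so general intervals are reached by a second
  limit.\<close>

lemma integral_interval_eq_0:
  assumes T: "T > 0" and h: "integrable (Iv T) h"
    and 0: "\<And>\<phi>. test_fun {0<..<T} \<phi> \<Longrightarrow> (LINT t|Iv T. h t * \<phi> t) = 0"
  shows "(LINT t|Iv T. indicat_real {a<..<b} t * h t) = 0"
proof -
  have inner: "(LINT t|Iv T. indicat_real {a<..<b} t * h t) = 0" if ab: "0 < a" "b < T" for a b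
  proof (cases "a < b")
    case True
    have "(\<lambda>n. LINT t|Iv T. bump a b (1 / real (Suc n)) t * h t) \<longlonglongrightarrow> (LINT t|Iv T. indicat_real {a<..<b} t * h t)"
    proof (rule integral_dominated_convergence[where w="\<lambda>s. \<bar>h s\<bar>"])
      show "(\<lambda>t. indicat_real {a<..<b} t * h t) \<in> borel_measurable (Iv T)"
        by (intro borel_measurable_integrable integrable_indicator_mult h) auto
      show "(\<lambda>t. bump a b (1 / real (Suc n)) t * h t) \<in> borel_measurable (Iv T)" for n
        by (intro borel_measurable_integrable integrable_mult_continuous_Iv h smooth_continuous_on smooth_bump) auto
      show "AE t in Iv T. (\<lambda>n. bump a b (1 / real (Suc n)) t * h t) \<longlonglongrightarrow> indicat_real {a<..<b} t * h t"
        by (intro AE_I2 tendsto_mult tendsto_const bump_tendsto_indicator)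
      show "AE t in Iv T. norm (bump a b (1 / real (Suc n)) t * h t) \<le> \<bar>h t\<bar>" for n
        using bump_nonneg[of a b "1 / real (Suc n)"] bump_le_1[of "1 / real (Suc n)" a b]
        by (intro AE_I2) (auto simp: abs_mult intro!: mult_left_le_one_le)
    qed (use h in auto)
    moreover have "(LINT t|Iv T. bump a b (1 / real (Suc n)) t * h t) = 0" for n
      using 0[OF test_fun_bump[of "1 / real (Suc n)" a b T]] ab True by (simp add: mult.commute)
    ultimately show ?thesis by (simp add: LIMSEQ_const_iff)
  qed (auto simp: indicator_def)
  \<comment> \<open>Cutting 1/(n+1) off both ends of \<open>{0<..<T}\<close> keeps
    \<open>A n\<close> strictly inside; at each fixed \<open>t\<close> the indicator is eventually
    the right one.\<close>
  define A where "A = (\<lambda>n. {max a (1 / real (Suc n))<..<min b (T - 1 / real (Suc n))})"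
  have "(\<lambda>n. LINT t|Iv T. indicat_real (A n) t * h t) \<longlonglongrightarrow> (LINT t|Iv T. indicat_real {a<..<b} t * h t)"
  proof (rule integral_dominated_convergence[where w="\<lambda>s. \<bar>h s\<bar>"])
    show "(\<lambda>t. indicat_real {a<..<b} t * h t) \<in> borel_measurable (Iv T)"
      by (intro borel_measurable_integrable integrable_indicator_mult h) auto
    show "(\<lambda>t. indicat_real (A n) t * h t) \<in> borel_measurable (Iv T)" for n
      unfolding A_def by (intro borel_measurable_integrable integrable_indicator_mult h) auto
    show "AE t in Iv T. (\<lambda>n. indicat_real (A n) t * h t) \<longlonglongrightarrow> indicat_real {a<..<b} t * h t"
    proof (intro AE_I2)
      fix t assume "t \<in> space (Iv T)"
      then have t: "0 < t" "t < T" by auto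
      have lim: "(\<lambda>n. 1 / real (Suc n)) \<longlonglongrightarrow> 0" by (rule LIMSEQ_Suc[OF lim_1_over_n])
      have "\<forall>\<^sub>F n in sequentially. 1 / real (Suc n) < t" "\<forall>\<^sub>F n in sequentially. 1 / real (Suc n) < T - t"
        using order_tendstoD(2)[OF lim] t by auto
      then have "\<forall>\<^sub>F n in sequentially. indicat_real {a<..<b} t * h t = indicat_real (A n) t * h t"
        by eventually_elim (use t in \<open>auto simp: A_def indicator_def\<close>)
      then show "(\<lambda>n. indicat_real (A n) t * h t) \<longlonglongrightarrow> indicat_real {a<..<b} t * h t"
        by (rule Lim_transform_eventually[OF tendsto_const])
    qed
  qed (use h in \<open>auto simp: indicator_def\<close>)
  moreover have "(LINT t|Iv T. indicat_real (A n) t * h t) = 0" for n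
    unfolding A_def by (rule inner) (auto simp: less_max_iff_disj min_less_iff_disj)
  ultimately show ?thesis by (simp add: LIMSEQ_const_iff)
qed

text \<open>Dynkin's argument: the sets over which \<open>h\<close> integrates to 0 contain the open
  intervals, which are stable under intersection, and are closed under complements and disjoint
  unions, so they include all Borel sets. A Lebesgue set agrees almost everywhere with its Borel
  \<open>main_part\<close>. Uniqueness of densities finishes the proof.\<close>

theorem fundamental_lemma:
  assumes T: "T > 0" and h: "integrable (Iv T) h"
    and 0: "\<And>\<phi>. test_fun {0<..<T} \<phi> \<Longrightarrow> (LINT t|Iv T. h t * \<phi> t) = 0"
  shows "AE t in Iv T. h t = 0"
proof -
  let ?G = "range (\<lambda>(a, b). {a<..<b::real})"
  have borel: "sets borel = sigma_sets UNIV ?G"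
  proof -
    have "(\<lambda>(a, b). {a<..<b::real}) = (\<lambda>(a, b). box a b)" by (auto simp: box_real)
    then have "borel = sigma UNIV ?G" using borel_eq_box[where 'a=real] by (simp only:)
    then show ?thesis by (metis sets_measure_of subset_UNIV Pow_UNIV)
  qed
  have borel0: "(LINT t|Iv T. indicat_real A t * h t) = 0" if "A \<in> sets borel" for A
  proof -
    have A: "A \<in> sigma_sets UNIV ?G"
      using that by (simp add: borel)
    have "Int_stable ?G"
      by (auto simp: Int_stable_def intro!: image_eqI[where x="(max _ _, min _ _)"])
    moreover have "?G \<subseteq> Pow UNIV" by simp
    ultimately show ?thesis using A
    proof (induction rule: sigma_sets_induct_disjoint)
      case (basic A)
      then show ?case using integral_interval_eq_0[OF T h 0] by auto
    next
      case (compl A)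
      then have A: "A \<in> sets borel" by (simp add: borel)
      have "(LINT t|Iv T. indicat_real (UNIV - A) t * h t) =
        (LINT t|Iv T. indicat_real {0<..<T} t * h t - indicat_real A t * h t)"
        by (rule Bochner_Integration.integral_cong) (auto simp: indicator_def)
      also have "\<dots> = 0"
        using integral_interval_eq_0[OF T h 0, of 0 T] compl(2)
          integrable_indicator_mult[OF h, of "{0<..<T}"] integrable_indicator_mult[OF h A] by simp
      finally show ?case .
    next
      case (union A)
      have A: "A i \<in> sets borel" for i
        using union(2) by (auto simp: borel)
      have "(\<lambda>n. LINT t|Iv T. (\<Sum>i<n. indicat_real (A i) t * h t)) \<longlonglongrightarrow> (LINT t|Iv T. indicat_real (\<Union>i. A i) t * h t)"
      proof (rule integral_dominated_convergence[where w="\<lambda>s. \<bar>h s\<bar>"])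
        show "(\<lambda>t. indicat_real (\<Union>i. A i) t * h t) \<in> borel_measurable (Iv T)"
          using A by (intro borel_measurable_integrable integrable_indicator_mult h) auto
        show "(\<lambda>t. \<Sum>i<n. indicat_real (A i) t * h t) \<in> borel_measurable (Iv T)" for n
          by (intro borel_measurable_sum borel_measurable_integrable integrable_indicator_mult h A)
        show "AE t in Iv T. (\<lambda>n. \<Sum>i<n. indicat_real (A i) t * h t) \<longlonglongrightarrow> indicat_real (\<Union>i. A i) t * h t"
          using sums_mult2[OF indicator_sums[of A]] union(1)
          by (intro AE_I2) (auto simp: sums_def disjoint_family_on_def)
        show "AE t in Iv T. norm (\<Sum>i<n. indicat_real (A i) t * h t) \<le> \<bar>h t\<bar>" for n
        proof (intro AE_I2)
          fix t
          have "(\<Sum>i<n. indicat_real (A i) t) = indicat_real (\<Union>i<n. A i) t"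
            using union(1) by (subst indicator_UN_disjoint) (auto intro: disjoint_family_on_mono)
          then have "(\<Sum>i<n. indicat_real (A i) t * h t) = indicat_real (\<Union>i<n. A i) t * h t"
            by (simp add: sum_distrib_right[symmetric])
          then show "norm (\<Sum>i<n. indicat_real (A i) t * h t) \<le> \<bar>h t\<bar>" by (auto simp: indicator_def)
        qed
      qed (use h in auto)
      moreover have "(LINT t|Iv T. (\<Sum>i<n. indicat_real (A i) t * h t)) = 0" for n
        using union(3) integrable_indicator_mult[OF h A] by (subst Bochner_Integration.integral_sum) auto
      ultimately show ?case by (simp add: LIMSEQ_const_iff)
    qed auto
  qed
  have "(\<integral>x\<in>A. h x \<partial>(Iv T)) = (\<integral>x\<in>A. 0 \<partial>(Iv T))" if "A \<in> sets (Iv T)" for A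
  proof -
    have A: "A \<in> sets lebesgue" using that by (auto simp: sets_restrict_space)
    define B where "B = main_part lborel A"
    have B: "B \<in> sets borel" unfolding B_def using main_part_sets[OF A] by simp
    have "AE x in lebesgue. x \<in> B \<longleftrightarrow> x \<in> A"
      unfolding B_def by (rule AE_completion) (rule AE_in_main_part[OF A])
    then have ae: "AE x in Iv T. x \<in> B \<longleftrightarrow> x \<in> A" by (subst AE_restrict_space_iff) auto
    have "(\<integral>x\<in>A. h x \<partial>(Iv T)) = (LINT x|Iv T. indicat_real B x * h x)"
      unfolding set_lebesgue_integral_def
    proof (rule integral_cong_AE)
      show "(\<lambda>x. indicat_real B x * h x) \<in> borel_measurable (Iv T)"
        by (intro borel_measurable_integrable integrable_indicator_mult h B)
      show "AE x in Iv T. indicat_real A x *\<^sub>R h x = indicat_real B x * h x"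
        using ae by eventually_elim (auto simp: indicator_def)
    qed (use that h in auto)
    with borel0[OF B] show ?thesis by simp
  qed
  with density_unique_real[OF h, of "\<lambda>x. 0"] show ?thesis by simp
qed

text \<open>The difference \<open>h\<close> of \<open>f\<close> and the primitive of
  \<open>g\<close> annihilates all derivatives of test functions. Subtracting the multiple m of a
  fixed bump \<open>b\<close> gives any test function mean zero, hence makes it such a derivative;
  so h - c annihilates every test function, with c the \<open>b\<close>-weighted mean of
  \<open>h\<close>.\<close>

theorem du_Bois_Reymond:
  assumes T: "T > 0" and f: "integrable (Iv T) f" and g: "integrable (Iv T) g"
    and eq: "\<And>\<psi>. test_fun {0<..<T} \<psi> \<Longrightarrow> (LINT t|Iv T. f t * deriv \<psi> t) = - (LINT t|Iv T. g t * \<psi> t)"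
  shows "\<exists>c. AE t in Iv T. f t = c + indef T g t"
proof -
  define h where "h = (\<lambda>t. f t - indef T g t)"
  have ic: "continuous_on {0..T} (indef T g)" by (rule continuous_on_indef[OF g])
  have h: "integrable (Iv T) h"
    unfolding h_def using f integrable_Iv_continuous[OF ic] by simp
  have h0: "(LINT t|Iv T. h t * deriv \<psi> t) = 0" if \<psi>: "test_fun {0<..<T} \<psi>" for \<psi>
  proof -
    note p = test_fun_prim[OF T \<psi>]
    have i: "integrable (Iv T) (\<lambda>t. g t * \<psi> t)" "integrable (Iv T) (\<lambda>t. f t * deriv \<psi> t)"
      using integrable_mult_continuous_Iv[OF p(4) g] integrable_mult_continuous_Iv[OF p(5) f]
      by (simp_all add: mult.commute)
    have i': "integrable (Iv T) (\<lambda>t. indef T g t * deriv \<psi> t)"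
      by (intro integrable_Iv_continuous continuous_intros ic p)
    have "0 = (LINT t|Iv T. g t * \<psi> t + indef T g t * deriv \<psi> t)"
      using prim_mult[OF prim_indef[OF g] p(1) T] p(2,3) by simp
    then have "(LINT t|Iv T. indef T g t * deriv \<psi> t) = - (LINT t|Iv T. g t * \<psi> t)"
      using i i' by simp
    then show ?thesis
      unfolding h_def left_diff_distrib using i i' eq[OF \<psi>] by simp
  qed
  define b where "b = bump (T/3) (2*T/3) 1"
  have b: "test_fun {0<..<T} b" unfolding b_def by (rule test_fun_bump) (use T in auto)
  note bc = test_fun_prim(4)[OF T b]
  define B where "B = (LINT t|Iv T. b t)"
  have ib: "integrable (Iv T) b" using bc by (rule integrable_Iv_continuous)
  have B: "B \<noteq> 0"
  proof
    assume "B = 0"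
    then have "AE t in Iv T. b t = 0"
      using integral_nonneg_eq_0_iff_AE[OF ib] bump_nonneg unfolding B_def b_def by auto
    then have "AE t in lebesgue. t \<in> {0<..<T} \<longrightarrow> b t = 0" by (subst (asm) AE_restrict_space_iff) auto
    then have "AE t in lebesgue. t \<notin> {T/3<..<2*T/3}"
      by eventually_elim (use T in \<open>auto simp: b_def bump_def\<close>)
    then have "{T/3<..<2*T/3} \<in> null_sets lebesgue"
      by (simp add: completion.null_sets_iff_AE)
    then have "emeasure lebesgue {T/3<..<2*T/3} = 0" by auto
    then show False using T by simp
  qed
  define c where "c = (LINT t|Iv T. h t * b t) / B"
  have "AE t in Iv T. h t - c = 0"
  proof (rule fundamental_lemma[OF T])
    show "integrable (Iv T) (\<lambda>t. h t - c)" by (intro Bochner_Integration.integrable_diff h integrable_Iv_const)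
    fix \<phi> assume \<phi>: "test_fun {0<..<T} \<phi>"
    note \<phi>c = test_fun_prim(4)[OF T \<phi>]
    have i\<phi>: "integrable (Iv T) \<phi>" using \<phi>c by (rule integrable_Iv_continuous)
    define m where "m = (LINT t|Iv T. \<phi> t) / B"
    have t: "test_fun {0<..<T} (\<lambda>t. \<phi> t - m * b t)" by (rule test_fun_mult_diff[OF T \<phi> b])
    have "(LINT t|Iv T. \<phi> t - m * b t) = 0"
      using i\<phi> ib B by (simp add: m_def B_def)
    from test_fun_antiderivative[OF T t this] obtain \<psi>
      where \<psi>: "test_fun {0<..<T} \<psi>" "deriv \<psi> = (\<lambda>t. \<phi> t - m * b t)" by blast
    have i: "integrable (Iv T) (\<lambda>t. h t * \<phi> t)" "integrable (Iv T) (\<lambda>t. h t * b t)"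
      using integrable_mult_continuous_Iv[OF \<phi>c h] integrable_mult_continuous_Iv[OF bc h]
      by (simp_all add: mult.commute)
    have "0 = (LINT t|Iv T. h t * \<phi> t - m * (h t * b t))"
      using h0[OF \<psi>(1)] \<psi>(2) by (simp add: algebra_simps)
    also have "\<dots> = (LINT t|Iv T. h t * \<phi> t) - m * (LINT t|Iv T. h t * b t)"
      using i by simp
    also have "m * (LINT t|Iv T. h t * b t) = c * (LINT t|Iv T. \<phi> t)"
      using B by (simp add: m_def c_def)
    finally show "(LINT t|Iv T. (h t - c) * \<phi> t) = 0"
      unfolding left_diff_distrib using i i\<phi> by simp
  qed
  then have "AE t in Iv T. f t = c + indef T g t"
    by eventually_elim (simp add: h_def)
  then show ?thesis ..
qed

text \<open>A nonempty open set is not negligible, so the points of agreement are dense, and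
  continuity carries the equality to all points including both endpoints.\<close>

lemma continuous_AE_eq:
  fixes f g :: "real \<Rightarrow> real"
  assumes T: "T > 0" and f: "continuous_on {0..T} f" and g: "continuous_on {0..T} g"
    and ae: "AE t in Iv T. f t = g t" and t: "t \<in> {0..T}"
  shows "f t = g t"
proof -
  let ?N = "{t \<in> {0<..<T}. f t \<noteq> g t}"
  have "AE t in lebesgue. t \<in> {0<..<T} \<longrightarrow> f t = g t" using ae by (subst (asm) AE_restrict_space_iff) auto
  then have "AE t in lebesgue. t \<notin> ?N" by eventually_elim auto
  then have n: "negligible ?N"
    by (simp add: negligible_iff_null_sets completion.null_sets_iff_AE)
  have "{0<..<T} \<subseteq> closure ({0<..<T} - ?N)"
  proof (rule ccontr)
    assume "\<not> ?thesis"
    then have "open ({0<..<T} - closure ({0<..<T} - ?N))" "{0<..<T} - closure ({0<..<T} - ?N) \<noteq> {}"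
      by (auto intro: open_Diff)
    moreover have "{0<..<T} - closure ({0<..<T} - ?N) \<subseteq> ?N"
      using closure_subset[of "{0<..<T} - ?N"] by blast
    then have "negligible ({0<..<T} - closure ({0<..<T} - ?N))" using negligible_subset[OF n] by blast
    ultimately show False using open_not_negligible by blast
  qed
  then have "closure {0<..<T} \<subseteq> closure ({0<..<T} - ?N)" by (simp add: closure_minimal)
  then have t': "t \<in> closure ({0<..<T} - ?N)" using t T by auto
  have sub: "closure ({0<..<T} - ?N) \<subseteq> {0..T}"
    by (rule closure_minimal) auto
  have "continuous_on (closure ({0<..<T} - ?N)) (\<lambda>t. f t - g t)"
    by (intro continuous_on_subset[OF _ sub] continuous_intros f g)
  from continuous_constant_on_closure[OF this _ t', of 0] show ?thesis by auto
qed

text \<open>Continuity upgrades the almost-everywhere representation to every time; this is what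
  makes initial and terminal values usable in \<open>prim_mult\<close>.\<close>

lemma prim_of_weak_derivative:
  assumes T: "T > 0" and F: "continuous_on {0..T} F" and g: "integrable (Iv T) g"
    and eq: "\<And>\<psi>. test_fun {0<..<T} \<psi> \<Longrightarrow> (LINT t|Iv T. F t * deriv \<psi> t) = - (LINT t|Iv T. g t * \<psi> t)"
  shows "prim T F g"
proof -
  obtain c where c: "AE t in Iv T. F t = c + indef T g t"
    using du_Bois_Reymond[OF T integrable_Iv_continuous[OF F] g eq] by blast
  have *: "F t = c + indef T g t" if "t \<in> {0..T}" for t
    by (rule continuous_AE_eq[OF T F _ c that]) (intro continuous_intros continuous_on_indef g)
  have "F 0 = c" using *[of 0] T by (simp add: indef_0)
  then show ?thesis using * g by (intro primI) auto
qed

section \<open>The space of square integrable functions\<close>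

text \<open>Completeness of Lebesgue measure. It is needed throughout because functions of time
  built from \<open>wd\<close> can be identified only almost everywhere.\<close>

lemma borel_measurable_lebesgue_on_AE:
  fixes f g :: "real \<Rightarrow> real"
  assumes f: "f \<in> borel_measurable (lebesgue_on S)" and ae: "AE x in lebesgue_on S. f x = g x"
    and S: "S \<in> sets lebesgue"
  shows "g \<in> borel_measurable (lebesgue_on S)"
proof -
  have "(\<lambda>x. if x \<in> S then f x else 0) \<in> borel_measurable lebesgue" using f S by (rule borel_measurable_if_I)
  moreover have "AE x in lebesgue. (if x \<in> S then f x else 0) = (if x \<in> S then g x else 0)"
    using ae S by (subst (asm) AE_restrict_space_iff) (auto elim: eventually_mono)
  ultimately have "(\<lambda>x. if x \<in> S then g x else 0) \<in> borel_measurable lebesgue" by (rule borel_measurable_AE)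
  then show ?thesis by (rule borel_measurable_if_D)
qed

lemma borel_measurable_LIMSEQ_AE:
  fixes f :: "nat \<Rightarrow> real \<Rightarrow> real"
  assumes f: "\<And>n. f n \<in> borel_measurable (lebesgue_on S)"
    and lim: "AE x in lebesgue_on S. (\<lambda>n. f n x) \<longlonglongrightarrow> g x" and S: "S \<in> sets lebesgue"
  shows "g \<in> borel_measurable (lebesgue_on S)"
proof (rule borel_measurable_lebesgue_on_AE[OF _ _ S])
  show "(\<lambda>x. lim (\<lambda>n. f n x)) \<in> borel_measurable (lebesgue_on S)"
    using f by (rule borel_measurable_lim_metric)
  show "AE x in lebesgue_on S. lim (\<lambda>n. f n x) = g x"
    using lim by eventually_elim (rule limI)
qed

lemma Om_Iv: "lebesgue_on Om = Iv 1"
  by (simp add: Om_def)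

lemma Om_sets [simp]: "Om \<in> sets lebesgue"
  by (simp add: Om_def)

lemma L2D: "f \<in> L2 \<Longrightarrow> f \<in> borel_measurable (lebesgue_on Om)" "f \<in> L2 \<Longrightarrow> integrable (lebesgue_on Om) (\<lambda>x. (f x)\<^sup>2)"
  by (simp_all add: L2_def)

lemma L2_integrable_mult:
  assumes "f \<in> L2" "g \<in> L2" shows "integrable (lebesgue_on Om) (\<lambda>x. f x * g x)"
proof (rule Bochner_Integration.integrable_bound)
  show "integrable (lebesgue_on Om) (\<lambda>x. (f x)\<^sup>2 + (g x)\<^sup>2)" using assms L2D by auto
  show "(\<lambda>x. f x * g x) \<in> borel_measurable (lebesgue_on Om)" using assms L2D by auto
  have "\<bar>a * b\<bar> \<le> a\<^sup>2 + b\<^sup>2" for a b :: real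
  proof -
    have "2 * \<bar>a\<bar> * \<bar>b\<bar> \<le> a\<^sup>2 + b\<^sup>2" using sum_squares_bound[of "\<bar>a\<bar>" "\<bar>b\<bar>"] by simp
    moreover have "0 \<le> \<bar>a\<bar> * \<bar>b\<bar>" by simp
    ultimately show ?thesis unfolding abs_mult by linarith
  qed
  then show "AE x in lebesgue_on Om. norm (f x * g x) \<le> norm ((f x)\<^sup>2 + (g x)\<^sup>2)"
    by (intro AE_I2) simp
qed

lemma L2_bounded_mult:
  assumes "f \<in> L2" "d \<in> borel_measurable (lebesgue_on Om)" "AE x in lebesgue_on Om. \<bar>d x\<bar> \<le> B"
  shows "(\<lambda>x. d x * f x) \<in> L2"
proof -
  have "AE x in lebesgue_on Om. \<bar>(d x)\<^sup>2\<bar> \<le> B\<^sup>2"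
    using assms(3) by eventually_elim (metis abs_ge_zero abs_power2 power2_abs power_mono)
  then have "integrable (lebesgue_on Om) (\<lambda>x. (d x)\<^sup>2 * (f x)\<^sup>2)"
    using assms(2) L2D(2)[OF assms(1)] by (intro integrable_bounded_mult[where B="B\<^sup>2"]) auto
  then show ?thesis using assms(2) L2D(1)[OF assms(1)] by (simp add: L2_def power_mult_distrib)
qed

lemma L2_continuous: "continuous_on {0..1} f \<Longrightarrow> f \<in> L2"
  unfolding L2_def Om_Iv
  by (auto intro!: integrable_Iv_continuous borel_measurable_integrable continuous_intros)

lemma L2_cmult: "f \<in> L2 \<Longrightarrow> (\<lambda>x. c * f x) \<in> L2"
  by (rule L2_bounded_mult[where B="\<bar>c\<bar>"]) auto

lemma L2_add: 
  assumes "f \<in> L2" "g \<in> L2" shows "(\<lambda>x. f x + g x) \<in> L2"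
  using L2D[OF assms(1)] L2D[OF assms(2)] L2_integrable_mult[OF assms]
  unfolding L2_def by (auto simp: power2_sum mult.assoc)

lemma L2_diff: 
  assumes "f \<in> L2" "g \<in> L2" shows "(\<lambda>x. f x - g x) \<in> L2"
  using L2_add[OF assms(1) L2_cmult[OF assms(2), of "-1"]] by simp

lemma L2_sum: "(\<And>k. k \<in> A \<Longrightarrow> f k \<in> L2) \<Longrightarrow> (\<lambda>x. \<Sum>k\<in>A. f k x) \<in> L2"
  by (induction A rule: infinite_finite_induct) (auto intro: L2_add L2_continuous)

lemma L2_cong_AE:
  assumes "f \<in> L2" "AE x in lebesgue_on Om. f x = g x" shows "g \<in> L2"
proof -
  have g: "g \<in> borel_measurable (lebesgue_on Om)"
    using borel_measurable_lebesgue_on_AE[OF L2D(1)] assms by simp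
  moreover have "integrable (lebesgue_on Om) (\<lambda>x. (g x)\<^sup>2)"
    using assms g L2D(2)[OF assms(1)]
    by (intro integrable_cong_AE_imp[where g="\<lambda>x. (f x)\<^sup>2" and f="\<lambda>x. (g x)\<^sup>2"]) auto
  ultimately show ?thesis by (simp add: L2_def)
qed

lemma L2_imp_integrable: "f \<in> L2 \<Longrightarrow> integrable (Iv 1) f"
  using L2_integrable_mult[of f "\<lambda>x. 1"] L2_continuous[of "\<lambda>x. 1"] by (simp add: Om_Iv)

lemma ip_commute: "ip f g = ip g f"
  by (simp add: ip_def mult.commute)

lemma ip_add_left: "f \<in> L2 \<Longrightarrow> g \<in> L2 \<Longrightarrow> h \<in> L2 \<Longrightarrow> ip (\<lambda>x. f x + g x) h = ip f h + ip g h"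
  unfolding ip_def distrib_right by (intro Bochner_Integration.integral_add L2_integrable_mult)

lemma ip_diff_left: "f \<in> L2 \<Longrightarrow> g \<in> L2 \<Longrightarrow> h \<in> L2 \<Longrightarrow> ip (\<lambda>x. f x - g x) h = ip f h - ip g h"
  unfolding ip_def left_diff_distrib by (intro Bochner_Integration.integral_diff L2_integrable_mult)

lemma ip_add_right: "f \<in> L2 \<Longrightarrow> g \<in> L2 \<Longrightarrow> h \<in> L2 \<Longrightarrow> ip h (\<lambda>x. f x + g x) = ip h f + ip h g"
  by (simp add: ip_add_left ip_commute[of h])

lemma ip_diff_right: "f \<in> L2 \<Longrightarrow> g \<in> L2 \<Longrightarrow> h \<in> L2 \<Longrightarrow> ip h (\<lambda>x. f x - g x) = ip h f - ip h g"
  by (simp add: ip_diff_left ip_commute[of h])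

lemma ip_cmult_left: "ip (\<lambda>x. c * f x) g = c * ip f g"
  by (simp add: ip_def mult.assoc)

lemma ip_cmult_right: "ip f (\<lambda>x. c * g x) = c * ip f g"
  by (simp add: ip_cmult_left ip_commute[of f])

lemma ip_minus_left: "ip (\<lambda>x. - f x) g = - ip f g"
  by (simp add: ip_def)

lemma ip_sum_left:
  "(\<And>k. k \<in> A \<Longrightarrow> f k \<in> L2) \<Longrightarrow> g \<in> L2 \<Longrightarrow> ip (\<lambda>x. \<Sum>k\<in>A. f k x) g = (\<Sum>k\<in>A. ip (f k) g)"
  unfolding ip_def sum_distrib_right
  by (intro Bochner_Integration.integral_sum L2_integrable_mult)

lemma ip_cong_AE:
  assumes "AE x in lebesgue_on Om. f x = f' x" "AE x in lebesgue_on Om. g x = g' x"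
    and "f \<in> L2" "g \<in> L2"
  shows "ip f g = ip f' g'"
proof -
  have "f' \<in> L2" "g' \<in> L2" using assms L2_cong_AE by blast+
  then show ?thesis
    unfolding ip_def using assms L2D by (intro integral_cong_AE) auto
qed

lemma ip_ge_0: "0 \<le> ip f f"
  unfolding ip_def by (rule integral_nonneg_AE) auto

lemma ip_power2: "ip f f = (LINT x|lebesgue_on Om. (f x)\<^sup>2)"
  by (simp add: ip_def power2_eq_square)

lemma ip_square_add: "f \<in> L2 \<Longrightarrow> g \<in> L2 \<Longrightarrow>
   ip (\<lambda>x. f x + g x) (\<lambda>x. f x + g x) = ip f f + 2 * ip f g + ip g g"
  by (simp add: ip_add_left ip_add_right L2_add ip_commute)

lemma ip_square_diff: "f \<in> L2 \<Longrightarrow> g \<in> L2 \<Longrightarrow>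
   ip (\<lambda>x. f x - g x) (\<lambda>x. f x - g x) = ip f f - 2 * ip f g + ip g g"
  by (simp add: ip_diff_left ip_diff_right L2_diff ip_commute)

text \<open>Young's inequality, from the square of sqrt r * f + s * g / sqrt r. The free weight
  \<open>r\<close> later lets a gradient term be absorbed by coercivity.\<close>

lemma ip_abs_le_weighted:
  assumes f: "f \<in> L2" and g: "g \<in> L2" and "r > 0"
  shows "2 * \<bar>ip f g\<bar> \<le> r * ip f f + ip g g / r"
proof -
  have r: "0 < sqrt r" "sqrt r * sqrt r = r" using assms by auto
  \<comment> \<open>The values s = 1 and s = -1 give the two signs of the absolute value.\<close>
  have "0 \<le> r * ip f f + 2 * s * ip f g + s\<^sup>2 * ip g g / r" for s
  proof -
    have "0 \<le> ip (\<lambda>x. sqrt r * f x + (s / sqrt r) * g x) (\<lambda>x. sqrt r * f x + (s / sqrt r) * g x)"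
      by (rule ip_ge_0)
    also have "\<dots> = sqrt r * (sqrt r * ip f f) + 2 * (sqrt r * ((s / sqrt r) * ip f g))
        + (s / sqrt r) * ((s / sqrt r) * ip g g)"
      by (simp only: ip_square_add L2_cmult f g ip_cmult_left ip_cmult_right)
    also have "\<dots> = r * ip f f + 2 * s * ip f g + s\<^sup>2 * ip g g / r"
      using r by (simp add: power2_eq_square mult.assoc[symmetric])
    finally show ?thesis .
  qed
  from this[of 1] this[of "-1"] show ?thesis by auto
qed

lemma ip_abs_le:
  assumes f: "f \<in> L2" and g: "g \<in> L2"
  shows "2 * \<bar>ip f g\<bar> \<le> ip f f + ip g g"
  using ip_abs_le_weighted[OF assms, of 1] by simp

lemma ip_square_add_le:
  assumes f: "f \<in> L2" and g: "g \<in> L2"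
  shows "ip (\<lambda>x. f x + g x) (\<lambda>x. f x + g x) \<le> 2 * ip f f + 2 * ip g g"
  using ip_abs_le[OF assms] by (simp add: ip_square_add assms)

lemma ip_square_diff_le:
  assumes f: "f \<in> L2" and g: "g \<in> L2"
  shows "ip (\<lambda>x. f x - g x) (\<lambda>x. f x - g x) \<le> 2 * ip f f + 2 * ip g g"
  using ip_abs_le[OF assms] by (simp add: ip_square_diff assms)

lemma ip_bounded_mult_le:
  assumes f: "f \<in> L2" and d: "d \<in> borel_measurable (lebesgue_on Om)" "AE x in lebesgue_on Om. (d x)\<^sup>2 \<le> B"
  shows "ip (\<lambda>x. d x * f x) (\<lambda>x. d x * f x) \<le> B * ip f f"
proof -
  have "ip (\<lambda>x. d x * f x) (\<lambda>x. d x * f x) = (LINT x|lebesgue_on Om. (d x)\<^sup>2 * (f x)\<^sup>2)"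
    by (simp add: ip_power2 power_mult_distrib)
  also have "\<dots> \<le> (LINT x|lebesgue_on Om. B * (f x)\<^sup>2)"
  proof (rule integral_mono_AE)
    have "AE x in lebesgue_on Om. \<bar>(d x)\<^sup>2\<bar> \<le> B" using d(2) by auto
    then show "integrable (lebesgue_on Om) (\<lambda>x. (d x)\<^sup>2 * (f x)\<^sup>2)"
      using L2D(2)[OF f] d(1) by (intro integrable_bounded_mult[where B=B]) auto
    show "integrable (lebesgue_on Om) (\<lambda>x. B * (f x)\<^sup>2)" using L2D(2)[OF f] by simp
    show "AE x in lebesgue_on Om. (d x)\<^sup>2 * (f x)\<^sup>2 \<le> B * (f x)\<^sup>2"
      using d(2) by eventually_elim (auto intro: mult_right_mono)
  qed
  finally show ?thesis by (simp add: ip_power2)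
qed

lemma ip_mult_move: "ip (\<lambda>x. d x * f x) g = ip f (\<lambda>x. d x * g x)"
  by (simp add: ip_def mult_ac)

section \<open>Orthonormal bases and Parseval's identity\<close>

definition onb :: "(nat \<Rightarrow> real \<Rightarrow> real) \<Rightarrow> bool" where
  "onb e \<longleftrightarrow> (\<forall>k. e k \<in> L2) \<and> (\<forall>j k. ip (e j) (e k) = (if j = k then 1 else 0)) \<and>
     (\<forall>f\<in>L2. \<forall>\<epsilon>>0. \<exists>N a. ip (\<lambda>x. f x - (\<Sum>k<N. a k * e k x)) (\<lambda>x. f x - (\<Sum>k<N. a k * e k x)) < \<epsilon>)"

text \<open>Completing the square: the error splits into the Fourier remainder and the squared
  deviation of the coefficients from the Fourier coefficients. Bessel's inequality and Parseval's
  identity are both read off from it.\<close>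

lemma onb_distance:
  assumes e: "onb e" and f: "f \<in> L2"
  shows "ip (\<lambda>x. f x - (\<Sum>k<N. a k * e k x)) (\<lambda>x. f x - (\<Sum>k<N. a k * e k x)) =
    ip f f - (\<Sum>k<N. (ip f (e k))\<^sup>2) + (\<Sum>k<N. (a k - ip f (e k))\<^sup>2)"
proof -
  have ek: "e k \<in> L2" and o: "ip (e j) (e k) = (if j = k then 1 else 0)" for j k
    using e by (auto simp: onb_def)
  let ?g = "\<lambda>x. \<Sum>k<N. a k * e k x"
  have g: "?g \<in> L2" by (intro L2_sum L2_cmult ek)
  have gh: "ip ?g h = (\<Sum>k<N. a k * ip (e k) h)" if "h \<in> L2" for h
    using that by (subst ip_sum_left) (auto intro: L2_cmult ek simp: ip_cmult_left)
  have gf: "ip f ?g = (\<Sum>k<N. a k * ip f (e k))"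
    using gh[OF f] by (simp add: ip_commute[of f])
  have "ip (e k) ?g = (\<Sum>j<N. a j * (if j = k then 1 else 0))" for k
    using gh[OF ek] by (simp add: ip_commute[of "e k"] o)
  then have "ip (e k) ?g = (if k < N then a k else 0)" for k by (simp add: if_distrib[where f="(*) _"] cong: if_cong)
  then have gg: "ip ?g ?g = (\<Sum>k<N. a k * a k)"
    using gh[OF g] by simp
  show ?thesis
    unfolding ip_square_diff[OF f g] gf gg
    by (simp add: power2_diff sum.distrib sum_subtractf sum_distrib_left power2_eq_square algebra_simps)
qed

lemma bessel:
  assumes "onb e" "f \<in> L2" shows "(\<Sum>k<N. (ip f (e k))\<^sup>2) \<le> ip f f"
  using onb_distance[OF assms, where N=N and a="\<lambda>k. ip f (e k)"] 
    ip_ge_0[of "\<lambda>x. f x - (\<Sum>k<N. ip f (e k) * e k x)"] by simp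

text \<open>By \<open>onb_distance\<close> the Fourier coefficients do at least as well as the
  approximant supplied by density; monotonicity in the number of terms and Bessel's inequality do
  the rest.\<close>

lemma parseval_norm:
  assumes e: "onb e" and f: "f \<in> L2"
  shows "(\<lambda>N. \<Sum>k<N. (ip f (e k))\<^sup>2) \<longlonglongrightarrow> ip f f"
proof (rule LIMSEQ_I)
  fix r :: real assume "r > 0"
  then obtain N a where "ip (\<lambda>x. f x - (\<Sum>k<N. a k * e k x)) (\<lambda>x. f x - (\<Sum>k<N. a k * e k x)) < r"
    using e f unfolding onb_def by blast
  moreover have "0 \<le> (\<Sum>k<N. (a k - ip f (e k))\<^sup>2)" by (intro sum_nonneg) auto
  ultimately have N: "ip f f - (\<Sum>k<N. (ip f (e k))\<^sup>2) < r" using onb_distance[OF e f, where N=N and a=a] by linarith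
  have "norm ((\<Sum>k<n. (ip f (e k))\<^sup>2) - ip f f) < r" if "n \<ge> N" for n
  proof -
    have "(\<Sum>k<N. (ip f (e k))\<^sup>2) \<le> (\<Sum>k<n. (ip f (e k))\<^sup>2)"
      using that by (intro sum_mono2) auto
    then show ?thesis using bessel[OF e f, of n] N by auto
  qed
  then show "\<exists>no. \<forall>n\<ge>no. norm ((\<Sum>k<n. (ip f (e k))\<^sup>2) - ip f f) < r" by blast
qed

text \<open>Polarization of \<open>parseval_norm\<close>.\<close>

theorem parseval:
  assumes e: "onb e" and f: "f \<in> L2" and g: "g \<in> L2"
  shows "(\<lambda>N. \<Sum>k<N. ip f (e k) * ip g (e k)) \<longlonglongrightarrow> ip f g"
proof -
  have ek: "e k \<in> L2" for k using e by (simp add: onb_def)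
  have "(\<lambda>N. ((\<Sum>k<N. (ip (\<lambda>x. f x + g x) (e k))\<^sup>2) - (\<Sum>k<N. (ip (\<lambda>x. f x - g x) (e k))\<^sup>2)) / 4) \<longlonglongrightarrow>
     (ip (\<lambda>x. f x + g x) (\<lambda>x. f x + g x) - ip (\<lambda>x. f x - g x) (\<lambda>x. f x - g x)) / 4"
    by (intro tendsto_intros parseval_norm e L2_add L2_diff f g) simp
  also have "(ip (\<lambda>x. f x + g x) (\<lambda>x. f x + g x) - ip (\<lambda>x. f x - g x) (\<lambda>x. f x - g x)) / 4 = ip f g"
    by (simp add: ip_square_add ip_square_diff f g)
  also have "(\<lambda>N. ((\<Sum>k<N. (ip (\<lambda>x. f x + g x) (e k))\<^sup>2) - (\<Sum>k<N. (ip (\<lambda>x. f x - g x) (e k))\<^sup>2)) / 4) =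
      (\<lambda>N. \<Sum>k<N. ip f (e k) * ip g (e k))"
    unfolding sum_subtractf[symmetric] sum_divide_distrib
    by (intro ext sum.cong) (auto simp: ip_add_left ip_diff_left f g ek power2_sum power2_diff)
  finally show ?thesis .
qed

text \<open>The bound is uniform in \<open>N\<close>, so it is the majorant when partial sums are
  integrated in time.\<close>

lemma parseval_partial_bound:
  assumes e: "onb e" and f: "f \<in> L2" and g: "g \<in> L2"
  shows "\<bar>\<Sum>k<N. ip f (e k) * ip g (e k)\<bar> \<le> ip f f + ip g g"
proof -
  have "\<bar>\<Sum>k<N. ip f (e k) * ip g (e k)\<bar> \<le> (\<Sum>k<N. \<bar>ip f (e k) * ip g (e k)\<bar>)" by (rule sum_abs)
  also have "\<dots> \<le> (\<Sum>k<N. (ip f (e k))\<^sup>2 + (ip g (e k))\<^sup>2)"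
  proof (rule sum_mono)
    fix k
    have "2 * \<bar>ip f (e k)\<bar> * \<bar>ip g (e k)\<bar> \<le> (ip f (e k))\<^sup>2 + (ip g (e k))\<^sup>2"
      using sum_squares_bound[of "\<bar>ip f (e k)\<bar>" "\<bar>ip g (e k)\<bar>"] by simp
    moreover have "0 \<le> \<bar>ip f (e k)\<bar> * \<bar>ip g (e k)\<bar>" by simp
    ultimately show "\<bar>ip f (e k) * ip g (e k)\<bar> \<le> (ip f (e k))\<^sup>2 + (ip g (e k))\<^sup>2"
      unfolding abs_mult by linarith
  qed
  also have "\<dots> \<le> ip f f + ip g g"
    unfolding sum.distrib by (intro add_mono bessel e f g)
  finally show ?thesis .
qed

section \<open>The sine and cosine bases\<close>

definition cosb :: "nat \<Rightarrow> real \<Rightarrow> real" where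
  "cosb n x = (if n = 0 then 1 else sqrt 2 * cos (real n * pi * x))"

text \<open>The index is shifted so that \<open>sinb n\<close> and \<open>cosb (Suc n)\<close> have
  the same frequency and differentiation exchanges them; the constant \<open>cosb 0\<close> has no
  sine partner.\<close>

definition sinb :: "nat \<Rightarrow> real \<Rightarrow> real" where
  "sinb n x = sqrt 2 * sin (real (Suc n) * pi * x)"

lemma continuous_cosb: "continuous_on A (cosb n)"
  unfolding cosb_def by (cases "n = 0") (auto intro!: continuous_intros)

lemma continuous_sinb: "continuous_on A (sinb n)"
  unfolding sinb_def by (auto intro!: continuous_intros)

lemma L2_cosb: "cosb n \<in> L2" and L2_sinb: "sinb n \<in> L2"
  by (auto intro: L2_continuous continuous_cosb continuous_sinb)

lemma integral_cos_int: "(LINT x|lebesgue_on Om. cos (real_of_int m * pi * x)) = (if m = 0 then 1 else 0)"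
proof (cases "m = 0")
  case True
  then show ?thesis by (simp add: Om_Iv measure_restrict_space)
next
  case False
  have "prim 1 (\<lambda>x. sin (real_of_int m * pi * x) / (real_of_int m * pi)) (\<lambda>x. cos (real_of_int m * pi * x))"
    using False by (intro prim_C1) (auto intro!: derivative_eq_intros continuous_intros)
  from prim_T[OF this] have "(LINT x|Iv 1. cos (real_of_int m * pi * x)) = 0"
    using sin_npi_int[of m] by (simp add: mult.commute)
  then show ?thesis using False by (simp add: Om_Iv)
qed

lemma integrable_cos_int: "integrable (lebesgue_on Om) (\<lambda>x. cos (real_of_int m * pi * x))"
  unfolding Om_Iv by (intro integrable_Iv_continuous continuous_intros)

lemma cos_mult_cos: "cos (real j * pi * x) * cos (real k * pi * x) =
  (cos (real_of_int (int j - int k) * pi * x) + cos (real_of_int (int j + int k) * pi * x)) / 2"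
  using cos_times_cos[of "real j * pi * x" "real k * pi * x"] by (simp add: algebra_simps)

lemma sin_mult_sin: "sin (real j * pi * x) * sin (real k * pi * x) =
  (cos (real_of_int (int j - int k) * pi * x) - cos (real_of_int (int j + int k) * pi * x)) / 2"
  using sin_times_sin[of "real j * pi * x" "real k * pi * x"] by (simp add: algebra_simps)

lemma ip_cosb: "ip (cosb j) (cosb k) = (if j = k then 1 else 0)"
proof -
  have eq: "cosb j x * cosb k x = (if j = 0 then 1 else sqrt 2) * (if k = 0 then 1 else sqrt 2) / 2 *
     (cos (real_of_int (int j - int k) * pi * x) + cos (real_of_int (int j + int k) * pi * x))" for x
    using cos_mult_cos[of j x k] by (auto simp: cosb_def)
  show ?thesis
    unfolding ip_def eq
    by (simp add: integral_cos_int integrable_cos_int del: of_int_diff of_int_add)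
qed

lemma ip_sinb: "ip (sinb j) (sinb k) = (if j = k then 1 else 0)"
proof -
  have eq: "sinb j x * sinb k x =
     cos (real_of_int (int (Suc j) - int (Suc k)) * pi * x) - cos (real_of_int (int (Suc j) + int (Suc k)) * pi * x)" for x
  proof -
    have "sinb j x * sinb k x = 2 * (sin (real (Suc j) * pi * x) * sin (real (Suc k) * pi * x))"
      by (simp add: sinb_def)
    then show ?thesis unfolding sin_mult_sin by simp
  qed
  show ?thesis
    unfolding ip_def eq
    by (subst Bochner_Integration.integral_diff[OF integrable_cos_int integrable_cos_int]) (simp add: integral_cos_int del: of_int_diff of_int_add)
qed

section \<open>Density of trigonometric polynomials\<close>

definition lincomb :: "(nat \<Rightarrow> real \<Rightarrow> real) \<Rightarrow> (real \<Rightarrow> real) set" where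
  "lincomb e = {\<lambda>x. \<Sum>k<N. a k * e k x | N a. True}"

lemma lincombI: "f = (\<lambda>x. \<Sum>k<N. a k * e k x) \<Longrightarrow> f \<in> lincomb e"
  unfolding lincomb_def by blast

lemma lincomb_add:
  assumes "f \<in> lincomb e" "g \<in> lincomb e" shows "(\<lambda>x. f x + g x) \<in> lincomb e"
proof -
  obtain N a where f: "f = (\<lambda>x. \<Sum>k<N. a k * e k x)" using assms by (auto simp: lincomb_def)
  obtain M b where g: "g = (\<lambda>x. \<Sum>k<M. b k * e k x)" using assms by (auto simp: lincomb_def)
  \<comment> \<open>Pad the coefficients with zeros to a common length.\<close>
  have ext: "(\<Sum>k<N. a k * e k x) = (\<Sum>k<max N M. (if k < N then a k else 0) * e k x)" for N a x M
    by (rule sum.mono_neutral_cong_left) auto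
  have "(\<lambda>x. f x + g x) = (\<lambda>x. \<Sum>k<max N M. ((if k < N then a k else 0) + (if k < M then b k else 0)) * e k x)"
    unfolding f g using ext[where N=N and a=a and M=M] ext[where N=M and a=b and M=N]
    by (simp only: max.commute[of M N] distrib_right sum.distrib)
  then show ?thesis by (rule lincombI)
qed

lemma lincomb_base: "(\<lambda>x. c * e n x) \<in> lincomb e"
proof -
  have "(\<lambda>x. c * e n x) = (\<lambda>x. \<Sum>k<Suc n. (if k = n then c else 0) * e k x)"
    by (auto simp: if_distrib[where f="\<lambda>a. a * _"] cong: if_cong)
  then show ?thesis by (rule lincombI)
qed

lemma onb_of_dense:
  assumes "\<And>k. e k \<in> L2" "\<And>j k. ip (e j) (e k) = (if j = k then 1 else 0)"
    and "\<And>f \<epsilon>. f \<in> L2 \<Longrightarrow> \<epsilon> > 0 \<Longrightarrow> \<exists>g\<in>lincomb e. ip (\<lambda>x. f x - g x) (\<lambda>x. f x - g x) < \<epsilon>"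
  shows "onb e"
  unfolding onb_def
proof (intro conjI allI ballI impI)
  fix \<epsilon> :: real and f :: "real \<Rightarrow> real" assume "f \<in> L2" "\<epsilon> > 0"
  from assms(3)[OF this]
  show "\<exists>N a. ip (\<lambda>x. f x - (\<Sum>k<N. a k * e k x)) (\<lambda>x. f x - (\<Sum>k<N. a k * e k x)) < \<epsilon>"
    unfolding lincomb_def by blast
qed (use assms in auto)

text \<open>Built for Stone-Weierstrass: by the product-to-sum formula this set is an algebra, and
  an inductive set makes closure under products an induction over generators.\<close>

inductive_set cos_poly :: "(real \<Rightarrow> real) set" where
  cos: "(\<lambda>x. c * cos (real n * pi * x)) \<in> cos_poly"
| add: "f \<in> cos_poly \<Longrightarrow> g \<in> cos_poly \<Longrightarrow> (\<lambda>x. f x + g x) \<in> cos_poly"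

lemma cos_poly_mult_cos: "f \<in> cos_poly \<Longrightarrow> (\<lambda>x. f x * (c * cos (real n * pi * x))) \<in> cos_poly"
proof (induction rule: cos_poly.induct)
  case (cos b m)
  \<comment> \<open>The generators have natural frequencies, whereas the difference m - n may be
    negative; the cosine is even.\<close>
  have "cos (real_of_int (int m - int n) * pi * x) = cos (real (nat \<bar>int m - int n\<bar>) * pi * x)" for x
    using cos_minus[of "real_of_int (int m - int n) * pi * x"]
    by (cases "n \<le> m") (auto simp: minus_mult_left nat_diff_distrib of_nat_diff simp del: mult_minus_left)
  note abs = this
  have "(b * cos (real m * pi * x)) * (c * cos (real n * pi * x)) =
     (b * c / 2) * cos (real (nat \<bar>int m - int n\<bar>) * pi * x) + (b * c / 2) * cos (real (m + n) * pi * x)" for x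
  proof -
    have "(b * cos (real m * pi * x)) * (c * cos (real n * pi * x)) =
      b * c * (cos (real m * pi * x) * cos (real n * pi * x))" by simp
    then show ?thesis unfolding cos_mult_cos abs by (simp add: algebra_simps)
  qed
  then show ?case by (simp only: cos_poly.intros)
qed (auto simp: distrib_right intro: cos_poly.add)

lemma cos_poly_mult:
  assumes f: "f \<in> cos_poly" and g: "g \<in> cos_poly" shows "(\<lambda>x. f x * g x) \<in> cos_poly"
  using g
proof (induction rule: cos_poly.induct)
  case (cos c n)
  then show ?case by (rule cos_poly_mult_cos[OF f])
qed (auto simp: distrib_left intro: cos_poly.add)

lemma cos_poly_continuous: "f \<in> cos_poly \<Longrightarrow> continuous_on A f"
  by (induction rule: cos_poly.induct) (auto intro!: continuous_intros)

text \<open>Frequency 0 supplies the constants, and the single function cos (pi x), injective on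
  \<open>{0..1}\<close>, separates points.\<close>

lemma cos_poly_uniform_dense:
  assumes "continuous_on {0..1} f" "\<epsilon> > 0"
  shows "\<exists>g\<in>cos_poly. \<forall>x\<in>{0..1}. \<bar>f x - g x\<bar> < \<epsilon>"
proof -
  have "\<exists>g. g \<in> cos_poly \<and> (\<forall>x\<in>{0..1}. \<bar>f x - g x\<bar> < \<epsilon>)"
  proof (rule Stone_Weierstrass_HOL)
    show "(\<lambda>x. c) \<in> cos_poly" for c using cos_poly.cos[of c 0] by simp
    fix x y :: real assume "x \<in> {0..1} \<and> y \<in> {0..1} \<and> x \<noteq> y"
    then have "cos (pi * x) \<noteq> cos (pi * y)"
      using cos_inj_pi[of "pi * x" "pi * y"] by (auto simp: mult_le_cancel_left1)
    then show "\<exists>f. f \<in> cos_poly \<and> f x \<noteq> f y" using cos_poly.cos[of 1 1] by (intro exI conjI) auto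
  qed (use assms cos_poly.add cos_poly_mult cos_poly_continuous in auto)
  then show ?thesis by blast
qed

lemma L2_truncation:
  assumes f: "f \<in> L2" and m: "\<And>n. g n \<in> borel_measurable (lebesgue_on Om)"
    and lim: "AE x in lebesgue_on Om. (\<lambda>n. g n x) \<longlonglongrightarrow> f x"
    and bd: "\<And>n. AE x in lebesgue_on Om. \<bar>f x - g n x\<bar> \<le> w x" and w: "w \<in> L2"
  shows "(\<lambda>n. ip (\<lambda>x. f x - g n x) (\<lambda>x. f x - g n x)) \<longlonglongrightarrow> 0"
proof -
  have "(\<lambda>n. LINT x|lebesgue_on Om. (f x - g n x)\<^sup>2) \<longlonglongrightarrow> (LINT x|lebesgue_on Om. 0)"
  proof (rule integral_dominated_convergence[where w="\<lambda>x. (w x)\<^sup>2"])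
    show "(\<lambda>x. (f x - g n x)\<^sup>2) \<in> borel_measurable (lebesgue_on Om)" for n using m L2D(1)[OF f] by simp
    show "integrable (lebesgue_on Om) (\<lambda>x. (w x)\<^sup>2)" using w by (rule L2D)
    show "AE x in lebesgue_on Om. (\<lambda>n. (f x - g n x)\<^sup>2) \<longlonglongrightarrow> 0"
      using lim
    proof eventually_elim
      fix x assume "(\<lambda>n. g n x) \<longlonglongrightarrow> f x"
      then have "(\<lambda>n. (f x - g n x)\<^sup>2) \<longlonglongrightarrow> (f x - f x)\<^sup>2" by (intro tendsto_intros)
      then show "(\<lambda>n. (f x - g n x)\<^sup>2) \<longlonglongrightarrow> 0" by simp
    qed
    show "AE x in lebesgue_on Om. norm ((f x - g n x)\<^sup>2) \<le> (w x)\<^sup>2" for n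
      using bd[of n] by eventually_elim (use abs_le_square_iff in force)
  qed auto
  then show ?thesis by (simp add: ip_power2)
qed

text \<open>Truncation happens twice. Cutting \<open>f\<close> at height M makes it bounded; cutting
  the continuous functions that converge to \<open>f\<close> almost everywhere at the same height
  gives the constant majorant 2M. The quarter of \<epsilon> compensates the factor 2 in
  \<open>ip_square_add_le\<close>.\<close>

lemma L2_dense_continuous:
  assumes f: "f \<in> L2" and \<epsilon>: "\<epsilon> > 0"
  shows "\<exists>g. continuous_on UNIV g \<and> ip (\<lambda>x. f x - g x) (\<lambda>x. f x - g x) < \<epsilon>"
proof -
  define tr :: "nat \<Rightarrow> real \<Rightarrow> real" where "tr M y = max (- real M) (min (real M) y)" for M y
  have trc: "continuous_on A (tr M)" for A M unfolding tr_def by (intro continuous_intros)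
  have trm: "(\<lambda>x. tr M (f x)) \<in> borel_measurable (lebesgue_on Om)" for M
    using L2D(1)[OF f] unfolding tr_def by simp
  have "(\<lambda>M. ip (\<lambda>x. f x - tr M (f x)) (\<lambda>x. f x - tr M (f x))) \<longlonglongrightarrow> 0"
  proof (rule L2_truncation[OF f trm, where w="\<lambda>x. \<bar>f x\<bar>"])
    show "AE x in lebesgue_on Om. (\<lambda>n. tr n (f x)) \<longlonglongrightarrow> f x"
    proof (intro AE_I2)
      fix x
      obtain M where M: "\<bar>f x\<bar> \<le> real M" using real_arch_simple by blast
      have "\<forall>\<^sub>F n in sequentially. f x = tr n (f x)"
        using eventually_ge_at_top[of M] by eventually_elim (use M in \<open>auto simp: tr_def\<close>)
      then show "(\<lambda>n. tr n (f x)) \<longlonglongrightarrow> f x" by (rule Lim_transform_eventually[OF tendsto_const])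
    qed
    show "(\<lambda>x. \<bar>f x\<bar>) \<in> L2" using f by (auto simp: L2_def)
    show "AE x in lebesgue_on Om. \<bar>f x - tr n (f x)\<bar> \<le> \<bar>f x\<bar>" for n
      by (intro AE_I2) (auto simp: tr_def)
  qed
  then obtain M where M: "ip (\<lambda>x. f x - tr M (f x)) (\<lambda>x. f x - tr M (f x)) < \<epsilon> / 4"
    using order_tendstoD(2)[of _ 0 sequentially "\<epsilon> / 4"] \<epsilon> eventually_happens'[OF sequentially_bot] by force
  have tf: "(\<lambda>x. tr M (f x)) \<in> L2"
  proof -
    have "integrable (lebesgue_on Om) (\<lambda>x. (tr M (f x))\<^sup>2)"
    proof (rule Bochner_Integration.integrable_bound[OF L2D(2)[OF f]])
      show "AE x in lebesgue_on Om. norm ((tr M (f x))\<^sup>2) \<le> norm ((f x)\<^sup>2)"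
        by (intro AE_I2) (auto simp: tr_def abs_le_square_iff[symmetric])
    qed (use trm in simp)
    then show ?thesis using trm by (simp add: L2_def)
  qed
  have "f measurable_on Om" using L2D(1)[OF f] by (simp add: measurable_on_iff_borel_measurable)
  then obtain N g where N: "negligible N" and gc: "\<And>n. continuous_on UNIV (g n)"
    and gl: "\<And>x. x \<notin> N \<Longrightarrow> (\<lambda>n. g n x) \<longlonglongrightarrow> (if x \<in> Om then f x else 0)"
    unfolding measurable_on_def by blast
  have "(\<lambda>n. ip (\<lambda>x. tr M (f x) - tr M (g n x)) (\<lambda>x. tr M (f x) - tr M (g n x))) \<longlonglongrightarrow> 0"
  proof (rule L2_truncation[OF tf])
    show "(\<lambda>x. tr M (g n x)) \<in> borel_measurable (lebesgue_on Om)" for n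
      by (intro L2D(1) L2_continuous continuous_on_compose2[OF trc] continuous_on_subset[OF gc]) auto
    have "AE x in lebesgue. x \<notin> N" using N by (simp add: negligible_iff_null_sets AE_not_in)
    then have "AE x in lebesgue_on Om. x \<notin> N" by (subst AE_restrict_space_iff) auto
    then show "AE x in lebesgue_on Om. (\<lambda>n. tr M (g n x)) \<longlonglongrightarrow> tr M (f x)"
    proof (rule lebesgue_on_mono)
      fix x assume "x \<notin> N" "x \<in> Om"
      then have "(\<lambda>n. g n x) \<longlonglongrightarrow> f x" using gl[of x] by simp
      then show "(\<lambda>n. tr M (g n x)) \<longlonglongrightarrow> tr M (f x)"
        using continuous_on_tendsto_compose[OF trc[of UNIV M]] by auto
    qed
    show "AE x in lebesgue_on Om. \<bar>tr M (f x) - tr M (g n x)\<bar> \<le> 2 * real M" for n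
      by (intro AE_I2) (auto simp: tr_def)
    show "(\<lambda>x. 2 * real M) \<in> L2" by (intro L2_continuous continuous_intros)
  qed
  then obtain n where n: "ip (\<lambda>x. tr M (f x) - tr M (g n x)) (\<lambda>x. tr M (f x) - tr M (g n x)) < \<epsilon> / 4"
    using order_tendstoD(2)[of _ 0 sequentially "\<epsilon> / 4"] \<epsilon> eventually_happens'[OF sequentially_bot] by force
  have c: "continuous_on UNIV (\<lambda>x. tr M (g n x))"
    by (intro continuous_on_compose2[OF trc gc]) auto
  then have "(\<lambda>x. tr M (g n x)) \<in> L2" by (intro L2_continuous) (auto intro: continuous_on_subset)
  then have "ip (\<lambda>x. (f x - tr M (f x)) + (tr M (f x) - tr M (g n x))) (\<lambda>x. (f x - tr M (f x)) + (tr M (f x) - tr M (g n x))) < \<epsilon>"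
    using ip_square_add_le[OF L2_diff[OF f tf] L2_diff[OF tf, of "\<lambda>x. tr M (g n x)"]] M n by simp
  then show ?thesis using c by (intro exI[of _ "\<lambda>x. tr M (g n x)"]) simp
qed

lemma ip_self_le_of_bound:
  assumes "h \<in> L2" "w \<in> L2" "\<And>x. x \<in> Om \<Longrightarrow> \<bar>h x\<bar> \<le> \<bar>w x\<bar>"
  shows "ip h h \<le> ip w w"
  unfolding ip_power2
  by (rule integral_mono[OF L2D(2)[OF assms(1)] L2D(2)[OF assms(2)]])
    (use assms(3) abs_le_square_iff in auto)

lemma ip_const_1: "ip (\<lambda>x. c) (\<lambda>x. c) = c\<^sup>2"
  by (simp add: ip_power2 Om_Iv measure_restrict_space)

lemma cos_poly_dense:
  assumes f: "f \<in> L2" and \<epsilon>: "\<epsilon> > 0"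
  shows "\<exists>g\<in>cos_poly. ip (\<lambda>x. f x - g x) (\<lambda>x. f x - g x) < \<epsilon>"
proof -
  obtain g where g: "continuous_on UNIV g" "ip (\<lambda>x. f x - g x) (\<lambda>x. f x - g x) < \<epsilon> / 4"
    using L2_dense_continuous[OF f, of "\<epsilon> / 4"] \<epsilon> by auto
  have g2: "g \<in> L2" using g(1) by (intro L2_continuous) (auto intro: continuous_on_subset)
  have "continuous_on {0..1} g" using g(1) by (auto intro: continuous_on_subset)
  then obtain h where h: "h \<in> cos_poly" "\<And>x. x \<in> {0..1} \<Longrightarrow> \<bar>g x - h x\<bar> < sqrt (\<epsilon> / 4)"
    using cos_poly_uniform_dense[of g "sqrt (\<epsilon> / 4)"] \<epsilon> by auto
  have h2: "h \<in> L2" using h(1) by (intro L2_continuous cos_poly_continuous)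
  have "ip (\<lambda>x. g x - h x) (\<lambda>x. g x - h x) \<le> ip (\<lambda>x. sqrt (\<epsilon> / 4)) (\<lambda>x. sqrt (\<epsilon> / 4))"
    by (rule ip_self_le_of_bound) (use h(2) \<epsilon> in \<open>auto intro!: L2_diff g2 h2 L2_continuous[of "\<lambda>x. sqrt (\<epsilon> / 4)"] simp: Om_def less_imp_le\<close>)
  also have "\<dots> = \<epsilon> / 4" unfolding ip_const_1 using \<epsilon> by simp
  finally have "ip (\<lambda>x. (f x - g x) + (g x - h x)) (\<lambda>x. (f x - g x) + (g x - h x)) < \<epsilon>"
    using ip_square_add_le[OF L2_diff[OF f g2] L2_diff[OF g2 h2]] g(2) by simp
  then show ?thesis using h(1) by (intro bexI[of _ h]) simp_all
qed

lemma onb_cosb: "onb cosb"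
proof (rule onb_of_dense)
  have "cos_poly \<subseteq> lincomb cosb"
  proof
    fix f assume "f \<in> cos_poly"
    then show "f \<in> lincomb cosb"
    proof (induction rule: cos_poly.induct)
      case (cos c n)
      have "(\<lambda>x. c * cos (real n * pi * x)) = (\<lambda>x. (if n = 0 then c else c / sqrt 2) * cosb n x)"
        by (auto simp: cosb_def)
      then show ?case using lincomb_base by metis
    qed (rule lincomb_add)
  qed
  then show "\<exists>g\<in>lincomb cosb. ip (\<lambda>x. f x - g x) (\<lambda>x. f x - g x) < \<epsilon>" if "f \<in> L2" "\<epsilon> > 0" for f \<epsilon>
    using cos_poly_dense[OF that] by blast
qed (rule L2_cosb ip_cosb)+

text \<open>Product-to-sum gives sines of frequencies n + 1 and n - 1. The second one is the
  negative of the lowest sine for n = 0, vanishes for n = 1, and is \<open>sinb j\<close> for n = j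
  + 2.\<close>

lemma sin_mult_cos_poly: "f \<in> cos_poly \<Longrightarrow> (\<lambda>x. sin (pi * x) * f x) \<in> lincomb sinb"
proof (induction rule: cos_poly.induct)
  case (cos c n)
  have eq: "sin (pi * x) * cos (real n * pi * x) = (sin (real (Suc n) * pi * x) - sin ((real n - 1) * pi * x)) / 2" for x
    using sin_times_cos[of "pi * x" "real n * pi * x"] sin_minus[of "(real n - 1) * pi * x"]
    by (simp add: algebra_simps)
  consider "n = 0" | "n = 1" | j where "n = Suc (Suc j)"
    by (metis One_nat_def not0_implies_Suc)
  then show ?case
  proof cases
    case 1
    then have "(\<lambda>x. sin (pi * x) * (c * cos (real n * pi * x))) = (\<lambda>x. (c / sqrt 2) * sinb 0 x)"
      by (auto simp: sinb_def)
    then show ?thesis using lincomb_base by metis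
  next
    case 2
    have "sin (pi * x) * (c * cos (real n * pi * x)) = (c / (2 * sqrt 2)) * sinb 1 x" for x
    proof -
      have "sin (pi * x) * (c * cos (real n * pi * x)) = c * (sin (pi * x) * cos (real n * pi * x))" by simp
      also have "\<dots> = (c / (2 * sqrt 2)) * sinb 1 x" unfolding eq using 2 by (simp add: sinb_def)
      finally show ?thesis .
    qed
    then show ?thesis using lincomb_base by (simp only:)
  next
    case 3
    have "sin (pi * x) * (c * cos (real n * pi * x)) =
        (c / (2 * sqrt 2)) * sinb n x + (- c / (2 * sqrt 2)) * sinb j x" for x
    proof -
      have "sin (pi * x) * (c * cos (real n * pi * x)) = c * (sin (pi * x) * cos (real n * pi * x))" by simp
      also have "\<dots> = c / 2 * sin (real (Suc n) * pi * x) - c / 2 * sin (real (Suc j) * pi * x)"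
        unfolding eq using 3 by (simp add: right_diff_distrib diff_divide_distrib)
      finally show ?thesis by (simp add: sinb_def)
    qed
    then show ?thesis using lincomb_add[OF lincomb_base lincomb_base] by (simp only:)
  qed
next
  case (add f g)
  then show ?case using lincomb_add[OF add.IH] by (simp add: distrib_left)
qed

text \<open>Stone-Weierstrass is not applied to sines, which all vanish at the endpoints. Instead
  completeness is transferred from cosines: away from the endpoints divide by sin (pi x),
  approximate by a cosine polynomial, and multiply back, which does not increase the error since the
  sine is at most 1.\<close>

lemma onb_sinb: "onb sinb"
proof (rule onb_of_dense)
  fix f :: "real \<Rightarrow> real" and \<epsilon> :: real assume f: "f \<in> L2" and \<epsilon>: "\<epsilon> > 0"
  let ?s = "\<lambda>x. sin (pi * x)"
  have spos: "?s x > 0" if "x \<in> Om" for x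
    using that by (intro sin_gt_zero) (auto simp: Om_def)
  have sm: "?s \<in> borel_measurable (lebesgue_on Om)"
    by (intro L2D(1) L2_continuous continuous_intros)
  define g where "g n x = (if ?s x \<ge> 1 / real (Suc n) then f x else 0)" for n x
  have gm: "g n \<in> borel_measurable (lebesgue_on Om)" for n
    unfolding g_def using sm L2D(1)[OF f] by measurable
  have g2: "g n \<in> L2" for n
  proof -
    have "integrable (lebesgue_on Om) (\<lambda>x. (g n x)\<^sup>2)"
    proof (rule Bochner_Integration.integrable_bound[OF L2D(2)[OF f]])
      show "(\<lambda>x. (g n x)\<^sup>2) \<in> borel_measurable (lebesgue_on Om)" using gm by simp
    qed (auto simp: g_def)
    then show ?thesis using gm by (simp add: L2_def)
  qed
  have "(\<lambda>n. ip (\<lambda>x. f x - g n x) (\<lambda>x. f x - g n x)) \<longlonglongrightarrow> 0"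
  proof (rule L2_truncation[OF f gm])
    show "AE x in lebesgue_on Om. (\<lambda>n. g n x) \<longlonglongrightarrow> f x"
    proof (intro AE_I2)
      fix x assume "x \<in> space (lebesgue_on Om)"
      then have "?s x > 0" using spos by simp
      then have "\<forall>\<^sub>F n in sequentially. 1 / real (Suc n) < ?s x"
        using order_tendstoD(2)[OF LIMSEQ_Suc[OF lim_1_over_n]] by blast
      then have "\<forall>\<^sub>F n in sequentially. f x = g n x" by eventually_elim (simp add: g_def)
      then show "(\<lambda>n. g n x) \<longlonglongrightarrow> f x" by (rule Lim_transform_eventually[OF tendsto_const])
    qed
    show "AE x in lebesgue_on Om. \<bar>f x - g n x\<bar> \<le> \<bar>f x\<bar>" for n by (intro AE_I2) (simp add: g_def)
    show "(\<lambda>x. \<bar>f x\<bar>) \<in> L2" using f by (auto simp: L2_def)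
  qed
  then obtain n where n: "ip (\<lambda>x. f x - g n x) (\<lambda>x. f x - g n x) < \<epsilon> / 4"
    using order_tendstoD(2)[of _ 0 sequentially "\<epsilon> / 4"] \<epsilon> eventually_happens'[OF sequentially_bot] by force
  \<comment> \<open>The reciprocal of the sine where it is at least 1/(n+1), hence bounded by n + 1;
    \<open>g n\<close> is the product of the sine, \<open>k\<close> and \<open>f\<close>.\<close>
  define k where "k x = (if ?s x \<ge> 1 / real (Suc n) then 1 / ?s x else 0)" for x
  have km: "k \<in> borel_measurable (lebesgue_on Om)" unfolding k_def using sm by measurable
  have "\<bar>k x\<bar> \<le> real (Suc n)" for x
  proof (cases "?s x \<ge> 1 / real (Suc n)")
    case True
    have "0 < 1 / real (Suc n)" by simp
    with True have "0 < ?s x" by linarith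
    with True show ?thesis by (simp add: k_def field_simps)
  qed (simp add: k_def)
  then have w: "(\<lambda>x. k x * f x) \<in> L2" by (intro L2_bounded_mult[OF f km]) auto
  obtain h where h: "h \<in> cos_poly" "ip (\<lambda>x. k x * f x - h x) (\<lambda>x. k x * f x - h x) < \<epsilon> / 4"
    using cos_poly_dense[OF w, of "\<epsilon> / 4"] \<epsilon> by auto
  have h2: "h \<in> L2" using h(1) by (intro L2_continuous cos_poly_continuous)
  have sh: "(\<lambda>x. ?s x * h x) \<in> L2" using h(1) by (intro L2_continuous continuous_intros cos_poly_continuous)
  have "ip (\<lambda>x. g n x - ?s x * h x) (\<lambda>x. g n x - ?s x * h x) \<le> ip (\<lambda>x. k x * f x - h x) (\<lambda>x. k x * f x - h x)"
  proof (rule ip_self_le_of_bound)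
    fix x assume x: "x \<in> Om"
    have "g n x - ?s x * h x = ?s x * (k x * f x - h x)"
      using spos[OF x] by (simp add: g_def k_def algebra_simps)
    moreover have "\<bar>?s x\<bar> * \<bar>k x * f x - h x\<bar> \<le> 1 * \<bar>k x * f x - h x\<bar>" by (intro mult_right_mono) auto
    ultimately show "\<bar>g n x - ?s x * h x\<bar> \<le> \<bar>k x * f x - h x\<bar>" by (simp add: abs_mult)
  qed (intro L2_diff g2 sh w h2)+
  then have "ip (\<lambda>x. (f x - g n x) + (g n x - ?s x * h x)) (\<lambda>x. (f x - g n x) + (g n x - ?s x * h x)) < \<epsilon>"
    using ip_square_add_le[OF L2_diff[OF f g2[of n]] L2_diff[OF g2[of n] sh]] n h(2) by simp
  then show "\<exists>g\<in>lincomb sinb. ip (\<lambda>x. f x - g x) (\<lambda>x. f x - g x) < \<epsilon>"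
    using sin_mult_cos_poly[OF h(1)] by (intro bexI[of _ "\<lambda>x. ?s x * h x"]) simp_all
qed (rule L2_sinb ip_sinb)+

section \<open>Weak derivatives\<close>

lemma test_fun_L2:
  assumes "test_fun Om \<phi>" shows "\<phi> \<in> L2" "deriv \<phi> \<in> L2"
  using test_fun_prim(4,5)[of 1 \<phi>] assms by (auto intro: L2_continuous simp: Om_def)

lemma weak_deriv_rep:
  assumes "weak_deriv_of f g"
  shows "\<exists>c. AE x in lebesgue_on Om. f x = c + indef 1 g x"
  unfolding Om_Iv
proof (rule du_Bois_Reymond)
  show "integrable (Iv 1) f" "integrable (Iv 1) g"
    using assms by (auto simp: weak_deriv_of_def intro: L2_imp_integrable)
  show "(LINT t|Iv 1. f t * deriv \<psi> t) = - (LINT t|Iv 1. g t * \<psi> t)" if "test_fun {0<..<1} \<psi>" for \<psi>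
    using assms that by (auto simp: weak_deriv_of_def ip_def Om_def)
qed simp

text \<open>The difference of the two derivatives annihilates every test function. This makes the
  choice in \<open>wd\<close> harmless inside integrals.\<close>

lemma weak_deriv_unique:
  assumes f: "weak_deriv_of f g" and f': "weak_deriv_of f' g'" and ae: "AE x in lebesgue_on Om. f x = f' x"
  shows "AE x in lebesgue_on Om. g x = g' x"
proof -
  have L: "f \<in> L2" "g \<in> L2" "f' \<in> L2" "g' \<in> L2" using f f' by (auto simp: weak_deriv_of_def)
  have "AE x in Iv 1. g x - g' x = 0"
  proof (rule fundamental_lemma)
    show "integrable (Iv 1) (\<lambda>x. g x - g' x)" by (intro L2_imp_integrable L2_diff L)
    fix \<phi> assume "test_fun {0<..<1} \<phi>"
    then have t: "test_fun Om \<phi>" by (simp add: Om_def)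
    have "ip g \<phi> = - ip f (deriv \<phi>)" "ip g' \<phi> = - ip f' (deriv \<phi>)"
      using f f' t by (auto simp: weak_deriv_of_def)
    moreover have "ip f (deriv \<phi>) = ip f' (deriv \<phi>)"
      using ae by (intro ip_cong_AE) (auto simp: L test_fun_L2[OF t])
    ultimately have "ip (\<lambda>x. g x - g' x) \<phi> = 0"
      by (simp add: ip_diff_left L test_fun_L2[OF t])
    then show "(LINT t|Iv 1. (g t - g' t) * \<phi> t) = 0" by (simp add: ip_def Om_Iv)
  qed simp
  then show ?thesis unfolding Om_Iv by simp
qed

lemma weak_deriv_wd: "f \<in> H1 \<Longrightarrow> weak_deriv_of f (wd f)"
  unfolding H1_def wd_def by (auto intro: someI[where P="weak_deriv_of f"])

lemma H1_L2: "f \<in> H1 \<Longrightarrow> f \<in> L2" and wd_L2: "f \<in> H1 \<Longrightarrow> wd f \<in> L2"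
  using weak_deriv_wd by (auto simp: weak_deriv_of_def)

lemma weak_deriv_H1: "weak_deriv_of f g \<Longrightarrow> f \<in> H1"
  by (auto simp: H1_def)

lemma wd_AE: "weak_deriv_of f g \<Longrightarrow> AE x in lebesgue_on Om. wd f x = g x"
  by (rule weak_deriv_unique[OF weak_deriv_wd]) (auto intro: weak_deriv_H1)

lemma weak_deriv_cong_AE:
  assumes "weak_deriv_of f g" "AE x in lebesgue_on Om. f x = f' x"
  shows "weak_deriv_of f' g"
proof -
  have "f \<in> L2" "f' \<in> L2" using assms L2_cong_AE by (auto simp: weak_deriv_of_def)
  moreover have "ip f' (deriv \<phi>) = ip f (deriv \<phi>)" if "test_fun Om \<phi>" for \<phi>
    using assms(2) by (intro ip_cong_AE) (auto simp: \<open>f' \<in> L2\<close> test_fun_L2[OF that])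
  ultimately show ?thesis using assms by (simp add: weak_deriv_of_def)
qed

lemma weak_deriv_add:
  assumes "weak_deriv_of f g" "weak_deriv_of f' g'"
  shows "weak_deriv_of (\<lambda>x. f x + f' x) (\<lambda>x. g x + g' x)"
  using assms by (auto simp: weak_deriv_of_def L2_add ip_add_left test_fun_L2)

lemma weak_deriv_cmult:
  assumes "weak_deriv_of f g"
  shows "weak_deriv_of (\<lambda>x. c * f x) (\<lambda>x. c * g x)"
  using assms by (auto simp: weak_deriv_of_def L2_cmult ip_cmult_left)

lemma weak_deriv_diff:
  assumes "weak_deriv_of f g" "weak_deriv_of f' g'"
  shows "weak_deriv_of (\<lambda>x. f x - f' x) (\<lambda>x. g x - g' x)"
  using assms by (auto simp: weak_deriv_of_def L2_diff ip_diff_left test_fun_L2)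

text \<open>The boundary terms belong to the continuous representative, because \<open>f\<close>
  itself is determined only almost everywhere and its values at 0 and 1 carry no meaning.\<close>

lemma ip_by_parts:
  assumes f: "weak_deriv_of f g" and rep: "AE x in lebesgue_on Om. f x = c + indef 1 g x"
    and \<phi>: "prim 1 \<phi> \<phi>'" "\<phi>' \<in> L2"
  shows "ip f \<phi>' + ip g \<phi> = (c + indef 1 g 1) * \<phi> 1 - c * \<phi> 0"
proof -
  have L: "f \<in> L2" "g \<in> L2" using f by (auto simp: weak_deriv_of_def)
  have \<phi>L: "\<phi> \<in> L2" using prim_continuous[OF \<phi>(1)] by (rule L2_continuous)
  let ?F = "\<lambda>x. c + indef 1 g x"
  have g: "integrable (Iv 1) g" by (rule L2_imp_integrable[OF L(2)])
  have F: "prim 1 ?F g" by (rule primI[OF g]) (simp add: indef_0)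
  have FL: "?F \<in> L2" using prim_continuous[OF F] by (rule L2_continuous)
  have "?F 1 * \<phi> 1 - ?F 0 * \<phi> 0 = (LINT t|Iv 1. g t * \<phi> t + ?F t * \<phi>' t)"
    by (rule prim_mult[OF F \<phi>(1)]) simp
  also have "\<dots> = ip g \<phi> + ip ?F \<phi>'"
    unfolding ip_def Om_Iv[symmetric]
    by (intro Bochner_Integration.integral_add L2_integrable_mult L FL \<phi>L \<phi>(2))
  also have "ip ?F \<phi>' = ip f \<phi>'"
    using rep by (intro ip_cong_AE FL \<phi>(2)) auto
  finally show ?thesis by (simp add: indef_0)
qed

lemma weak_deriv_C1:
  assumes F: "\<And>x. x \<in> {0..1} \<Longrightarrow> (F has_real_derivative f x) (at x within {0..1})"
    and f: "continuous_on {0..1} f"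
  shows "weak_deriv_of F f"
proof -
  have p: "prim 1 F f" by (rule prim_C1[OF _ F f]) auto
  have L: "F \<in> L2" "f \<in> L2" using prim_continuous[OF p] f by (auto intro: L2_continuous)
  have "ip F (deriv \<phi>) = - ip f \<phi>" if t: "test_fun Om \<phi>" for \<phi>
  proof -
    note t' = test_fun_prim[of 1 \<phi>, simplified, OF t[unfolded Om_def]]
    have "0 = (LINT t|Iv 1. f t * \<phi> t + F t * deriv \<phi> t)"
      using prim_mult[OF p t'(1)] t'(2,3) by simp
    also have "\<dots> = ip f \<phi> + ip F (deriv \<phi>)"
      unfolding ip_def Om_Iv[symmetric]
      by (intro Bochner_Integration.integral_add L2_integrable_mult L test_fun_L2[OF t])
    finally show ?thesis by simp
  qed
  then show ?thesis using L by (simp add: weak_deriv_of_def)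
qed

text \<open>Here the test function kills the boundary terms. This is the form for sines against
  \<open>wd u\<close>, whose boundary values are free.\<close>

lemma weak_deriv_by_parts:
  assumes f: "weak_deriv_of f g" and \<phi>: "prim 1 \<phi> \<phi>'" "\<phi>' \<in> L2" "\<phi> 0 = 0" "\<phi> 1 = 0"
  shows "ip g \<phi> = - ip f \<phi>'"
proof -
  obtain c where "AE x in lebesgue_on Om. f x = c + indef 1 g x" using weak_deriv_rep[OF f] ..
  from ip_by_parts[OF f this \<phi>(1,2)] \<phi>(3,4) show ?thesis by simp
qed

text \<open>Here \<open>f\<close> kills the boundary terms, since its continuous representative must
  coincide with the function \<open>h\<close> of \<open>bdry_zero\<close>. The test function may be
  a cosine, nonzero at the ends.\<close>

lemma weak_deriv_by_parts_H01:
  assumes f: "weak_deriv_of f g" "bdry_zero f" and \<phi>: "prim 1 \<phi> \<phi>'" "\<phi>' \<in> L2"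
  shows "ip g \<phi> = - ip f \<phi>'"
proof -
  have g: "integrable (Iv 1) g" using f by (auto simp: weak_deriv_of_def intro: L2_imp_integrable)
  obtain c where c: "AE x in lebesgue_on Om. f x = c + indef 1 g x" using weak_deriv_rep[OF f(1)] ..
  obtain h where h: "continuous_on {0..1} h" "h 0 = 0" "h 1 = 0" "AE x in lebesgue_on Om. f x = h x"
    using f(2) unfolding bdry_zero_def by blast
  have ae: "AE x in Iv 1. h x = c + indef 1 g x"
    using c h(4) unfolding Om_Iv by eventually_elim simp
  have "h x = c + indef 1 g x" if "x \<in> {0..1}" for x
    by (rule continuous_AE_eq[OF _ h(1) _ ae that])
      (auto intro!: continuous_intros continuous_on_indef g)
  from this[of 0] this[of 1] have "c = 0" "c + indef 1 g 1 = 0" using h by (auto simp: indef_0)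
  with ip_by_parts[OF f(1) c \<phi>] show ?thesis by simp
qed

section \<open>Dirichlet modes and their frequencies (the \<open>\<mu>\<^sub>n\<close> of the
  overview)\<close>

definition freq :: "nat \<Rightarrow> real" where "freq n = real (Suc n) * pi"

lemma freq_ge_1: "1 \<le> freq n"
proof -
  have "1 * 1 \<le> real (Suc n) * pi" using pi_gt3 by (intro mult_mono) auto
  then show ?thesis by (simp add: freq_def)
qed

lemma sinb_has_derivative: "(sinb n has_real_derivative freq n * cosb (Suc n) x) (at x within A)"
  unfolding sinb_def cosb_def freq_def by (auto intro!: derivative_eq_intros)

lemma cosb_has_derivative: "(cosb (Suc n) has_real_derivative - freq n * sinb n x) (at x within A)"
  unfolding sinb_def cosb_def freq_def by (auto intro!: derivative_eq_intros)

lemma prim_sinb: "prim 1 (sinb n) (\<lambda>x. freq n * cosb (Suc n) x)"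
  by (intro prim_C1 sinb_has_derivative continuous_intros continuous_cosb) auto

lemma prim_cosb: "prim 1 (cosb (Suc n)) (\<lambda>x. - freq n * sinb n x)"
  by (intro prim_C1 cosb_has_derivative continuous_intros continuous_sinb) auto

lemma sinb_boundary: "sinb n 0 = 0" "sinb n 1 = 0"
  using sin_npi[of "Suc n"] by (simp_all add: sinb_def)

lemma weak_deriv_sinb: "weak_deriv_of (sinb n) (\<lambda>x. freq n * cosb (Suc n) x)"
  by (intro weak_deriv_C1 sinb_has_derivative continuous_intros continuous_cosb)

lemma weak_deriv_cosb: "weak_deriv_of (cosb (Suc n)) (\<lambda>x. - freq n * sinb n x)"
  by (intro weak_deriv_C1 cosb_has_derivative continuous_intros continuous_sinb)

lemma wd_sinb: "AE x in lebesgue_on Om. wd (sinb n) x = freq n * cosb (Suc n) x"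
  by (rule wd_AE[OF weak_deriv_sinb])

lemma weak_deriv_wd_sinb: "weak_deriv_of (wd (sinb n)) (\<lambda>x. freq n * (- freq n * sinb n x))"
  by (rule weak_deriv_cong_AE[OF weak_deriv_cmult[OF weak_deriv_cosb]]) (use wd_sinb[of n] in eventually_elim, simp)

lemma wd_wd_sinb: "AE x in lebesgue_on Om. wd (wd (sinb n)) x = - (freq n)\<^sup>2 * sinb n x"
  using wd_AE[OF weak_deriv_wd_sinb, of n] by (simp add: power2_eq_square mult.assoc)

lemma sinb_V02: "sinb n \<in> V02"
proof -
  have "bdry_zero (sinb n)"
    unfolding bdry_zero_def using continuous_sinb sinb_boundary by (intro exI[of _ "sinb n"]) auto
  then show ?thesis
    using weak_deriv_H1[OF weak_deriv_sinb] weak_deriv_H1[OF weak_deriv_wd_sinb]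
    by (auto simp: V02_def H2_def)
qed

text \<open>The sine coefficients of \<open>f\<close> determine the cosine coefficients of \<open>g\<close> as they would for \<open>g = f'\<close>
  with \<open>f\<close> vanishing at both ends.\<close>

definition D01 :: "(real \<Rightarrow> real) \<Rightarrow> (real \<Rightarrow> real) \<Rightarrow> bool" where
  "D01 f g \<longleftrightarrow> f \<in> L2 \<and> g \<in> L2 \<and> ip g (cosb 0) = 0 \<and> (\<forall>n. ip g (cosb (Suc n)) = freq n * ip f (sinb n))"

lemma D01_diff:
  "D01 f g \<Longrightarrow> D01 f' g' \<Longrightarrow> D01 (\<lambda>x. f x - f' x) (\<lambda>x. g x - g' x)"
  by (simp add: D01_def L2_diff ip_diff_left L2_cosb L2_sinb right_diff_distrib)

text \<open>Integration by parts against cosines; the boundary terms vanish with \<open>f\<close>,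
  and the coefficient of the constant is the difference of the two boundary values.\<close>

lemma D01_H01:
  assumes "f \<in> H01" shows "D01 f (wd f)"
proof -
  have f: "weak_deriv_of f (wd f)" "bdry_zero f" using assms weak_deriv_wd by (auto simp: H01_def)
  have "prim 1 (cosb 0) (\<lambda>x. 0)"
    unfolding cosb_def by (intro prim_C1) (auto intro!: derivative_eq_intros)
  from weak_deriv_by_parts_H01[OF f this] have "ip (wd f) (cosb 0) = 0"
    using L2_continuous[of "\<lambda>x. 0"] by (simp add: ip_def)
  moreover have "ip (wd f) (cosb (Suc n)) = freq n * ip f (sinb n)" for n
    using weak_deriv_by_parts_H01[OF f prim_cosb[of n] L2_cmult[OF L2_sinb]]
    unfolding ip_cmult_right by simp
  ultimately show ?thesis using f by (simp add: D01_def weak_deriv_of_def)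
qed

text \<open>Two integrations by parts: the boundary terms vanish first because \<open>sinb n\<close>
  does and then because \<open>u\<close> does, so no boundary value of a derivative of
  \<open>u\<close> appears.\<close>

lemma ip_wd_wd_sinb:
  assumes "u \<in> V02" shows "ip (wd (wd u)) (sinb n) = - (freq n)\<^sup>2 * ip u (sinb n)"
proof -
  have u: "u \<in> H01" "weak_deriv_of (wd u) (wd (wd u))" using assms weak_deriv_wd by (auto simp: V02_def H2_def H01_def)
  have "ip (wd (wd u)) (sinb n) = - ip (wd u) (\<lambda>x. freq n * cosb (Suc n) x)"
    by (rule weak_deriv_by_parts[OF u(2) prim_sinb L2_cmult[OF L2_cosb] sinb_boundary])
  also have "\<dots> = - (freq n)\<^sup>2 * ip u (sinb n)"
    using D01_H01[OF u(1)] by (simp add: D01_def ip_cmult_right power2_eq_square)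
  finally show ?thesis .
qed

text \<open>The coefficient of \<open>cosb 0\<close> is zero, so the cosine series may start at
  index 1 and runs in step with the sine series.\<close>

lemma parseval_D01:
  assumes "D01 f g" "h \<in> L2"
  shows "(\<lambda>N. \<Sum>n<N. ip g (cosb (Suc n)) * ip h (cosb (Suc n))) \<longlonglongrightarrow> ip g h"
proof -
  have "(\<lambda>N. \<Sum>n<Suc N. ip g (cosb n) * ip h (cosb n)) \<longlonglongrightarrow> ip g h"
    using parseval[OF onb_cosb, of g h] assms by (intro LIMSEQ_Suc) (auto simp: D01_def)
  then show ?thesis using assms(1) by (simp only: sum.lessThan_Suc_shift D01_def mult_zero_left add_0_left)
qed

lemma parseval_D01_bound:
  assumes "D01 f g" "h \<in> L2"
  shows "\<bar>\<Sum>n<N. ip g (cosb (Suc n)) * ip h (cosb (Suc n))\<bar> \<le> ip g g + ip h h"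
proof -
  have "\<bar>\<Sum>n<Suc N. ip g (cosb n) * ip h (cosb n)\<bar> \<le> ip g g + ip h h"
    using assms by (intro parseval_partial_bound onb_cosb) (auto simp: D01_def)
  then show ?thesis using assms(1) by (simp only: sum.lessThan_Suc_shift D01_def mult_zero_left add_0_left)
qed

text \<open>Mode by mode, since every frequency is at least 1. The optimal constant would be 1/pi^2;
  the constant 1 suffices.\<close>

lemma poincare:
  assumes "D01 f g" shows "ip f f \<le> ip g g"
proof (rule LIMSEQ_le)
  show "(\<lambda>N. \<Sum>k<N. (ip f (sinb k))\<^sup>2) \<longlonglongrightarrow> ip f f"
    using assms by (intro parseval_norm onb_sinb) (simp add: D01_def)
  show "(\<lambda>N. \<Sum>n<N. ip g (cosb (Suc n)) * ip g (cosb (Suc n))) \<longlonglongrightarrow> ip g g"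
    using assms by (intro parseval_D01[OF assms]) (simp add: D01_def)
  have "(ip f (sinb k))\<^sup>2 \<le> ip g (cosb (Suc k)) * ip g (cosb (Suc k))" for k
  proof -
    have "1 * (ip f (sinb k))\<^sup>2 \<le> (freq k)\<^sup>2 * (ip f (sinb k))\<^sup>2"
      using freq_ge_1[of k] by (intro mult_right_mono) (auto simp: one_le_power)
    then show ?thesis using assms by (simp add: D01_def power2_eq_square mult_ac)
  qed
  then show "\<exists>N. \<forall>n\<ge>N. (\<Sum>k<n. (ip f (sinb k))\<^sup>2) \<le> (\<Sum>k<n. ip g (cosb (Suc k)) * ip g (cosb (Suc k)))"
    by (auto intro: sum_mono)
qed

lemma ip1_ge_0: "0 \<le> ip1 f f"
  by (simp add: ip1_def ip_ge_0)

lemma norm1_power2: "(norm1 f)\<^sup>2 = ip f f + ip (wd f) (wd f)"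
  using ip1_ge_0[of f] by (simp add: norm1_def ip1_def)

text \<open>On an interval of length 1 this says that the variance of |g| is nonnegative.\<close>

lemma integral_abs_power2_le:
  assumes "g \<in> L2" shows "(LINT x|lebesgue_on Om. \<bar>g x\<bar>)\<^sup>2 \<le> ip g g"
proof -
  define m where "m = (LINT x|lebesgue_on Om. \<bar>g x\<bar>)"
  have g: "(\<lambda>x. \<bar>g x\<bar>) \<in> L2" using assms by (auto simp: L2_def)
  have 1: "(\<lambda>x. m) \<in> L2" by (rule L2_continuous) auto
  have "0 \<le> ip (\<lambda>x. \<bar>g x\<bar> - m) (\<lambda>x. \<bar>g x\<bar> - m)" by (rule ip_ge_0)
  also have "\<dots> = ip (\<lambda>x. \<bar>g x\<bar>) (\<lambda>x. \<bar>g x\<bar>) - 2 * ip (\<lambda>x. \<bar>g x\<bar>) (\<lambda>x. m) + m\<^sup>2"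
    by (simp add: ip_square_diff[OF g 1] ip_const_1)
  also have "ip (\<lambda>x. \<bar>g x\<bar>) (\<lambda>x. m) = m\<^sup>2" by (simp add: ip_def m_def power2_eq_square)
  also have "ip (\<lambda>x. \<bar>g x\<bar>) (\<lambda>x. \<bar>g x\<bar>) = ip g g" by (simp add: ip_def)
  finally show ?thesis by (simp add: m_def)
qed

text \<open>The oscillation of the continuous representative \<open>F\<close> is at most the
  integral \<open>m\<close> of |f'|. Averaging F(x)^2 \<le> 2 F(y)^2 + 2 m^2 over y in the unit
  interval gives the bound with factor 2.\<close>

lemma H1_sup_bound:
  assumes "f \<in> H1" shows "AE x in lebesgue_on Om. (f x)\<^sup>2 \<le> 2 * (norm1 f)\<^sup>2"
proof -
  define g where "g = wd f"
  have f: "weak_deriv_of f g" unfolding g_def by (rule weak_deriv_wd[OF assms])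
  then have L: "f \<in> L2" "g \<in> L2" by (auto simp: weak_deriv_of_def)
  have gi: "integrable (Iv 1) g" by (rule L2_imp_integrable[OF L(2)])
  obtain c where c: "AE x in lebesgue_on Om. f x = c + indef 1 g x" using weak_deriv_rep[OF f] ..
  define F where "F x = c + indef 1 g x" for x
  have Fc: "continuous_on {0..1} F" unfolding F_def by (intro continuous_intros continuous_on_indef gi)
  have FL: "F \<in> L2" using Fc by (rule L2_continuous)
  define m where "m = (LINT x|lebesgue_on Om. \<bar>g x\<bar>)"
  have d: "\<bar>F x - F y\<bar> \<le> m" for x y
  proof -
    have "F x - F y = (LINT s|Iv 1. indicat_real {..<x} s * g s - indicat_real {..<y} s * g s)"
      unfolding F_def indef_def using integrable_indicator_mult[OF gi, of "{..<x}"] integrable_indicator_mult[OF gi, of "{..<y}"]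
      by simp
    also have "\<bar>\<dots>\<bar> \<le> (LINT s|Iv 1. \<bar>g s\<bar>)"
    proof (rule integral_abs_bound_integral)
      show "integrable (Iv 1) (\<lambda>s. indicat_real {..<x} s * g s - indicat_real {..<y} s * g s)"
        by (intro Bochner_Integration.integrable_diff integrable_indicator_mult gi) auto
    qed (use gi in \<open>auto simp: indicator_def\<close>)
    finally show ?thesis by (simp add: m_def Om_Iv)
  qed
  have sq: "(F x)\<^sup>2 \<le> 2 * (F y)\<^sup>2 + 2 * m\<^sup>2" for x y
  proof -
    have "(F x)\<^sup>2 = (F y + (F x - F y))\<^sup>2" by simp
    also have "\<dots> \<le> 2 * (F y)\<^sup>2 + 2 * (F x - F y)\<^sup>2"
      using sum_squares_bound[of "F y" "F x - F y"] unfolding power2_sum by linarith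
    also have "(F x - F y)\<^sup>2 \<le> m\<^sup>2" using d[of x y] by (metis abs_ge_zero power2_abs power_mono)
    finally show ?thesis by simp
  qed
  have Fb: "(F x)\<^sup>2 \<le> 2 * ip f f + 2 * ip g g" for x
  proof -
    have "(F x)\<^sup>2 = (LINT y|Iv 1. (F x)\<^sup>2)" by (simp add: measure_restrict_space)
    also have "\<dots> \<le> (LINT y|Iv 1. 2 * (F y)\<^sup>2 + 2 * m\<^sup>2)"
      by (rule integral_mono) (auto intro!: integrable_Iv_continuous continuous_intros Fc sq)
    also have "\<dots> = 2 * (LINT y|Iv 1. (F y)\<^sup>2) + 2 * m\<^sup>2"
      using integrable_Iv_const[of 1 "2 * m\<^sup>2"] L2D(2)[OF FL] by (simp add: Om_Iv measure_restrict_space)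
    also have "(LINT y|Iv 1. (F y)\<^sup>2) = ip f f"
    proof -
      have "ip F F = ip f f" using c by (intro ip_cong_AE FL) (auto simp: F_def elim: eventually_mono)
      then show ?thesis by (simp add: ip_power2 Om_Iv)
    qed
    also have "m\<^sup>2 \<le> ip g g" unfolding m_def by (rule integral_abs_power2_le[OF L(2)])
    finally show ?thesis by simp
  qed
  show ?thesis
    using c by eventually_elim (use Fb in \<open>simp add: F_def norm1_power2 g_def\<close>)
qed

section \<open>Weakly measurable families\<close>

lemma ip_cauchy_schwarz:
  assumes f: "f \<in> L2" and g: "g \<in> L2"
  shows "(ip f g)\<^sup>2 \<le> ip f f * ip g g"
proof -
  have *: "(ip f g)\<^sup>2 \<le> ip f f * ip g g" if f: "f \<in> L2" and g: "g \<in> L2" and pos: "ip g g > 0" for f g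
  proof -
    let ?B = "ip g g" and ?A = "ip f g"
    have "0 \<le> ip (\<lambda>x. ?B * f x - ?A * g x) (\<lambda>x. ?B * f x - ?A * g x)" by (rule ip_ge_0)
    also have "\<dots> = ?B * (?B * ip f f - ?A\<^sup>2)"
      unfolding ip_square_diff[OF L2_cmult[OF f] L2_cmult[OF g]] ip_cmult_left ip_cmult_right
      by (simp add: power2_eq_square algebra_simps)
    finally show ?thesis using pos by (simp add: zero_le_mult_iff mult.commute)
  qed
  show ?thesis
  proof (cases "ip g g > 0 \<or> ip f f > 0")
    case True
    then show ?thesis using *[OF f g] *[OF g f] by (auto simp: ip_commute[of g f] mult.commute)
  next
    case False
    then have "ip f f = 0" "ip g g = 0" using ip_ge_0[of f] ip_ge_0[of g] by auto
    then show ?thesis using ip_abs_le[OF f g] by simp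
  qed
qed

section \<open>Families continuous in time with values in \<open>L2\<close>\<close>

lemma CL2_L2: "CL2 T u \<Longrightarrow> t \<in> {0..T} \<Longrightarrow> u t \<in> L2"
  by (simp add: CL2_def)

lemma CL2_tendsto:
  "CL2 T u \<Longrightarrow> s \<in> {0..T} \<Longrightarrow> ((\<lambda>t. ip (\<lambda>x. u t x - u s x) (\<lambda>x. u t x - u s x)) \<longlongrightarrow> 0) (at s within {0..T})"
  by (simp add: CL2_def ip_power2)

lemma CL2_const: "h \<in> L2 \<Longrightarrow> CL2 T (\<lambda>t. h)"
  by (simp add: CL2_def)

lemma CL2_zero: "CL2 T (\<lambda>t x. 0)"
  by (rule CL2_const) (simp add: L2_continuous)

lemma CL2_diff:
  assumes u: "CL2 T u" and w: "CL2 T w" shows "CL2 T (\<lambda>t x. u t x - w t x)"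
  unfolding CL2_def
proof safe
  fix s assume s: "s \<in> {0..T}"
  show "(\<lambda>x. u s x - w s x) \<in> L2" by (intro L2_diff CL2_L2[OF u s] CL2_L2[OF w s])
  let ?a = "\<lambda>t. (\<lambda>x. u t x - u s x)" and ?b = "\<lambda>t. (\<lambda>x. w t x - w s x)"
  have "((\<lambda>t. ip (\<lambda>x. ?a t x - ?b t x) (\<lambda>x. ?a t x - ?b t x)) \<longlongrightarrow> 0) (at s within {0..T})"
  proof (rule tendsto_sandwich[OF _ _ tendsto_const])
    show "((\<lambda>t. 2 * ip (?a t) (?a t) + 2 * ip (?b t) (?b t)) \<longlongrightarrow> 0) (at s within {0..T})"
      using tendsto_add[OF tendsto_mult_right_zero[OF CL2_tendsto[OF u s]] tendsto_mult_right_zero[OF CL2_tendsto[OF w s]]] by simp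
    show "\<forall>\<^sub>F t in at s within {0..T}. 0 \<le> ip (\<lambda>x. ?a t x - ?b t x) (\<lambda>x. ?a t x - ?b t x)"
      by (simp add: ip_ge_0)
    show "\<forall>\<^sub>F t in at s within {0..T}. ip (\<lambda>x. ?a t x - ?b t x) (\<lambda>x. ?a t x - ?b t x) \<le>
        2 * ip (?a t) (?a t) + 2 * ip (?b t) (?b t)"
      unfolding eventually_at_filter
      by (intro always_eventually allI impI ip_square_diff_le L2_diff CL2_L2[OF u] CL2_L2[OF w] s)
  qed
  moreover have "?a t x - ?b t x = u t x - w t x - (u s x - w s x)" for t x by simp
  ultimately show "((\<lambda>t. LINT x|lebesgue_on Om. (u t x - w t x - (u s x - w s x))\<^sup>2) \<longlongrightarrow> 0) (at s within {0..T})"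
    by (simp only: ip_power2)
qed

text \<open>Expanding both factors around time \<open>s\<close> leaves three error terms, each of
  which tends to 0 by the Cauchy-Schwarz inequality.\<close>

lemma continuous_on_ip:
  assumes u: "CL2 T u" and w: "CL2 T w"
  shows "continuous_on {0..T} (\<lambda>t. ip (u t) (w t))"
  unfolding continuous_on_def
proof
  fix s assume s: "s \<in> {0..T}"
  let ?a = "\<lambda>t. (\<lambda>x. u t x - u s x)" and ?b = "\<lambda>t. (\<lambda>x. w t x - w s x)"
  let ?F = "at s within {0..T}"
  have aL: "?a t \<in> L2" and bL: "?b t \<in> L2" if "t \<in> {0..T}" for t
    by (intro L2_diff CL2_L2[OF u] CL2_L2[OF w] that s)+
  have zero: "((\<lambda>t. ip (f t) (g t)) \<longlongrightarrow> 0) ?F"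
    if f: "\<And>t. t \<in> {0..T} \<Longrightarrow> f t \<in> L2" and g: "\<And>t. t \<in> {0..T} \<Longrightarrow> g t \<in> L2"
      and l: "((\<lambda>t. ip (f t) (f t) * ip (g t) (g t)) \<longlongrightarrow> 0) ?F" for f g
  proof -
    have "((\<lambda>t. (ip (f t) (g t))\<^sup>2) \<longlongrightarrow> 0) ?F"
    proof (rule tendsto_sandwich[OF _ _ tendsto_const l])
      show "\<forall>\<^sub>F t in ?F. (ip (f t) (g t))\<^sup>2 \<le> ip (f t) (f t) * ip (g t) (g t)"
        unfolding eventually_at_filter by (intro always_eventually) (auto intro!: ip_cauchy_schwarz f g)
    qed simp
    then have "((\<lambda>t. sqrt ((ip (f t) (g t))\<^sup>2)) \<longlongrightarrow> sqrt 0) ?F" by (rule tendsto_real_sqrt)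
    then show ?thesis by (simp add: tendsto_rabs_zero_iff)
  qed
  have a: "((\<lambda>t. ip (?a t) (?a t)) \<longlongrightarrow> 0) ?F" and b: "((\<lambda>t. ip (?b t) (?b t)) \<longlongrightarrow> 0) ?F"
    by (rule CL2_tendsto[OF u s], rule CL2_tendsto[OF w s])
  have "((\<lambda>t. ip (?a t) (?b t) + ip (?a t) (w s) + ip (u s) (?b t) + ip (u s) (w s)) \<longlongrightarrow> 0 + 0 + 0 + ip (u s) (w s)) ?F"
  proof (intro tendsto_add tendsto_const)
    show "((\<lambda>t. ip (?a t) (?b t)) \<longlongrightarrow> 0) ?F"
      by (rule zero[OF aL bL]) (use tendsto_mult[OF a b] in auto)
    show "((\<lambda>t. ip (?a t) (w s)) \<longlongrightarrow> 0) ?F"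
      by (rule zero[OF aL CL2_L2[OF w s]]) (use tendsto_mult[OF a tendsto_const] in auto)
    show "((\<lambda>t. ip (u s) (?b t)) \<longlongrightarrow> 0) ?F"
      by (rule zero[OF CL2_L2[OF u s] bL]) (use tendsto_mult[OF tendsto_const b] in auto)
  qed
  then have "((\<lambda>t. ip (?a t) (?b t) + ip (?a t) (w s) + ip (u s) (?b t) + ip (u s) (w s)) \<longlongrightarrow> ip (u s) (w s)) ?F"
    by simp
  moreover have "\<forall>\<^sub>F t in ?F. ip (?a t) (?b t) + ip (?a t) (w s) + ip (u s) (?b t) + ip (u s) (w s) = ip (u t) (w t)"
  proof -
    have "ip (?a t) (?b t) + ip (?a t) (w s) + ip (u s) (?b t) + ip (u s) (w s) = ip (u t) (w t)" if t: "t \<in> {0..T}" for t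
    proof -
      note L = CL2_L2[OF u s] CL2_L2[OF w s] CL2_L2[OF u t] CL2_L2[OF w t]
      show ?thesis by (simp add: ip_diff_left ip_diff_right L L2_diff)
    qed
    then show ?thesis unfolding eventually_at_filter by (intro always_eventually) auto
  qed
  ultimately show "((\<lambda>t. ip (u t) (w t)) \<longlongrightarrow> ip (u s) (w s)) ?F" by (rule Lim_transform_eventually)
qed

section \<open>Weak measurability and square integrability in time\<close>

definition wmeas :: "real \<Rightarrow> (real \<Rightarrow> real \<Rightarrow> real) \<Rightarrow> bool" where
  "wmeas T X \<longleftrightarrow> (AE t in Iv T. X t \<in> L2) \<and> (\<forall>h\<in>L2. (\<lambda>t. ip (X t) h) \<in> borel_measurable (Iv T))"

text \<open>A countable basis reduces the inner product of two moving functions to products of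
  scalar measurable functions.\<close>

lemma wmeas_ip_measurable:
  assumes "wmeas T X" "wmeas T Y" shows "(\<lambda>t. ip (X t) (Y t)) \<in> borel_measurable (Iv T)"
proof (rule borel_measurable_LIMSEQ_AE)
  show "(\<lambda>t. \<Sum>k<N. ip (X t) (sinb k) * ip (Y t) (sinb k)) \<in> borel_measurable (Iv T)" for N
    using assms L2_sinb unfolding wmeas_def by (intro borel_measurable_sum borel_measurable_times) auto
  have "AE t in Iv T. X t \<in> L2" "AE t in Iv T. Y t \<in> L2" using assms by (auto simp: wmeas_def)
  then show "AE t in Iv T. (\<lambda>N. \<Sum>k<N. ip (X t) (sinb k) * ip (Y t) (sinb k)) \<longlonglongrightarrow> ip (X t) (Y t)"
    by eventually_elim (rule parseval[OF onb_sinb])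
qed simp

lemma wmeas_diff:
  assumes X: "wmeas T X" and Y: "wmeas T Y" shows "wmeas T (\<lambda>t x. X t x - Y t x)"
proof -
  have L: "AE t in Iv T. X t \<in> L2" "AE t in Iv T. Y t \<in> L2" using assms by (auto simp: wmeas_def)
  have "(\<lambda>t. ip (\<lambda>x. X t x - Y t x) h) \<in> borel_measurable (Iv T)" if h: "h \<in> L2" for h
  proof (rule borel_measurable_lebesgue_on_AE)
    show "(\<lambda>t. ip (X t) h - ip (Y t) h) \<in> borel_measurable (Iv T)"
      using X Y h by (intro borel_measurable_diff) (auto simp: wmeas_def)
    show "AE t in Iv T. ip (X t) h - ip (Y t) h = ip (\<lambda>x. X t x - Y t x) h"
      using L by eventually_elim (simp add: ip_diff_left h)
  qed simp
  moreover have "AE t in Iv T. (\<lambda>x. X t x - Y t x) \<in> L2"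
    using L by eventually_elim (rule L2_diff)
  ultimately show ?thesis by (auto simp: wmeas_def)
qed

definition bdd_coeff :: "(real \<Rightarrow> real) \<Rightarrow> bool" where
  "bdd_coeff d \<longleftrightarrow> d \<in> borel_measurable (lebesgue_on Om) \<and> (\<exists>B. AE x in lebesgue_on Om. \<bar>d x\<bar> \<le> B)"

lemma bdd_coeff_mult_L2: "bdd_coeff d \<Longrightarrow> f \<in> L2 \<Longrightarrow> (\<lambda>x. d x * f x) \<in> L2"
  unfolding bdd_coeff_def by (auto intro: L2_bounded_mult)

lemma bdd_coeff_const: "bdd_coeff (\<lambda>x. c)"
  by (auto simp: bdd_coeff_def)

lemma wmeas_mult:
  assumes X: "wmeas T X" and d: "bdd_coeff d"
  shows "wmeas T (\<lambda>t x. d x * X t x)"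
proof -
  have L: "AE t in Iv T. X t \<in> L2" using X by (auto simp: wmeas_def)
  then have "AE t in Iv T. (\<lambda>x. d x * X t x) \<in> L2"
    by eventually_elim (rule bdd_coeff_mult_L2[OF d])
  then show ?thesis using X bdd_coeff_mult_L2[OF d] unfolding wmeas_def ip_mult_move by auto
qed

text \<open>Stands in for the Bochner space of square integrable functions of time with values in
  \<open>L2\<close>.\<close>

definition LL :: "real \<Rightarrow> (real \<Rightarrow> real \<Rightarrow> real) \<Rightarrow> bool" where
  "LL T X \<longleftrightarrow> wmeas T X \<and> integrable (Iv T) (\<lambda>t. ip (X t) (X t))"

lemma LL_L2: "LL T X \<Longrightarrow> AE t in Iv T. X t \<in> L2"
  by (simp add: LL_def wmeas_def)

lemma LL_norm: "LL T X \<Longrightarrow> integrable (Iv T) (\<lambda>t. ip (X t) (X t))"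
  by (simp add: LL_def)

lemma LL_integrable_ip:
  assumes X: "LL T X" and Y: "LL T Y" shows "integrable (Iv T) (\<lambda>t. ip (X t) (Y t))"
proof (rule Bochner_Integration.integrable_bound)
  show "integrable (Iv T) (\<lambda>t. ip (X t) (X t) + ip (Y t) (Y t))" using X Y by (auto simp: LL_def)
  show "(\<lambda>t. ip (X t) (Y t)) \<in> borel_measurable (Iv T)" using X Y wmeas_ip_measurable by (auto simp: LL_def)
  show "AE t in Iv T. norm (ip (X t) (Y t)) \<le> norm (ip (X t) (X t) + ip (Y t) (Y t))"
    using LL_L2[OF X] LL_L2[OF Y]
  proof eventually_elim
    fix t assume "X t \<in> L2" "Y t \<in> L2"
    from ip_abs_le[OF this] show "norm (ip (X t) (Y t)) \<le> norm (ip (X t) (X t) + ip (Y t) (Y t))" by simp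
  qed
qed

lemma LL_diff:
  assumes X: "LL T X" and Y: "LL T Y" shows "LL T (\<lambda>t x. X t x - Y t x)"
proof -
  have w: "wmeas T (\<lambda>t x. X t x - Y t x)" using X Y by (auto simp: LL_def intro: wmeas_diff)
  moreover have "integrable (Iv T) (\<lambda>t. ip (\<lambda>x. X t x - Y t x) (\<lambda>x. X t x - Y t x))"
  proof (rule Bochner_Integration.integrable_bound)
    show "integrable (Iv T) (\<lambda>t. 2 * ip (X t) (X t) + 2 * ip (Y t) (Y t))" using X Y by (auto simp: LL_def)
    show "(\<lambda>t. ip (\<lambda>x. X t x - Y t x) (\<lambda>x. X t x - Y t x)) \<in> borel_measurable (Iv T)"
      by (rule wmeas_ip_measurable[OF w w])
    show "AE t in Iv T. norm (ip (\<lambda>x. X t x - Y t x) (\<lambda>x. X t x - Y t x)) \<le> norm (2 * ip (X t) (X t) + 2 * ip (Y t) (Y t))"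
      using LL_L2[OF X] LL_L2[OF Y]
    proof eventually_elim
      fix t assume "X t \<in> L2" "Y t \<in> L2"
      from ip_square_diff_le[OF this] ip_ge_0[of "\<lambda>x. X t x - Y t x"]
      show "norm (ip (\<lambda>x. X t x - Y t x) (\<lambda>x. X t x - Y t x)) \<le> norm (2 * ip (X t) (X t) + 2 * ip (Y t) (Y t))" by simp
    qed
  qed
  ultimately show ?thesis by (simp add: LL_def)
qed

lemma LL_mult:
  assumes X: "LL T X" and d: "bdd_coeff d"
  shows "LL T (\<lambda>t x. d x * X t x)"
proof -
  have w: "wmeas T (\<lambda>t x. d x * X t x)" using X by (auto simp: LL_def intro: wmeas_mult d)
  obtain B where dm: "d \<in> borel_measurable (lebesgue_on Om)" and B: "AE x in lebesgue_on Om. \<bar>d x\<bar> \<le> B"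
    using d by (auto simp: bdd_coeff_def)
  have B2: "AE x in lebesgue_on Om. (d x)\<^sup>2 \<le> B\<^sup>2"
    using B by eventually_elim (metis abs_ge_zero power2_abs power_mono)
  have "integrable (Iv T) (\<lambda>t. ip (\<lambda>x. d x * X t x) (\<lambda>x. d x * X t x))"
  proof (rule Bochner_Integration.integrable_bound)
    show "integrable (Iv T) (\<lambda>t. B\<^sup>2 * ip (X t) (X t))" using X by (auto simp: LL_def)
    show "(\<lambda>t. ip (\<lambda>x. d x * X t x) (\<lambda>x. d x * X t x)) \<in> borel_measurable (Iv T)"
      by (rule wmeas_ip_measurable[OF w w])
    show "AE t in Iv T. norm (ip (\<lambda>x. d x * X t x) (\<lambda>x. d x * X t x)) \<le> norm (B\<^sup>2 * ip (X t) (X t))"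
      using LL_L2[OF X]
    proof eventually_elim
      fix t assume "X t \<in> L2"
      from ip_bounded_mult_le[OF this dm B2] ip_ge_0[of "\<lambda>x. d x * X t x"]
      show "norm (ip (\<lambda>x. d x * X t x) (\<lambda>x. d x * X t x)) \<le> norm (B\<^sup>2 * ip (X t) (X t))" by simp
    qed
  qed
  then show ?thesis using w by (simp add: LL_def)
qed

lemma LL_minus: "LL T X \<Longrightarrow> LL T (\<lambda>t x. - X t x)"
  using LL_mult[OF _ bdd_coeff_const[of "-1"]] by simp

lemma LL_CL2:
  assumes "CL2 T u" shows "LL T u"
  unfolding LL_def wmeas_def
  using assms CL2_L2
  by (auto intro!: integrable_Iv_continuous borel_measurable_integrable continuous_on_ip CL2_const AE_I2)

text \<open>The cosine coefficients of \<open>wd (v t)\<close> are multiples of the sine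
  coefficients of \<open>v t\<close>, which are continuous in time; Parseval then exhibits every
  pairing with a fixed \<open>h\<close> as a limit of continuous functions.\<close>

lemma LL_wd:
  assumes v: "v \<in> L2V T H01 norm1" and c: "CL2 T v"
  shows "AE t in Iv T. D01 (v t) (wd (v t))" "LL T (\<lambda>t. wd (v t))"
proof -
  have "AE t in Iv T. v t \<in> H01" using v by (simp add: L2V_def)
  then show D: "AE t in Iv T. D01 (v t) (wd (v t))" by eventually_elim (rule D01_H01)
  have "(\<lambda>t. ip (wd (v t)) h) \<in> borel_measurable (Iv T)" if h: "h \<in> L2" for h
  proof (rule borel_measurable_LIMSEQ_AE)
    show "(\<lambda>t. \<Sum>n<N. freq n * ip (v t) (sinb n) * ip h (cosb (Suc n))) \<in> borel_measurable (Iv T)" for N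
      by (intro borel_measurable_integrable integrable_Iv_continuous continuous_intros
          continuous_on_ip[OF c CL2_const[OF L2_sinb]])
    show "AE t in Iv T. (\<lambda>N. \<Sum>n<N. freq n * ip (v t) (sinb n) * ip h (cosb (Suc n))) \<longlonglongrightarrow> ip (wd (v t)) h"
      using D
    proof eventually_elim
      fix t assume "D01 (v t) (wd (v t))"
      with parseval_D01[OF this h]
      show "(\<lambda>N. \<Sum>n<N. freq n * ip (v t) (sinb n) * ip h (cosb (Suc n))) \<longlonglongrightarrow> ip (wd (v t)) h"
        by (simp add: D01_def)
    qed
  qed simp
  moreover have "AE t in Iv T. wd (v t) \<in> L2" using D by eventually_elim (simp add: D01_def)
  moreover have "integrable (Iv T) (\<lambda>t. ip (wd (v t)) (wd (v t)))"
  proof -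
    have "integrable (Iv T) (\<lambda>t. (norm1 (v t))\<^sup>2 - ip (v t) (v t))"
      using v LL_norm[OF LL_CL2[OF c]] by (auto simp: L2V_def)
    then show ?thesis by (simp add: norm1_power2)
  qed
  ultimately show "LL T (\<lambda>t. wd (v t))" by (auto simp: LL_def wmeas_def)
qed

section \<open>Evolution equations in sine coefficients\<close>

lemma reflect_measurable: "(\<lambda>t. T - t) \<in> Iv T \<rightarrow>\<^sub>M Iv T"
proof (rule measurable_restrict_space2)
  have "(\<lambda>t::real. T - t) \<in> lebesgue \<rightarrow>\<^sub>M lebesgue"
    using lebesgue_affine_measurable[of "\<lambda>_. -1" T] by simp
  then show "(\<lambda>t. T - t) \<in> Iv T \<rightarrow>\<^sub>M lebesgue" by (rule measurable_restrict_space1)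
qed auto

lemma distr_reflect: "distr (Iv T) (Iv T) (\<lambda>t. T - t) = Iv T"
proof (rule measure_eqI)
  fix A assume "A \<in> sets (distr (Iv T) (Iv T) (\<lambda>t. T - t))"
  then have A: "A \<in> sets (Iv T)" by simp
  then have AT: "A \<subseteq> {0<..<T}" and AL: "A \<in> sets lebesgue"
    by (auto simp: sets_restrict_space)
  have m: "(\<lambda>t::real. T - t) \<in> lebesgue \<rightarrow>\<^sub>M lebesgue"
    using lebesgue_affine_measurable[of "\<lambda>_. -1" T] by simp
  have leb: "lebesgue = distr lebesgue lebesgue (\<lambda>t::real. T - t)"
    using lebesgue_real_affine[of "-1" T] by (simp add: density_1)
  have pre: "(\<lambda>t. T - t) -` A \<in> sets lebesgue"
    using measurable_sets[OF m AL] by simp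
  have "emeasure (distr (Iv T) (Iv T) (\<lambda>t. T - t)) A = emeasure (Iv T) ((\<lambda>t. T - t) -` A \<inter> {0<..<T})"
    by (subst emeasure_distr[OF reflect_measurable A]) simp
  also have "(\<lambda>t. T - t) -` A \<inter> {0<..<T} = (\<lambda>t. T - t) -` A" using AT by auto
  also have "emeasure (Iv T) ((\<lambda>t. T - t) -` A) = emeasure lebesgue ((\<lambda>t. T - t) -` A)"
    using AT by (intro emeasure_restrict_space) auto
  also have "\<dots> = emeasure (distr lebesgue lebesgue (\<lambda>t. T - t)) A"
    by (subst emeasure_distr[OF m AL]) simp
  also have "\<dots> = emeasure lebesgue A" by (subst (2) leb) simp
  also have "\<dots> = emeasure (Iv T) A" using AT by (intro emeasure_restrict_space[symmetric]) auto
  finally show "emeasure (distr (Iv T) (Iv T) (\<lambda>t. T - t)) A = emeasure (Iv T) A" .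
qed simp

lemma measurable_reflect:
  "f \<in> borel_measurable (Iv T) \<Longrightarrow> (\<lambda>t. f (T - t)) \<in> borel_measurable (Iv T)"
  by (rule measurable_compose[OF reflect_measurable])

lemma AE_reflect: "(AE t in Iv T. P t) \<Longrightarrow> AE t in Iv T. P (T - t)"
proof -
  assume "AE t in Iv T. P t"
  then have "AE t in distr (Iv T) (Iv T) (\<lambda>t. T - t). P t" by (simp only: distr_reflect)
  then show ?thesis by (rule AE_distrD[OF reflect_measurable])
qed

lemma integrable_reflect:
  fixes f :: "real \<Rightarrow> real"
  shows "integrable (Iv T) f \<Longrightarrow> integrable (Iv T) (\<lambda>t. f (T - t))"
  using integrable_distr[OF reflect_measurable, of T f] by (simp only: distr_reflect)

lemma integral_reflect:
  fixes f :: "real \<Rightarrow> real"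
  assumes "f \<in> borel_measurable (Iv T)"
  shows "(LINT t|Iv T. f (T - t)) = (LINT t|Iv T. f t)"
  using integral_distr[OF reflect_measurable assms] by (simp only: distr_reflect)

lemma prim_reflect:
  assumes F: "prim T F f" and T: "T > 0"
  shows "prim T (\<lambda>t. F (T - t)) (\<lambda>t. - f (T - t))"
proof (rule primI)
  have f: "integrable (Iv T) f" using F by (rule prim_integrable)
  show "integrable (Iv T) (\<lambda>t. - f (T - t))" using integrable_reflect[OF f] by simp
  fix t assume t: "t \<in> {0..T}"
  have "AE r in lebesgue. r \<noteq> T - t" by (rule AE_completion) (rule AE_lborel_singleton)
  then have ae: "AE r in Iv T. r \<noteq> T - t" by (subst AE_restrict_space_iff) auto
  have "indef T (\<lambda>t. - f (T - t)) t = - (LINT s|Iv T. indicat_real {..<t} s * f (T - s))"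
    unfolding indef_def by simp
  also have "(LINT s|Iv T. indicat_real {..<t} s * f (T - s)) =
     (LINT s|Iv T. indicat_real {T - t<..} (T - s) * f (T - s))"
    by (intro Bochner_Integration.integral_cong) (auto simp: indicator_def)
  also have "\<dots> = (LINT s|Iv T. indicat_real {T - t<..} s * f s)"
    by (rule integral_reflect[of "\<lambda>s. indicat_real {T - t<..} s * f s"])
      (intro borel_measurable_integrable integrable_indicator_mult f, simp)
  also have "\<dots> = (LINT s|Iv T. f s - indicat_real {..<T - t} s * f s)"
    using ae f integrable_indicator_mult[OF f, of "{T - t<..}"] integrable_indicator_mult[OF f, of "{..<T-t}"]
    by (intro integral_cong_AE) (auto simp: indicator_def)
  also have "\<dots> = (LINT s|Iv T. f s) - indef T f (T - t)"
    unfolding indef_def using f integrable_indicator_mult[OF f, of "{..<T-t}"] by simp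
  also have "\<dots> = F T - F (T - t)"
    using t prim_eq[OF F, of "T - t"] prim_T[OF F T] by auto
  finally show "F (T - t) = F (T - 0) + indef T (\<lambda>t. - f (T - t)) t" by simp
qed

lemma LL_reflect: "LL T X \<Longrightarrow> LL T (\<lambda>t. X (T - t))"
  unfolding LL_def wmeas_def
  using AE_reflect[where T=T and P="\<lambda>t. X t \<in> L2"] measurable_reflect[of "\<lambda>t. ip (X t) _" T]
    integrable_reflect[of T "\<lambda>t. ip (X t) (X t)"] by auto

lemma CL2_reflect:
  assumes u: "CL2 T u" shows "CL2 T (\<lambda>t. u (T - t))"
  unfolding CL2_def
proof safe
  fix s assume s: "s \<in> {0..T}"
  then have s': "T - s \<in> {0..T}" by auto
  show "u (T - s) \<in> L2" by (rule CL2_L2[OF u s'])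
  have "filterlim (\<lambda>t. T - t) (at (T - s) within {0..T}) (at s within {0..T})"
    unfolding filterlim_at
  proof
    show "\<forall>\<^sub>F t in at s within {0..T}. T - t \<in> {0..T} \<and> T - t \<noteq> T - s"
      by (auto simp: eventually_at_filter)
    show "((\<lambda>t. T - t) \<longlongrightarrow> T - s) (at s within {0..T})" by (intro tendsto_intros)
  qed
  with u s' show "((\<lambda>t. LINT x|lebesgue_on Om. (u (T - t) x - u (T - s) x)\<^sup>2) \<longlongrightarrow> 0) (at s within {0..T})"
    unfolding CL2_def using filterlim_compose by blast
qed

lemma prim_cong:
  assumes "prim T F f" "\<And>t. t \<in> {0..T} \<Longrightarrow> F t = F' t" "T > 0" "AE t in Iv T. f t = f' t"
  shows "prim T F' f'"
proof -
  have f: "integrable (Iv T) f" by (rule prim_integrable[OF assms(1)])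
  have "f' \<in> borel_measurable (Iv T)"
    by (rule borel_measurable_lebesgue_on_AE[OF borel_measurable_integrable[OF f] assms(4)]) simp
  from prim_cong_AE[OF assms(1,4) this] have p: "prim T F f'" .
  show ?thesis
  proof (rule primI[OF prim_integrable[OF p]])
    fix t assume "t \<in> {0..T}"
    then show "F' t = F' 0 + indef T f' t"
      using prim_eq[OF p] assms(2)[of t] assms(2)[of 0] assms(3) by force
  qed
qed

text \<open>\<open>evol T v X A G\<close>: the sine coefficients of \<open>v\<close> satisfy those of \<open>v\<^sub>t = A\<^sub>x + G\<close> with \<open>X = v\<^sub>x\<close>
  and homogeneous Dirichlet data.\<close>

definition evol :: "real \<Rightarrow> (real \<Rightarrow> real \<Rightarrow> real) \<Rightarrow> (real \<Rightarrow> real \<Rightarrow> real) \<Rightarrow>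
    (real \<Rightarrow> real \<Rightarrow> real) \<Rightarrow> (real \<Rightarrow> real \<Rightarrow> real) \<Rightarrow> bool" where
  "evol T v X A G \<longleftrightarrow> CL2 T v \<and> LL T X \<and> LL T A \<and> LL T G \<and> (AE t in Iv T. D01 (v t) (X t)) \<and>
     (\<forall>n. prim T (\<lambda>t. ip (v t) (sinb n)) (\<lambda>t. ip (G t) (sinb n) - freq n * ip (A t) (cosb (Suc n))))"

lemma evol_diff:
  assumes T: "T > 0" and 1: "evol T v X A G" and 2: "evol T v' X' A' G'"
  shows "evol T (\<lambda>t x. v t x - v' t x) (\<lambda>t x. X t x - X' t x) (\<lambda>t x. A t x - A' t x) (\<lambda>t x. G t x - G' t x)"
proof -
  have "AE t in Iv T. D01 (v t) (X t)" "AE t in Iv T. D01 (v' t) (X' t)" using 1 2 by (auto simp: evol_def)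
  then have D: "AE t in Iv T. D01 (\<lambda>x. v t x - v' t x) (\<lambda>x. X t x - X' t x)"
    by eventually_elim (rule D01_diff)
  have L: "AE t in Iv T. A t \<in> L2" "AE t in Iv T. A' t \<in> L2" "AE t in Iv T. G t \<in> L2" "AE t in Iv T. G' t \<in> L2"
    using 1 2 by (auto simp: evol_def LL_L2)
  have p: "prim T (\<lambda>t. ip (\<lambda>x. v t x - v' t x) (sinb n)) (\<lambda>t. ip (\<lambda>x. G t x - G' t x) (sinb n) -
     freq n * ip (\<lambda>x. A t x - A' t x) (cosb (Suc n)))" for n
  proof (rule prim_cong[OF prim_diff])
    show "prim T (\<lambda>t. ip (v t) (sinb n)) (\<lambda>t. ip (G t) (sinb n) - freq n * ip (A t) (cosb (Suc n)))"
      "prim T (\<lambda>t. ip (v' t) (sinb n)) (\<lambda>t. ip (G' t) (sinb n) - freq n * ip (A' t) (cosb (Suc n)))"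
      using 1 2 by (auto simp: evol_def)
    show "ip (v t) (sinb n) - ip (v' t) (sinb n) = ip (\<lambda>x. v t x - v' t x) (sinb n)" if "t \<in> {0..T}" for t
      using 1 2 that by (intro ip_diff_left[symmetric] L2_sinb CL2_L2) (auto simp: evol_def)
    show "AE t in Iv T. (ip (G t) (sinb n) - freq n * ip (A t) (cosb (Suc n))) -
         (ip (G' t) (sinb n) - freq n * ip (A' t) (cosb (Suc n))) =
         ip (\<lambda>x. G t x - G' t x) (sinb n) - freq n * ip (\<lambda>x. A t x - A' t x) (cosb (Suc n))"
      using L by eventually_elim (simp add: ip_diff_left L2_sinb L2_cosb algebra_simps)
  qed (rule T)
  show ?thesis using 1 2 D p by (auto simp: evol_def intro: CL2_diff LL_diff)
qed

text \<open>Reversal flips the sign of the time derivative, which is moved into the flux and the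
  source, while \<open>X\<close> remains the space derivative. This is one reason to carry the flux
  \<open>A\<close> separately from \<open>X\<close>.\<close>

lemma evol_reflect:
  assumes T: "T > 0" and 1: "evol T v X A G"
  shows "evol T (\<lambda>t. v (T - t)) (\<lambda>t. X (T - t)) (\<lambda>t x. - A (T - t) x) (\<lambda>t x. - G (T - t) x)"
proof -
  have D: "AE t in Iv T. D01 (v (T - t)) (X (T - t))"
    using AE_reflect[where T=T and P="\<lambda>t. D01 (v t) (X t)"] 1 by (simp add: evol_def)
  have p: "prim T (\<lambda>t. ip (v (T - t)) (sinb n)) (\<lambda>t. ip (\<lambda>x. - G (T - t) x) (sinb n) -
     freq n * ip (\<lambda>x. - A (T - t) x) (cosb (Suc n)))" for n
  proof -
    have "prim T (\<lambda>t. ip (v t) (sinb n)) (\<lambda>t. ip (G t) (sinb n) - freq n * ip (A t) (cosb (Suc n)))"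
      using 1 by (simp add: evol_def)
    from prim_reflect[OF this T] show ?thesis by (simp add: ip_minus_left algebra_simps)
  qed
  show ?thesis using 1 D p by (auto simp: evol_def intro: CL2_reflect LL_reflect LL_minus[OF LL_reflect])
qed

theorem evol_green:
  assumes T: "T > 0" and 1: "evol T v1 X1 A1 G1" and 2: "evol T v2 X2 A2 G2"
  shows "ip (v1 T) (v2 T) - ip (v1 0) (v2 0) =
    (LINT t|Iv T. ip (G1 t) (v2 t) - ip (X2 t) (A1 t) + ip (G2 t) (v1 t) - ip (X1 t) (A2 t))"
proof -
  have LL: "LL T v1" "LL T v2" "LL T X1" "LL T X2" "LL T A1" "LL T A2" "LL T G1" "LL T G2"
    using 1 2 LL_CL2 by (auto simp: evol_def)
  have C: "CL2 T v1" "CL2 T v2" using 1 2 by (auto simp: evol_def)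
  have D: "AE t in Iv T. D01 (v1 t) (X1 t)" "AE t in Iv T. D01 (v2 t) (X2 t)" using 1 2 by (auto simp: evol_def)
  have p1: "prim T (\<lambda>t. ip (v1 t) (sinb n)) (\<lambda>t. ip (G1 t) (sinb n) - freq n * ip (A1 t) (cosb (Suc n)))"
    and p2: "prim T (\<lambda>t. ip (v2 t) (sinb n)) (\<lambda>t. ip (G2 t) (sinb n) - freq n * ip (A2 t) (cosb (Suc n)))" for n
    using 1 2 by (auto simp: evol_def)
  \<comment> \<open>Compared with \<open>k0\<close>, each factor \<open>freq n\<close> is merged
    with a sine coefficient of \<open>v1\<close> or \<open>v2\<close> into a cosine coefficient of
    \<open>X1\<close> or \<open>X2\<close>. Only in this form can the sum over \<open>n\<close> be
    controlled.\<close>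
  define k where "k n t = ip (G1 t) (sinb n) * ip (v2 t) (sinb n) - ip (X2 t) (cosb (Suc n)) * ip (A1 t) (cosb (Suc n))
     + ip (G2 t) (sinb n) * ip (v1 t) (sinb n) - ip (X1 t) (cosb (Suc n)) * ip (A2 t) (cosb (Suc n))" for n t
  define k0 where "k0 n t = (ip (G1 t) (sinb n) - freq n * ip (A1 t) (cosb (Suc n))) * ip (v2 t) (sinb n) +
     ip (v1 t) (sinb n) * (ip (G2 t) (sinb n) - freq n * ip (A2 t) (cosb (Suc n)))" for n t
  have k0i: "integrable (Iv T) (k0 n)" for n
    unfolding k0_def
    using integrable_mult_continuous_Iv[OF prim_continuous[OF p2[of n]] prim_integrable[OF p1[of n]]]
      integrable_mult_continuous_Iv[OF prim_continuous[OF p1[of n]] prim_integrable[OF p2[of n]]]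
    by (intro Bochner_Integration.integrable_add) (auto simp: mult.commute)
  have k0k: "AE t in Iv T. k0 n t = k n t" for n
    using D by eventually_elim (simp add: k0_def k_def D01_def algebra_simps)
  have km: "k n \<in> borel_measurable (Iv T)" for n
    by (rule borel_measurable_lebesgue_on_AE[OF borel_measurable_integrable[OF k0i] k0k]) simp
  have ki: "integrable (Iv T) (k n)" for n
    by (rule integrable_cong_AE_imp[OF k0i km k0k])
  have step: "ip (v1 T) (sinb n) * ip (v2 T) (sinb n) - ip (v1 0) (sinb n) * ip (v2 0) (sinb n) = (LINT t|Iv T. k n t)" for n
  proof -
    have "ip (v1 T) (sinb n) * ip (v2 T) (sinb n) - ip (v1 0) (sinb n) * ip (v2 0) (sinb n) = (LINT t|Iv T. k0 n t)"
      unfolding k0_def by (rule prim_mult[OF p1 p2 T])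
    also have "\<dots> = (LINT t|Iv T. k n t)"
      by (rule integral_cong_AE[OF borel_measurable_integrable[OF k0i] km k0k])
    finally show ?thesis .
  qed
  have L: "AE t in Iv T. v1 t \<in> L2" "AE t in Iv T. v2 t \<in> L2" "AE t in Iv T. A1 t \<in> L2" "AE t in Iv T. A2 t \<in> L2"
     "AE t in Iv T. G1 t \<in> L2" "AE t in Iv T. G2 t \<in> L2"
    using LL by (auto simp: LL_L2)
  let ?h = "\<lambda>t. ip (G1 t) (v2 t) - ip (X2 t) (A1 t) + ip (G2 t) (v1 t) - ip (X1 t) (A2 t)"
  \<comment> \<open>One bound of \<open>parseval_partial_bound\<close> type for each of the four
    series in \<open>k\<close>.\<close>
  let ?w = "\<lambda>t. ip (G1 t) (G1 t) + ip (v2 t) (v2 t) + (ip (X2 t) (X2 t) + ip (A1 t) (A1 t)) +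
     (ip (G2 t) (G2 t) + ip (v1 t) (v1 t)) + (ip (X1 t) (X1 t) + ip (A2 t) (A2 t))"
  have split: "(\<Sum>n<N. k n t) = (\<Sum>n<N. ip (G1 t) (sinb n) * ip (v2 t) (sinb n)) - (\<Sum>n<N. ip (X2 t) (cosb (Suc n)) * ip (A1 t) (cosb (Suc n)))
     + (\<Sum>n<N. ip (G2 t) (sinb n) * ip (v1 t) (sinb n)) - (\<Sum>n<N. ip (X1 t) (cosb (Suc n)) * ip (A2 t) (cosb (Suc n)))" for N t
    by (simp add: k_def sum.distrib sum_subtractf)
  have "(\<lambda>N. LINT t|Iv T. (\<Sum>n<N. k n t)) \<longlonglongrightarrow> (LINT t|Iv T. ?h t)"
  proof (rule integral_dominated_convergence[where w="?w"])
    show "?h \<in> borel_measurable (Iv T)"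
      using LL by (intro borel_measurable_diff borel_measurable_add borel_measurable_integrable LL_integrable_ip)
    show "(\<lambda>t. \<Sum>n<N. k n t) \<in> borel_measurable (Iv T)" for N using km by simp
    show "integrable (Iv T) ?w"
      using LL by (intro Bochner_Integration.integrable_add LL_norm)
    show "AE t in Iv T. (\<lambda>N. \<Sum>n<N. k n t) \<longlonglongrightarrow> ?h t"
      using D L unfolding split
      by eventually_elim (intro tendsto_diff tendsto_add parseval[OF onb_sinb] parseval_D01; assumption)
    show "AE t in Iv T. norm (\<Sum>n<N. k n t) \<le> ?w t" for N
      using D L unfolding split
    proof eventually_elim
      fix t assume a: "D01 (v1 t) (X1 t)" "D01 (v2 t) (X2 t)" "v1 t \<in> L2" "v2 t \<in> L2" "A1 t \<in> L2" "A2 t \<in> L2" "G1 t \<in> L2" "G2 t \<in> L2"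
      from parseval_partial_bound[OF onb_sinb a(7,4), of N] parseval_partial_bound[OF onb_sinb a(8,3), of N]
        parseval_D01_bound[OF a(2,5), of N] parseval_D01_bound[OF a(1,6), of N]
      show "norm ((\<Sum>n<N. ip (G1 t) (sinb n) * ip (v2 t) (sinb n)) - (\<Sum>n<N. ip (X2 t) (cosb (Suc n)) * ip (A1 t) (cosb (Suc n)))
     + (\<Sum>n<N. ip (G2 t) (sinb n) * ip (v1 t) (sinb n)) - (\<Sum>n<N. ip (X1 t) (cosb (Suc n)) * ip (A2 t) (cosb (Suc n)))) \<le> ?w t"
        unfolding real_norm_def by linarith
    qed
  qed
  moreover have "(LINT t|Iv T. (\<Sum>n<N. k n t)) = (\<Sum>n<N. ip (v1 T) (sinb n) * ip (v2 T) (sinb n)) - (\<Sum>n<N. ip (v1 0) (sinb n) * ip (v2 0) (sinb n))" for N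
    using ki by (simp add: step[symmetric] sum_subtractf)
  moreover have "(\<lambda>N. (\<Sum>n<N. ip (v1 T) (sinb n) * ip (v2 T) (sinb n)) - (\<Sum>n<N. ip (v1 0) (sinb n) * ip (v2 0) (sinb n)))
     \<longlonglongrightarrow> ip (v1 T) (v2 T) - ip (v1 0) (v2 0)"
    using T by (intro tendsto_diff parseval[OF onb_sinb] CL2_L2[OF C(1)] CL2_L2[OF C(2)]) auto
  ultimately show ?thesis using LIMSEQ_unique by (simp only:) 
qed

section \<open>The fourth-order equation, mode by mode\<close>

definition evolu :: "real \<Rightarrow> (real \<Rightarrow> real \<Rightarrow> real) \<Rightarrow> (real \<Rightarrow> real \<Rightarrow> real) \<Rightarrow> bool" where
  "evolu T u F \<longleftrightarrow> CL2 T u \<and> CL2 T F \<and>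
     (\<forall>n. prim T (\<lambda>t. ip (u t) (sinb n)) (\<lambda>t. ip (F t) (sinb n) - (freq n) ^ 4 * ip (u t) (sinb n)))"

lemma evolu_diff:
  assumes T: "T > 0" and 1: "evolu T u F" and 2: "evolu T u' F'"
  shows "evolu T (\<lambda>t x. u t x - u' t x) (\<lambda>t x. F t x - F' t x)"
proof -
  have C: "CL2 T u" "CL2 T u'" "CL2 T F" "CL2 T F'" using 1 2 by (auto simp: evolu_def)
  have d: "ip (\<lambda>x. f t x - f' t x) (sinb n) = ip (f t) (sinb n) - ip (f' t) (sinb n)"
    if "CL2 T f" "CL2 T f'" "t \<in> {0..T}" for f f' t n
    using that by (intro ip_diff_left L2_sinb CL2_L2)
  have p: "prim T (\<lambda>t. ip (\<lambda>x. u t x - u' t x) (sinb n)) (\<lambda>t. ip (\<lambda>x. F t x - F' t x) (sinb n) -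
     freq n ^ 4 * ip (\<lambda>x. u t x - u' t x) (sinb n))" for n
  proof (rule prim_cong[OF prim_diff])
    show "prim T (\<lambda>t. ip (u t) (sinb n)) (\<lambda>t. ip (F t) (sinb n) - (freq n) ^ 4 * ip (u t) (sinb n))"
      "prim T (\<lambda>t. ip (u' t) (sinb n)) (\<lambda>t. ip (F' t) (sinb n) - (freq n) ^ 4 * ip (u' t) (sinb n))"
      using 1 2 by (auto simp: evolu_def)
    show "ip (u t) (sinb n) - ip (u' t) (sinb n) = ip (\<lambda>x. u t x - u' t x) (sinb n)" if "t \<in> {0..T}" for t
      using d[OF C(1,2) that] by simp
    show "AE t in Iv T. ip (F t) (sinb n) - freq n ^ 4 * ip (u t) (sinb n) -
             (ip (F' t) (sinb n) - freq n ^ 4 * ip (u' t) (sinb n)) =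
             ip (\<lambda>x. F t x - F' t x) (sinb n) - freq n ^ 4 * ip (\<lambda>x. u t x - u' t x) (sinb n)"
      by (intro AE_I2) (simp add: d[OF C(1,2)] d[OF C(3,4)] algebra_simps)
  qed (rule T)
  show ?thesis using C p by (auto simp: evolu_def intro: CL2_diff)
qed

lemma LINT_parseval:
  assumes C: "CL2 T f" "CL2 T g"
  shows "(\<lambda>N. LINT t|Iv T. (\<Sum>n<N. ip (f t) (sinb n) * ip (g t) (sinb n))) \<longlonglongrightarrow> (LINT t|Iv T. ip (f t) (g t))"
proof (rule integral_dominated_convergence[where w="\<lambda>t. ip (f t) (f t) + ip (g t) (g t)"])
  have c: "continuous_on {0..T} (\<lambda>t. ip (f t) (sinb n))" "continuous_on {0..T} (\<lambda>t. ip (g t) (sinb n))" for n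
    using continuous_on_ip[OF C(1) CL2_const[OF L2_sinb]] continuous_on_ip[OF C(2) CL2_const[OF L2_sinb]] by auto
  show "(\<lambda>t. ip (f t) (g t)) \<in> borel_measurable (Iv T)"
    by (intro borel_measurable_integrable integrable_Iv_continuous continuous_on_ip C)
  show "(\<lambda>t. \<Sum>n<N. ip (f t) (sinb n) * ip (g t) (sinb n)) \<in> borel_measurable (Iv T)" for N
    by (intro borel_measurable_integrable integrable_Iv_continuous continuous_intros c)
  show "integrable (Iv T) (\<lambda>t. ip (f t) (f t) + ip (g t) (g t))"
    by (intro integrable_Iv_continuous continuous_intros continuous_on_ip C)
  show "AE t in Iv T. (\<lambda>N. \<Sum>n<N. ip (f t) (sinb n) * ip (g t) (sinb n)) \<longlonglongrightarrow> ip (f t) (g t)"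
    by (intro AE_I2 parseval[OF onb_sinb] CL2_L2[OF C(1)] CL2_L2[OF C(2)]) auto
  show "AE t in Iv T. norm (\<Sum>n<N. ip (f t) (sinb n) * ip (g t) (sinb n)) \<le> ip (f t) (f t) + ip (g t) (g t)" for N
    unfolding real_norm_def
    by (intro AE_I2 parseval_partial_bound[OF onb_sinb] CL2_L2[OF C(1)] CL2_L2[OF C(2)]) auto
qed

lemma evolu_duality:
  assumes T: "T > 0" and U: "evolu T u F" and P: "evolu T (\<lambda>t. p (T - t)) (\<lambda>t x. 0)"
  shows "ip (u T) (p T) - ip (u 0) (p 0) = (LINT t|Iv T. ip (F t) (p t))"
proof -
  have Cp: "CL2 T p" using CL2_reflect[of T "\<lambda>t. p (T - t)"] P by (simp add: evolu_def)
  have C: "CL2 T u" "CL2 T F" using U by (auto simp: evolu_def)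
  have c: "continuous_on {0..T} (\<lambda>t. ip (f t) (sinb n))" if "CL2 T f" for f n
    using continuous_on_ip[OF that CL2_const[OF L2_sinb]] .
  have z: "ip (\<lambda>x. 0) g = 0" for g by (simp add: ip_def)
  have step: "ip (u T) (sinb n) * ip (p T) (sinb n) - ip (u 0) (sinb n) * ip (p 0) (sinb n) =
      (LINT t|Iv T. ip (F t) (sinb n) * ip (p t) (sinb n))" for n
  proof -
    have "prim T (\<lambda>t. ip (p (T - t)) (sinb n)) (\<lambda>t. ip (\<lambda>x. 0) (sinb n) - freq n ^ 4 * ip (p (T - t)) (sinb n))"
      using P by (simp add: evolu_def)
    from prim_reflect[OF this T] have pp: "prim T (\<lambda>t. ip (p t) (sinb n)) (\<lambda>t. freq n ^ 4 * ip (p t) (sinb n))"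
      by (simp add: z)
    have pu: "prim T (\<lambda>t. ip (u t) (sinb n)) (\<lambda>t. ip (F t) (sinb n) - freq n ^ 4 * ip (u t) (sinb n))"
      using U by (simp add: evolu_def)
    from prim_mult[OF pu pp T] show ?thesis by (simp add: algebra_simps)
  qed
  have i: "integrable (Iv T) (\<lambda>t. ip (F t) (sinb n) * ip (p t) (sinb n))" for n
    by (intro integrable_Iv_continuous continuous_intros c C Cp)
  have "(LINT t|Iv T. (\<Sum>n<N. ip (F t) (sinb n) * ip (p t) (sinb n))) =
     (\<Sum>n<N. ip (u T) (sinb n) * ip (p T) (sinb n)) - (\<Sum>n<N. ip (u 0) (sinb n) * ip (p 0) (sinb n))" for N
    using i by (simp add: step[symmetric] sum_subtractf)
  moreover have "(\<lambda>N. (\<Sum>n<N. ip (u T) (sinb n) * ip (p T) (sinb n)) - (\<Sum>n<N. ip (u 0) (sinb n) * ip (p 0) (sinb n)))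
     \<longlonglongrightarrow> ip (u T) (p T) - ip (u 0) (p 0)"
    using T by (intro tendsto_diff parseval[OF onb_sinb] CL2_L2[OF C(1)] CL2_L2[OF Cp]) auto
  ultimately show ?thesis using LINT_parseval[OF C(2) Cp] LIMSEQ_unique by (simp only:)
qed

text \<open>Each mode loses energy at rate at least 2 u^2 because its eigenvalue is at least 1; that
  loss absorbs the work 2 F u of the source, leaving at most F^2.\<close>

lemma evolu_energy:
  assumes T: "T > 0" and U: "evolu T u F"
  shows "ip (u T) (u T) \<le> ip (u 0) (u 0) + (LINT t|Iv T. ip (F t) (F t))"
proof -
  have C: "CL2 T u" "CL2 T F" using U by (auto simp: evolu_def)
  have c: "continuous_on {0..T} (\<lambda>t. ip (f t) (sinb n))" if "CL2 T f" for f n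
    using continuous_on_ip[OF that CL2_const[OF L2_sinb]] .
  have step: "(ip (u T) (sinb n))\<^sup>2 - (ip (u 0) (sinb n))\<^sup>2 \<le> (LINT t|Iv T. ip (F t) (sinb n) * ip (F t) (sinb n))" for n
  proof -
    let ?u = "\<lambda>t. ip (u t) (sinb n)" and ?F = "\<lambda>t. ip (F t) (sinb n)" and ?m = "freq n ^ 4"
    have pu: "prim T ?u (\<lambda>t. ?F t - ?m * ?u t)" using U by (simp add: evolu_def)
    have m: "1 \<le> ?m" using freq_ge_1 by (rule one_le_power)
    have "(?u T)\<^sup>2 - (?u 0)\<^sup>2 = (LINT t|Iv T. (?F t - ?m * ?u t) * ?u t + ?u t * (?F t - ?m * ?u t))"
      using prim_mult[OF pu pu T] by (simp add: power2_eq_square)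
    also have "\<dots> \<le> (LINT t|Iv T. ?F t * ?F t)"
    proof (rule integral_mono)
      show "integrable (Iv T) (\<lambda>t. (?F t - ?m * ?u t) * ?u t + ?u t * (?F t - ?m * ?u t))"
        by (intro integrable_Iv_continuous continuous_intros c C)
      show "integrable (Iv T) (\<lambda>t. ?F t * ?F t)"
        by (intro integrable_Iv_continuous continuous_intros c C)
      fix t
      \<comment> \<open>The right-hand side is F^2 - 2 u (F - m u) with the square
        completed.\<close>
      have "0 \<le> (?F t - ?u t)\<^sup>2 + (?u t)\<^sup>2 + 2 * ((?m - 1) * (?u t)\<^sup>2)" using m by simp
      then show "(?F t - ?m * ?u t) * ?u t + ?u t * (?F t - ?m * ?u t) \<le> ?F t * ?F t"
        by (simp add: power2_eq_square algebra_simps)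
    qed
    finally show ?thesis .
  qed
  have i: "integrable (Iv T) (\<lambda>t. ip (F t) (sinb n) * ip (F t) (sinb n))" for n
    by (intro integrable_Iv_continuous continuous_intros c C)
  have "ip (u T) (u T) - ip (u 0) (u 0) \<le> (LINT t|Iv T. ip (F t) (F t))"
  proof (rule LIMSEQ_le)
    show "(\<lambda>N. (\<Sum>n<N. (ip (u T) (sinb n))\<^sup>2) - (\<Sum>n<N. (ip (u 0) (sinb n))\<^sup>2)) \<longlonglongrightarrow> ip (u T) (u T) - ip (u 0) (u 0)"
      using T by (intro tendsto_diff parseval_norm[OF onb_sinb] CL2_L2[OF C(1)]) auto
    show "(\<lambda>N. LINT t|Iv T. (\<Sum>n<N. ip (F t) (sinb n) * ip (F t) (sinb n))) \<longlonglongrightarrow> (LINT t|Iv T. ip (F t) (F t))"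
      by (rule LINT_parseval[OF C(2) C(2)])
    have "(\<Sum>n<N. (ip (u T) (sinb n))\<^sup>2) - (\<Sum>n<N. (ip (u 0) (sinb n))\<^sup>2) \<le> (LINT t|Iv T. (\<Sum>n<N. ip (F t) (sinb n) * ip (F t) (sinb n)))" for N
      using i by (simp add: sum_subtractf[symmetric] sum_mono step)
    then show "\<exists>N. \<forall>n\<ge>N. (\<Sum>k<n. (ip (u T) (sinb k))\<^sup>2) - (\<Sum>k<n. (ip (u 0) (sinb k))\<^sup>2) \<le> (LINT t|Iv T. (\<Sum>k<n. ip (F t) (sinb k) * ip (F t) (sinb k)))"
      by blast
  qed
  then show ?thesis by simp
qed

text \<open>The mode \<open>sinb n\<close> is the test function; its \<open>wd\<close> is some
  unknown representative, replaced by the explicit cosine under the integral. The lemma serves both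
  the forward problem and the reversed adjoint problem, hence the general source.\<close>

lemma weak_sol_evol:
  assumes T: "T > 0" and w: "weak_sol T d F G a b u v" and d: "bdd_coeff d" and G: "CL2 T G"
  shows "evol T v (\<lambda>t. wd (v t)) (\<lambda>t x. d x * wd (v t) x) G"
proof -
  have v: "v \<in> L2V T H01 norm1" "CL2 T v" using w by (auto simp: weak_sol_def)
  note D = LL_wd[OF v]
  have A: "LL T (\<lambda>t x. d x * wd (v t) x)" by (rule LL_mult[OF D(2) d])
  have c: "continuous_on {0..T} (\<lambda>t. ip (f t) (sinb n))" if "CL2 T f" for f n
    using continuous_on_ip[OF that CL2_const[OF L2_sinb]] .
  have "prim T (\<lambda>t. ip (v t) (sinb n)) (\<lambda>t. ip (G t) (sinb n) - freq n * ip (\<lambda>x. d x * wd (v t) x) (cosb (Suc n)))" for n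
  proof (rule prim_of_weak_derivative[OF T c[OF v(2)]])
    let ?g = "\<lambda>t. ip (G t) (sinb n) - freq n * ip (\<lambda>x. d x * wd (v t) x) (cosb (Suc n))"
    have Ai: "integrable (Iv T) (\<lambda>t. ip (\<lambda>x. d x * wd (v t) x) (cosb (Suc n)))"
      by (rule LL_integrable_ip[OF A LL_CL2[OF CL2_const[OF L2_cosb]]])
    then show gi: "integrable (Iv T) ?g"
      using integrable_Iv_continuous[OF c[OF G]] by simp
    fix \<psi> assume \<psi>: "test_fun {0<..<T} \<psi>"
    have wdL: "wd (sinb n) \<in> L2" by (rule wd_L2[OF weak_deriv_H1[OF weak_deriv_sinb]])
    have "(LINT t|Iv T. ip (v t) (sinb n) * deriv \<psi> t) =
        (LINT t|Iv T. (ip (\<lambda>x. d x * wd (v t) x) (wd (sinb n)) - ip (G t) (sinb n)) * \<psi> t)"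
      using w sinb_V02 \<psi> by (simp add: weak_sol_def)
    also have "\<dots> = (LINT t|Iv T. - (?g t * \<psi> t))"
    proof (rule integral_cong_AE)
      have "\<psi> \<in> borel_measurable (Iv T)"
        using integrable_Iv_continuous[OF test_fun_prim(4)[OF T \<psi>]] by auto
      moreover have "(\<lambda>t. ip (\<lambda>x. d x * wd (v t) x) (wd (sinb n)) - ip (G t) (sinb n)) \<in> borel_measurable (Iv T)"
        using LL_integrable_ip[OF A LL_CL2[OF CL2_const[OF wdL]]] integrable_Iv_continuous[OF c[OF G]]
        by (intro borel_measurable_diff borel_measurable_integrable)
      ultimately show "(\<lambda>t. (ip (\<lambda>x. d x * wd (v t) x) (wd (sinb n)) - ip (G t) (sinb n)) * \<psi> t) \<in> borel_measurable (Iv T)"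
        "(\<lambda>t. - (?g t * \<psi> t)) \<in> borel_measurable (Iv T)"
        using gi by auto
      show "AE t in Iv T. (ip (\<lambda>x. d x * wd (v t) x) (wd (sinb n)) - ip (G t) (sinb n)) * \<psi> t = - (?g t * \<psi> t)"
        using LL_L2[OF A]
      proof eventually_elim
        fix t assume "(\<lambda>x. d x * wd (v t) x) \<in> L2"
        then have "ip (\<lambda>x. d x * wd (v t) x) (wd (sinb n)) = ip (\<lambda>x. d x * wd (v t) x) (\<lambda>x. freq n * cosb (Suc n) x)"
          by (intro ip_cong_AE wd_sinb wdL) auto
        then show "(ip (\<lambda>x. d x * wd (v t) x) (wd (sinb n)) - ip (G t) (sinb n)) * \<psi> t = - (?g t * \<psi> t)"
          by (simp add: ip_cmult_right algebra_simps)
      qed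
    qed
    finally show "(LINT t|Iv T. ip (v t) (sinb n) * deriv \<psi> t) = - (LINT t|Iv T. ?g t * \<psi> t)" by simp
  qed
  then show ?thesis using v D A LL_CL2[OF G] by (simp add: evol_def)
qed

lemma weak_sol_evolu:
  assumes T: "T > 0" and w: "weak_sol T d F G a b u v" and F: "CL2 T F"
  shows "evolu T u F"
proof -
  have u: "u \<in> L2V T V02 norm2" "CL2 T u" using w by (auto simp: weak_sol_def)
  have V: "AE t in Iv T. u t \<in> V02" using u by (simp add: L2V_def)
  have c: "continuous_on {0..T} (\<lambda>t. ip (f t) (sinb n))" if "CL2 T f" for f n
    using continuous_on_ip[OF that CL2_const[OF L2_sinb]] .
  have "prim T (\<lambda>t. ip (u t) (sinb n)) (\<lambda>t. ip (F t) (sinb n) - freq n ^ 4 * ip (u t) (sinb n))" for n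
  proof (rule prim_of_weak_derivative[OF T c[OF u(2)]])
    let ?g = "\<lambda>t. ip (F t) (sinb n) - freq n ^ 4 * ip (u t) (sinb n)"
    let ?k = "\<lambda>t. ip (wd (wd (u t))) (wd (wd (sinb n))) - ip (F t) (sinb n)"
    show gi: "integrable (Iv T) ?g"
      by (intro integrable_Iv_continuous continuous_intros c u F)
    fix \<psi> assume \<psi>: "test_fun {0<..<T} \<psi>"
    have eq: "AE t in Iv T. - (?g t) = ?k t"
      using V
    proof eventually_elim
      fix t assume t: "u t \<in> V02"
      then have "wd (wd (u t)) \<in> L2" by (intro wd_L2) (auto simp: V02_def H2_def)
      moreover have "wd (wd (sinb n)) \<in> L2" using sinb_V02[of n] by (intro wd_L2) (auto simp: V02_def H2_def)
      ultimately have "ip (wd (wd (u t))) (wd (wd (sinb n))) = ip (wd (wd (u t))) (\<lambda>x. - (freq n)\<^sup>2 * sinb n x)"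
        by (intro ip_cong_AE wd_wd_sinb) auto
      also have "\<dots> = freq n ^ 4 * ip (u t) (sinb n)"
        unfolding ip_cmult_right ip_wd_wd_sinb[OF t] by (simp add: power2_eq_square power4_eq_xxxx)
      finally show "- (?g t) = ?k t" by simp
    qed
    \<comment> \<open>Measurability of the pairing with the second derivatives is derived from the
      identity \<open>eq\<close>: almost everywhere it equals a continuous function of time.\<close>
    have km: "?k \<in> borel_measurable (Iv T)"
      by (rule borel_measurable_lebesgue_on_AE[OF borel_measurable_uminus[OF borel_measurable_integrable[OF gi]] eq]) simp
    have "(LINT t|Iv T. ip (u t) (sinb n) * deriv \<psi> t) = (LINT t|Iv T. ?k t * \<psi> t)"
      using w sinb_V02 \<psi> by (simp add: weak_sol_def)
    also have "\<dots> = (LINT t|Iv T. - (?g t * \<psi> t))"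
    proof (rule integral_cong_AE)
      have \<psi>m: "\<psi> \<in> borel_measurable (Iv T)"
        using integrable_Iv_continuous[OF test_fun_prim(4)[OF T \<psi>]] by auto
      show "(\<lambda>t. ?k t * \<psi> t) \<in> borel_measurable (Iv T)" using km \<psi>m by (rule borel_measurable_times)
      show "(\<lambda>t. - (?g t * \<psi> t)) \<in> borel_measurable (Iv T)" using gi \<psi>m by auto
      show "AE t in Iv T. ?k t * \<psi> t = - (?g t * \<psi> t)"
        using eq by eventually_elim (metis mult_minus_left)
    qed
    finally show "(LINT t|Iv T. ip (u t) (sinb n) * deriv \<psi> t) = - (LINT t|Iv T. ?g t * \<psi> t)" by simp
  qed
  then show ?thesis using u F by (simp add: evolu_def)
qed

section \<open>Differentiability of the Tikhonov functional\<close>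

lemma Dset_bdd_coeff:
  assumes "d \<in> Dset a0 a1 a2" "0 < a0" shows "bdd_coeff d"
proof -
  have "d \<in> L2" using assms H1_L2 by (auto simp: Dset_def)
  moreover have "AE x in lebesgue_on Om. \<bar>d x\<bar> \<le> a1"
    using assms by (intro AE_I2) (force simp: Dset_def)
  ultimately show ?thesis using L2D(1) by (auto simp: bdd_coeff_def)
qed

section \<open>Energy estimates for the diffusion equation\<close>

lemma ip_coercive:
  assumes d: "bdd_coeff d" "\<And>x. x \<in> Om \<Longrightarrow> a0 \<le> d x" and f: "f \<in> L2"
  shows "a0 * ip f f \<le> ip f (\<lambda>x. d x * f x)"
proof -
  have "a0 * ip f f = (LINT x|lebesgue_on Om. a0 * (f x * f x))" by (simp add: ip_def)
  also have "\<dots> \<le> (LINT x|lebesgue_on Om. f x * (d x * f x))"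
  proof (rule integral_mono)
    show "integrable (lebesgue_on Om) (\<lambda>x. a0 * (f x * f x))" using L2_integrable_mult[OF f f] by simp
    show "integrable (lebesgue_on Om) (\<lambda>x. f x * (d x * f x))"
      by (rule L2_integrable_mult[OF f bdd_coeff_mult_L2[OF d(1) f]])
    fix x assume "x \<in> space (lebesgue_on Om)"
    then have "a0 * (f x * f x) \<le> d x * (f x * f x)" using d(2) by (intro mult_right_mono) auto
    then show "a0 * (f x * f x) \<le> f x * (d x * f x)" by (simp add: mult_ac)
  qed
  finally show ?thesis by (simp add: ip_def)
qed

lemma ip_zero_left: "ip (\<lambda>x. 0) g = 0"
  by (simp add: ip_def)

text \<open>Green's formula for \<open>v\<close> paired with itself, dropping the energy at time T.
  Only \<open>a0\<close> and the initial value remain, so the bound holds uniformly over all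
  admissible coefficients.\<close>

lemma gradient_bound:
  assumes T: "T > 0" and a0: "a0 > 0" and d: "bdd_coeff d" "\<And>x. x \<in> Om \<Longrightarrow> a0 \<le> d x"
    and v: "evol T v X (\<lambda>t x. d x * X t x) (\<lambda>t x. 0)"
  shows "2 * a0 * (LINT t|Iv T. ip (X t) (X t)) \<le> ip (v 0) (v 0)"
proof -
  have X: "LL T X" "LL T (\<lambda>t x. d x * X t x)" using v by (auto simp: evol_def)
  have i: "integrable (Iv T) (\<lambda>t. ip (X t) (\<lambda>x. d x * X t x))" by (rule LL_integrable_ip[OF X])
  have "ip (v T) (v T) - ip (v 0) (v 0) = (LINT t|Iv T. - 2 * ip (X t) (\<lambda>x. d x * X t x))"
    using evol_green[OF T v v] by (simp add: ip_zero_left)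
  also have "\<dots> = - 2 * (LINT t|Iv T. ip (X t) (\<lambda>x. d x * X t x))" by simp
  finally have "2 * (LINT t|Iv T. ip (X t) (\<lambda>x. d x * X t x)) \<le> ip (v 0) (v 0)"
    using ip_ge_0[of "v T"] by simp
  moreover have "(LINT t|Iv T. a0 * ip (X t) (X t)) \<le> (LINT t|Iv T. ip (X t) (\<lambda>x. d x * X t x))"
  proof (rule integral_mono_AE)
    show "AE t in Iv T. a0 * ip (X t) (X t) \<le> ip (X t) (\<lambda>x. d x * X t x)"
      using LL_L2[OF X(1)] by eventually_elim (rule ip_coercive[OF d])
  qed (use i LL_norm[OF X(1)] in auto)
  ultimately show ?thesis by simp
qed

text \<open>Pair \<open>W\<close> with itself. Coercivity yields 2 \<open>a0\<close> times the
  squared gradient; Young's inequality with weight \<open>a0\<close> spends half of it on the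
  perturbation flux \<delta> Y, and \<open>B\<close> bounds the square of \<delta>.\<close>

lemma difference_energy:
  assumes T: "T > 0" and a0: "a0 > 0" and d: "bdd_coeff d" "\<And>x. x \<in> Om \<Longrightarrow> a0 \<le> d x"
    and \<delta>: "bdd_coeff \<delta>" "AE x in lebesgue_on Om. (\<delta> x)\<^sup>2 \<le> B" and Y: "LL T Y"
    and W: "evol T W X A (\<lambda>t x. 0)" and W0: "ip (W 0) (W 0) = 0"
    and A: "AE t in Iv T. \<forall>x. A t x = d x * X t x + \<delta> x * Y t x"
  shows "ip (W T) (W T) + a0 * (LINT t|Iv T. ip (X t) (X t)) \<le> B / a0 * (LINT t|Iv T. ip (Y t) (Y t))"
proof -
  have X: "LL T X" and AL: "LL T A" using W by (auto simp: evol_def)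
  have "ip (W T) (W T) = (LINT t|Iv T. - 2 * ip (X t) (A t))"
    using evol_green[OF T W W] W0 by (simp add: ip_zero_left)
  also have "\<dots> \<le> (LINT t|Iv T. B / a0 * ip (Y t) (Y t) - a0 * ip (X t) (X t))"
  proof (rule integral_mono_AE)
    show "integrable (Iv T) (\<lambda>t. - 2 * ip (X t) (A t))" using LL_integrable_ip[OF X AL] by simp
    show "integrable (Iv T) (\<lambda>t. B / a0 * ip (Y t) (Y t) - a0 * ip (X t) (X t))"
      using LL_norm[OF X] LL_norm[OF Y] by simp
    show "AE t in Iv T. - 2 * ip (X t) (A t) \<le> B / a0 * ip (Y t) (Y t) - a0 * ip (X t) (X t)"
      using LL_L2[OF X] LL_L2[OF Y] A
    proof eventually_elim
      fix t assume x: "X t \<in> L2" and y: "Y t \<in> L2" and a: "\<forall>x. A t x = d x * X t x + \<delta> x * Y t x"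
      have "A t = (\<lambda>x. d x * X t x + \<delta> x * Y t x)" using a by auto
      then have "ip (X t) (A t) = ip (X t) (\<lambda>x. d x * X t x) + ip (X t) (\<lambda>x. \<delta> x * Y t x)"
        by (simp only: ip_add_right bdd_coeff_mult_L2[OF d(1) x] bdd_coeff_mult_L2[OF \<delta>(1) y] x)
      moreover have "a0 * ip (X t) (X t) \<le> ip (X t) (\<lambda>x. d x * X t x)" by (rule ip_coercive[OF d x])
      moreover have "2 * \<bar>ip (X t) (\<lambda>x. \<delta> x * Y t x)\<bar> \<le>
          a0 * ip (X t) (X t) + ip (\<lambda>x. \<delta> x * Y t x) (\<lambda>x. \<delta> x * Y t x) / a0"
        by (rule ip_abs_le_weighted[OF x bdd_coeff_mult_L2[OF \<delta>(1) y] a0])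
      moreover have "ip (\<lambda>x. \<delta> x * Y t x) (\<lambda>x. \<delta> x * Y t x) / a0 \<le> (B * ip (Y t) (Y t)) / a0"
        using \<delta> a0 by (intro divide_right_mono ip_bounded_mult_le y) (auto simp: bdd_coeff_def)
      ultimately show "- 2 * ip (X t) (A t) \<le> B / a0 * ip (Y t) (Y t) - a0 * ip (X t) (X t)" by simp
    qed
  qed
  also have "\<dots> = B / a0 * (LINT t|Iv T. ip (Y t) (Y t)) - a0 * (LINT t|Iv T. ip (X t) (X t))"
    using LL_norm[OF X] LL_norm[OF Y] by simp
  finally show ?thesis by simp
qed

section \<open>Expansion of the quadratic terms of the functional\<close>

lemma norm1_add:
  assumes "d \<in> H1" "\<delta> \<in> H1"
  shows "(norm1 (\<lambda>x. d x + \<delta> x))\<^sup>2 = (norm1 d)\<^sup>2 + 2 * ip1 d \<delta> + (norm1 \<delta>)\<^sup>2"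
proof -
  note L = H1_L2[OF assms(1)] H1_L2[OF assms(2)] wd_L2[OF assms(1)] wd_L2[OF assms(2)]
  have w: "AE x in lebesgue_on Om. wd (\<lambda>x. d x + \<delta> x) x = wd d x + wd \<delta> x"
    by (rule wd_AE[OF weak_deriv_add[OF weak_deriv_wd[OF assms(1)] weak_deriv_wd[OF assms(2)]]])
  have "ip (wd (\<lambda>x. d x + \<delta> x)) (wd (\<lambda>x. d x + \<delta> x)) = ip (\<lambda>x. wd d x + wd \<delta> x) (\<lambda>x. wd d x + wd \<delta> x)"
    using w by (intro ip_cong_AE[symmetric] L2_add L) (auto elim: eventually_mono)
  then show ?thesis by (simp add: norm1_power2 ip_square_add L ip1_def)
qed

lemma ip1_add_cmult_left:
  assumes "f \<in> H1" "d \<in> H1" "\<delta> \<in> H1"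
  shows "ip1 (\<lambda>x. f x + \<gamma> * d x) \<delta> = ip1 f \<delta> + \<gamma> * ip1 d \<delta>"
proof -
  note L = H1_L2[OF assms(1)] H1_L2[OF assms(2)] H1_L2[OF assms(3)]
    wd_L2[OF assms(1)] wd_L2[OF assms(2)] wd_L2[OF assms(3)]
  have w: "AE x in lebesgue_on Om. wd (\<lambda>x. f x + \<gamma> * d x) x = wd f x + \<gamma> * wd d x"
    by (rule wd_AE[OF weak_deriv_add[OF weak_deriv_wd[OF assms(1)] weak_deriv_cmult[OF weak_deriv_wd[OF assms(2)]]]])
  have "ip (wd (\<lambda>x. f x + \<gamma> * d x)) (wd \<delta>) = ip (\<lambda>x. wd f x + \<gamma> * wd d x) (wd \<delta>)"
    using w by (intro ip_cong_AE[symmetric] L2_add L2_cmult L) (auto elim: eventually_mono)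
  then show ?thesis by (simp add: ip1_def ip_add_left L L2_cmult ip_cmult_left algebra_simps)
qed

lemma ip_diff_AE_zero:
  assumes "f \<in> L2" "g \<in> L2" "AE x in lebesgue_on Om. f x = a x" "AE x in lebesgue_on Om. g x = a x" "h \<in> L2"
  shows "ip (\<lambda>x. f x - g x) h = 0"
proof -
  have "ip (\<lambda>x. f x - g x) h = ip (\<lambda>x. 0) h"
  proof (rule ip_cong_AE)
    show "AE x in lebesgue_on Om. f x - g x = 0" using assms(3,4) by eventually_elim simp
  qed (use assms in \<open>auto intro: L2_diff\<close>)
  then show ?thesis by (simp add: ip_zero_left)
qed

text \<open>Expand the square around \<open>f - m\<close>. The function \<open>r\<close> is the
  terminal value of the adjoint state, known to be the residual only almost everywhere.\<close>

lemma misfit_difference: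
  assumes f: "f \<in> L2" and f': "f' \<in> L2" and m: "m \<in> L2" and ae: "AE x in lebesgue_on Om. r x = f x - m x"
  shows "ip (\<lambda>x. f' x - m x) (\<lambda>x. f' x - m x) - ip (\<lambda>x. f x - m x) (\<lambda>x. f x - m x) =
    2 * ip (\<lambda>x. f' x - f x) r + ip (\<lambda>x. f' x - f x) (\<lambda>x. f' x - f x)"
proof -
  have "ip (\<lambda>x. f' x - f x) (\<lambda>x. f x - m x) = ip (\<lambda>x. f' x - f x) r"
    using ae by (intro ip_cong_AE L2_diff f f' m) (auto elim: eventually_mono)
  moreover have "ip (\<lambda>x. f' x - m x) (\<lambda>x. f' x - m x) =
    ip (\<lambda>x. (f' x - f x) + (f x - m x)) (\<lambda>x. (f' x - f x) + (f x - m x))" by simp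
  ultimately show ?thesis by (simp only: ip_square_add L2_diff f f' m)
qed

text \<open>The problem for \<Lambda> enters variationally: testing its equation with \<phi> under
  Neumann conditions gives the identity for all \<phi> in \<open>H1\<close>, including the minus
  sign. \<open>C\<close> is chosen before \<delta> and the perturbed states, so the estimate is
  uniform in the perturbation.\<close>

theorem theorem4p1:
  fixes T \<gamma> a0 a1 a2 :: real
    and u0 v0 m1 m2 d \<Lambda> :: "real \<Rightarrow> real"
    and u v p q :: "real \<Rightarrow> real \<Rightarrow> real"
  assumes "T > 0" and "\<gamma> > 0" and "0 < a0" and "a0 \<le> a1" and "a2 > 0"
    and "u0 \<in> L2" and "v0 \<in> L2" and "m1 \<in> L2" and "m2 \<in> L2"
    and "d \<in> Dset a0 a1 a2"
    and "forward_sol T d u0 v0 u v"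
    and "adjoint_sol T d (\<lambda>x. u T x - m1 x) (\<lambda>x. v T x - m2 x) p q"
    and "\<Lambda> \<in> H1"
    and "\<forall>\<phi>\<in>H1. ip1 \<Lambda> \<phi> =
           - (LINT t|lebesgue_on {0<..<T}. ip (\<lambda>x. wd (q t) x * wd (v t) x) \<phi>)"
  shows "\<exists>C. \<forall>\<delta> u' v'. (\<lambda>x. d x + \<delta> x) \<in> Dset a0 a1 a2 \<longrightarrow>
            forward_sol T (\<lambda>x. d x + \<delta> x) u0 v0 u' v' \<longrightarrow>
            \<bar>Jgam T \<gamma> m1 m2 (\<lambda>x. d x + \<delta> x) u' v' - Jgam T \<gamma> m1 m2 d u v
              - ip1 (\<lambda>x. \<Lambda> x + \<gamma> * d x) \<delta>\<bar> \<le> C * (norm1 \<delta>)\<^sup>2"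
proof -
  note T = \<open>T > 0\<close> and a0 = \<open>0 < a0\<close>
  have d: "bdd_coeff d" "\<And>x. x \<in> Om \<Longrightarrow> a0 \<le> d x" "d \<in> H1"
    using Dset_bdd_coeff[OF assms(10) a0] assms(10) by (auto simp: Dset_def)
  have sol: "weak_sol T d v (\<lambda>t x. 0) u0 v0 u v" using assms(11) by (simp add: forward_sol_def)
  then have C: "CL2 T u" "CL2 T v" by (auto simp: weak_sol_def)
  have adj: "weak_sol T d (\<lambda>t x. 0) (\<lambda>t. p (T - t)) (\<lambda>x. u T x - m1 x) (\<lambda>x. v T x - m2 x)
      (\<lambda>t. p (T - t)) (\<lambda>t. q (T - t))" using assms(12) by (simp add: adjoint_sol_def)
  then have CP: "CL2 T (\<lambda>t. p (T - t))" "CL2 T (\<lambda>t. q (T - t))" by (auto simp: weak_sol_def)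
  have Cp: "CL2 T p" "CL2 T q" using CL2_reflect[OF CP(1)] CL2_reflect[OF CP(2)] by simp_all
  have pT: "AE x in lebesgue_on Om. p T x = u T x - m1 x" and qT: "AE x in lebesgue_on Om. q T x = v T x - m2 x"
    using adj by (auto simp: weak_sol_def)
  have Ev: "evol T v (\<lambda>t. wd (v t)) (\<lambda>t x. d x * wd (v t) x) (\<lambda>t x. 0)"
    by (rule weak_sol_evol[OF T sol d(1) CL2_zero])
  have Eu: "evolu T u v" by (rule weak_sol_evolu[OF T sol C(2)])
  have EP: "evolu T (\<lambda>t. p (T - t)) (\<lambda>t x. 0)" by (rule weak_sol_evolu[OF T adj CL2_zero])
  have Eq: "evol T q (\<lambda>t. wd (q t)) (\<lambda>t x. - (d x * wd (q t) x)) (\<lambda>t x. - p t x)"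
    using evol_reflect[OF T weak_sol_evol[OF T adj d(1) CP(1)]] by simp
  have Lq: "LL T (\<lambda>t. wd (q t))" and Lv: "LL T (\<lambda>t. wd (v t))" using Eq Ev by (auto simp: evol_def)
  have T0: "0 \<in> {0..T}" "T \<in> {0..T}" using T by auto
  \<comment> \<open>From \<open>difference_energy\<close> with B = 2N and
    \<open>gradient_bound\<close>: (2N / a0) * |v0|^2 / (2 a0) = N K.\<close>
  define K where "K = ip v0 v0 / a0\<^sup>2"
  define Sq where "Sq = (LINT t|Iv T. ip (wd (q t)) (wd (q t)))"
  have K0: "0 \<le> K" using ip_ge_0[of v0] by (simp add: K_def)
  \<comment> \<open>K / a0 collects half of |U(T)|^2 and the gradient half of \<open>Rb\<close>; K /
    2 comes from |W(T)|^2 / 2, \<gamma> / 2 from the penalty, and \<open>Sq\<close> from the adjoint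
    gradient in \<open>Rb\<close>.\<close>
  let ?C = "K / a0 + K / 2 + \<gamma> / 2 + Sq"
  show ?thesis
  proof (intro exI[of _ ?C] allI impI)
    fix \<delta> u' v'
    assume D': "(\<lambda>x. d x + \<delta> x) \<in> Dset a0 a1 a2" and F': "forward_sol T (\<lambda>x. d x + \<delta> x) u0 v0 u' v'"
    have d': "bdd_coeff (\<lambda>x. d x + \<delta> x)" "\<And>x. x \<in> Om \<Longrightarrow> a0 \<le> d x + \<delta> x" "(\<lambda>x. d x + \<delta> x) \<in> H1"
      using Dset_bdd_coeff[OF D' a0] D' by (auto simp: Dset_def)
    have "weak_deriv_of (\<lambda>x. (d x + \<delta> x) - d x) (\<lambda>x. wd (\<lambda>x. d x + \<delta> x) x - wd d x)"
      by (rule weak_deriv_diff[OF weak_deriv_wd[OF d'(3)] weak_deriv_wd[OF d(3)]])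
    then have \<delta>H: "\<delta> \<in> H1" by (intro weak_deriv_H1) simp
    define N where "N = (norm1 \<delta>)\<^sup>2"
    have N0: "0 \<le> N" by (simp add: N_def)
    have \<delta>2: "AE x in lebesgue_on Om. (\<delta> x)\<^sup>2 \<le> 2 * N" unfolding N_def by (rule H1_sup_bound[OF \<delta>H])
    have "AE x in lebesgue_on Om. \<bar>\<delta> x\<bar> \<le> sqrt (2 * N)"
      using \<delta>2 by eventually_elim (metis real_sqrt_abs real_sqrt_le_iff)
    then have \<delta>b: "bdd_coeff \<delta>" using L2D(1)[OF H1_L2[OF \<delta>H]] by (auto simp: bdd_coeff_def)
    have sol': "weak_sol T (\<lambda>x. d x + \<delta> x) v' (\<lambda>t x. 0) u0 v0 u' v'" using F' by (simp add: forward_sol_def)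
    then have C': "CL2 T u'" "CL2 T v'" by (auto simp: weak_sol_def)
    have Ev': "evol T v' (\<lambda>t. wd (v' t)) (\<lambda>t x. (d x + \<delta> x) * wd (v' t) x) (\<lambda>t x. 0)"
      by (rule weak_sol_evol[OF T sol' d'(1) CL2_zero])
    have Eu': "evolu T u' v'" by (rule weak_sol_evolu[OF T sol' C'(2)])
    have Lv': "LL T (\<lambda>t. wd (v' t))" using Ev' by (auto simp: evol_def)
    define W where "W = (\<lambda>t x. v' t x - v t x)"
    define X where "X = (\<lambda>t x. wd (v' t) x - wd (v t) x)"
    define A where "A = (\<lambda>t x. (d x + \<delta> x) * wd (v' t) x - d x * wd (v t) x)"
    define U where "U = (\<lambda>t x. u' t x - u t x)"
    have EW: "evol T W X A (\<lambda>t x. 0)"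
      using evol_diff[OF T Ev' Ev] unfolding W_def X_def A_def by simp
    have EU: "evolu T U W" using evolu_diff[OF T Eu' Eu] unfolding W_def U_def .
    \<comment> \<open>For the energy estimate the perturbation multiplies the gradient of the
      perturbed solution, so that no gradient of \<open>W\<close> carries the factor
      \<delta>.\<close>
    have A: "A t x = d x * X t x + \<delta> x * wd (v' t) x" for t x
      by (simp add: A_def X_def algebra_simps)
    have CW: "CL2 T W" and CU: "CL2 T U" and LX: "LL T X" and LA: "LL T A"
      and DW: "AE t in Iv T. D01 (W t) (X t)"
      using EW EU by (auto simp: evol_def evolu_def)
    have W0: "ip (W 0) h = 0" and U0: "ip (U 0) h = 0" if "h \<in> L2" for h
      unfolding W_def U_def using sol sol' that
      by (auto simp: weak_sol_def intro!: ip_diff_AE_zero CL2_L2[OF C(1) T0(1)] CL2_L2[OF C(2) T0(1)]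
          CL2_L2[OF C'(1) T0(1)] CL2_L2[OF C'(2) T0(1)])

    have "2 * a0 * (LINT t|Iv T. ip (wd (v' t)) (wd (v' t))) \<le> ip (v' 0) (v' 0)"
      by (rule gradient_bound[OF T a0 d'(1,2) Ev'])
    also have "ip (v' 0) (v' 0) = ip v0 v0"
      using sol' by (intro ip_cong_AE CL2_L2[OF C'(2) T0(1)]) (auto simp: weak_sol_def)
    finally have grad: "(LINT t|Iv T. ip (wd (v' t)) (wd (v' t))) \<le> ip v0 v0 / (2 * a0)"
      using a0 by (simp add: field_simps)
    define SX where "SX = (LINT t|Iv T. ip (X t) (X t))"
    have SX0: "0 \<le> SX" unfolding SX_def by (intro integral_nonneg_AE AE_I2 ip_ge_0)
    have "ip (W T) (W T) + a0 * SX \<le> 2 * N / a0 * (LINT t|Iv T. ip (wd (v' t)) (wd (v' t)))"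
      unfolding SX_def
      by (rule difference_energy[OF T a0 d(1,2) \<delta>b \<delta>2 Lv' EW]) (use A W0 CL2_L2[OF CW T0(1)] in auto)
    also have "\<dots> \<le> 2 * N / a0 * (ip v0 v0 / (2 * a0))"
      using grad N0 a0 by (intro mult_left_mono) auto
    also have "\<dots> = N * K" using a0 by (simp add: K_def power2_eq_square)
    finally have en: "ip (W T) (W T) + a0 * SX \<le> N * K" .
    have WT: "ip (W T) (W T) \<le> N * K" using en SX0 a0 by (smt (verit) mult_nonneg_nonneg)
    have "a0 * SX \<le> N * K" using en ip_ge_0[of "W T"] by simp
    then have SXb: "SX \<le> N * K / a0" using a0 by (simp add: field_simps)
    \<comment> \<open>\<open>U\<close> starts at zero and is driven by \<open>W\<close>, and
      Poincare's inequality trades \<open>W\<close> for its gradient.\<close>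
    have UT: "ip (U T) (U T) \<le> SX"
    proof -
      have "ip (U T) (U T) \<le> (LINT t|Iv T. ip (W t) (W t))"
        using evolu_energy[OF T EU] U0[OF CL2_L2[OF CU T0(1)]] by simp
      also have "\<dots> \<le> SX"
        unfolding SX_def
      proof (rule integral_mono_AE)
        show "AE t in Iv T. ip (W t) (W t) \<le> ip (X t) (X t)"
          using DW by eventually_elim (rule poincare)
      qed (use LL_norm[OF LL_CL2[OF CW]] LL_norm[OF LX] in auto)
      finally show ?thesis .
    qed

    have L\<delta>X: "LL T (\<lambda>t x. \<delta> x * X t x)" and L\<delta>v: "LL T (\<lambda>t x. \<delta> x * wd (v t) x)"
      by (rule LL_mult[OF LX \<delta>b], rule LL_mult[OF Lv \<delta>b])
    define R where "R = (LINT t|Iv T. ip (wd (q t)) (\<lambda>x. \<delta> x * X t x))"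
    define I where "I = (LINT t|Iv T. ip (wd (q t)) (\<lambda>x. \<delta> x * wd (v t) x))"
    define PW where "PW = (LINT t|Iv T. ip (W t) (p t))"
    have iR: "integrable (Iv T) (\<lambda>t. ip (wd (q t)) (\<lambda>x. \<delta> x * X t x))"
      and iI: "integrable (Iv T) (\<lambda>t. ip (wd (q t)) (\<lambda>x. \<delta> x * wd (v t) x))"
      and iPW: "integrable (Iv T) (\<lambda>t. ip (W t) (p t))"
      by (intro LL_integrable_ip Lq L\<delta>X L\<delta>v LL_CL2[OF CW] LL_CL2[OF Cp(1)])+
    \<comment> \<open>Green's formula for \<open>W\<close> and \<open>q\<close>, with zero initial
      value of \<open>W\<close>; the terms carrying \<open>d\<close> cancel by symmetry in the next
      step.\<close>
    have "ip (W T) (q T) = (LINT t|Iv T. - ip (wd (q t)) (A t) + ip (\<lambda>x. - p t x) (W t)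
         - ip (X t) (\<lambda>x. - (d x * wd (q t) x)))"
      using evol_green[OF T EW Eq] W0[OF CL2_L2[OF Cp(2) T0(1)]] by (simp add: ip_zero_left)
    also have "\<dots> = (LINT t|Iv T. - ip (wd (q t)) (\<lambda>x. \<delta> x * wd (v t) x) - ip (wd (q t)) (\<lambda>x. \<delta> x * X t x) - ip (W t) (p t))"
    proof (rule integral_cong_AE)
      show "(\<lambda>t. - ip (wd (q t)) (A t) + ip (\<lambda>x. - p t x) (W t) - ip (X t) (\<lambda>x. - (d x * wd (q t) x))) \<in> borel_measurable (Iv T)"
        using Eq by (intro borel_measurable_integrable Bochner_Integration.integrable_diff Bochner_Integration.integrable_add
           Bochner_Integration.integrable_minus LL_integrable_ip Lq LA LX LL_CL2[OF CW]) (auto simp: evol_def)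
      show "(\<lambda>t. - ip (wd (q t)) (\<lambda>x. \<delta> x * wd (v t) x) - ip (wd (q t)) (\<lambda>x. \<delta> x * X t x) - ip (W t) (p t)) \<in> borel_measurable (Iv T)"
        using iR iI iPW by auto
      show "AE t in Iv T. - ip (wd (q t)) (A t) + ip (\<lambda>x. - p t x) (W t) - ip (X t) (\<lambda>x. - (d x * wd (q t) x)) =
         - ip (wd (q t)) (\<lambda>x. \<delta> x * wd (v t) x) - ip (wd (q t)) (\<lambda>x. \<delta> x * X t x) - ip (W t) (p t)"
        using LL_L2[OF Lq] LL_L2[OF Lv] LL_L2[OF LX]
      proof eventually_elim
        fix t assume L: "wd (q t) \<in> L2" "wd (v t) \<in> L2" "X t \<in> L2"
        note L' = bdd_coeff_mult_L2[OF \<delta>b L(2)] bdd_coeff_mult_L2[OF \<delta>b L(3)] bdd_coeff_mult_L2[OF d(1) L(3)]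
        \<comment> \<open>The other splitting of the flux, now with the unperturbed gradient:
          \<delta> times \<open>wd (v t)\<close> gives the linear term \<open>I\<close>, and
          \<delta> times \<open>X t\<close> the remainder \<open>R\<close>.\<close>
        have "A t = (\<lambda>x. d x * X t x + (\<delta> x * wd (v t) x + \<delta> x * X t x))"
          by (auto simp: A_def X_def algebra_simps)
        then have "ip (wd (q t)) (A t) = ip (wd (q t)) (\<lambda>x. d x * X t x) +
           (ip (wd (q t)) (\<lambda>x. \<delta> x * wd (v t) x) + ip (wd (q t)) (\<lambda>x. \<delta> x * X t x))"
          by (simp only: ip_add_right L L' L2_add)
        moreover have "ip (X t) (\<lambda>x. - (d x * wd (q t) x)) = - ip (wd (q t)) (\<lambda>x. d x * X t x)"
          by (simp add: ip_def mult_ac)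
        moreover have "ip (\<lambda>x. - p t x) (W t) = - ip (W t) (p t)"
          by (simp add: ip_minus_left ip_commute)
        ultimately show "- ip (wd (q t)) (A t) + ip (\<lambda>x. - p t x) (W t) - ip (X t) (\<lambda>x. - (d x * wd (q t) x)) =
         - ip (wd (q t)) (\<lambda>x. \<delta> x * wd (v t) x) - ip (wd (q t)) (\<lambda>x. \<delta> x * X t x) - ip (W t) (p t)" by simp
      qed
    qed
    also have "\<dots> = - I - R - PW"
      unfolding I_def R_def PW_def using iR iI iPW by simp
    finally have Wq: "ip (W T) (q T) = - I - R - PW" .
    \<comment> \<open>This cancels the term \<open>- PW\<close> of \<open>Wq\<close> when the two
      misfits are added.\<close>
    have Up: "ip (U T) (p T) = PW"
      using evolu_duality[OF T EU EP] U0[OF CL2_L2[OF Cp(1) T0(1)]] by (simp add: PW_def)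
    have \<Lambda>: "ip1 \<Lambda> \<delta> = - I"
    proof -
      have "ip (\<lambda>x. wd (q t) x * wd (v t) x) \<delta> = ip (wd (q t)) (\<lambda>x. \<delta> x * wd (v t) x)" for t
        by (simp add: ip_def mult_ac)
      then show ?thesis using assms(14) \<delta>H by (simp add: I_def)
    qed
    \<comment> \<open>Moving \<delta> onto the adjoint gradient makes one square of order N through
      the sup bound; the other, \<open>SX\<close>, is of order N by the energy estimate. Young's
      inequality therefore bounds \<open>R\<close> by a multiple of N.\<close>
    have Rb: "\<bar>R\<bar> \<le> N * Sq + SX / 2"
    proof -
      have "\<bar>R\<bar> \<le> (LINT t|Iv T. N * ip (wd (q t)) (wd (q t)) + ip (X t) (X t) / 2)"
        unfolding R_def
      proof (rule integral_abs_bound[THEN order_trans], rule integral_mono_AE)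
        show "AE t in Iv T. \<bar>ip (wd (q t)) (\<lambda>x. \<delta> x * X t x)\<bar> \<le> N * ip (wd (q t)) (wd (q t)) + ip (X t) (X t) / 2"
          using LL_L2[OF Lq] LL_L2[OF LX]
        proof eventually_elim
          fix t assume L: "wd (q t) \<in> L2" "X t \<in> L2"
          have "ip (wd (q t)) (\<lambda>x. \<delta> x * X t x) = ip (\<lambda>x. \<delta> x * wd (q t) x) (X t)" by (simp add: ip_mult_move)
          moreover have "2 * \<bar>ip (\<lambda>x. \<delta> x * wd (q t) x) (X t)\<bar> \<le>
              ip (\<lambda>x. \<delta> x * wd (q t) x) (\<lambda>x. \<delta> x * wd (q t) x) + ip (X t) (X t)"
            by (rule ip_abs_le[OF bdd_coeff_mult_L2[OF \<delta>b L(1)] L(2)])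
          moreover have "ip (\<lambda>x. \<delta> x * wd (q t) x) (\<lambda>x. \<delta> x * wd (q t) x) \<le> 2 * N * ip (wd (q t)) (wd (q t))"
            using \<delta>b \<delta>2 by (intro ip_bounded_mult_le L(1)) (auto simp: bdd_coeff_def)
          ultimately show "\<bar>ip (wd (q t)) (\<lambda>x. \<delta> x * X t x)\<bar> \<le> N * ip (wd (q t)) (wd (q t)) + ip (X t) (X t) / 2"
            by simp
        qed
      qed (use iR LL_norm[OF Lq] LL_norm[OF LX] in auto)
      also have "\<dots> = N * Sq + SX / 2"
        unfolding Sq_def SX_def using LL_norm[OF Lq] LL_norm[OF LX] by simp
      finally show ?thesis .
    qed

    have J1: "(LINT x|lebesgue_on Om. (u' T x - m1 x)\<^sup>2) - (LINT x|lebesgue_on Om. (u T x - m1 x)\<^sup>2) =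
       2 * ip (U T) (p T) + ip (U T) (U T)"
      unfolding U_def ip_power2[symmetric]
      by (rule misfit_difference[OF CL2_L2[OF C(1) T0(2)] CL2_L2[OF C'(1) T0(2)] assms(8) pT])
    have J2: "(LINT x|lebesgue_on Om. (v' T x - m2 x)\<^sup>2) - (LINT x|lebesgue_on Om. (v T x - m2 x)\<^sup>2) =
       2 * ip (W T) (q T) + ip (W T) (W T)"
      unfolding W_def ip_power2[symmetric]
      by (rule misfit_difference[OF CL2_L2[OF C(2) T0(2)] CL2_L2[OF C'(2) T0(2)] assms(9) qT])
    have "Jgam T \<gamma> m1 m2 (\<lambda>x. d x + \<delta> x) u' v' - Jgam T \<gamma> m1 m2 d u v
        - ip1 (\<lambda>x. \<Lambda> x + \<gamma> * d x) \<delta> =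
        ip (U T) (p T) + ip (U T) (U T) / 2 + ip (W T) (q T) + ip (W T) (W T) / 2 + \<gamma> / 2 * N - ip1 \<Lambda> \<delta>"
      unfolding Jgam_def norm1_add[OF d(3) \<delta>H] ip1_add_cmult_left[OF assms(13) d(3) \<delta>H] N_def
      using J1 J2 by (simp add: algebra_simps add_divide_distrib)
    also have "\<dots> = ip (U T) (U T) / 2 + ip (W T) (W T) / 2 + \<gamma> / 2 * N - R"
      using Wq Up \<Lambda> by simp
    finally have J: "Jgam T \<gamma> m1 m2 (\<lambda>x. d x + \<delta> x) u' v' - Jgam T \<gamma> m1 m2 d u v
        - ip1 (\<lambda>x. \<Lambda> x + \<gamma> * d x) \<delta> = ip (U T) (U T) / 2 + ip (W T) (W T) / 2 + \<gamma> / 2 * N - R" .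
    have "0 \<le> \<gamma> / 2 * N" using \<open>\<gamma> > 0\<close> N0 by simp
    then have "\<bar>ip (U T) (U T) / 2 + ip (W T) (W T) / 2 + \<gamma> / 2 * N - R\<bar> \<le>
       N * K / a0 + N * K / 2 + \<gamma> / 2 * N + N * Sq"
      using UT WT SXb Rb ip_ge_0[of "U T"] ip_ge_0[of "W T"] by linarith
    also have "\<dots> = ?C * N" by (simp add: algebra_simps)
    finally show "\<bar>Jgam T \<gamma> m1 m2 (\<lambda>x. d x + \<delta> x) u' v' - Jgam T \<gamma> m1 m2 d u v
        - ip1 (\<lambda>x. \<Lambda> x + \<gamma> * d x) \<delta>\<bar> \<le> ?C * (norm1 \<delta>)\<^sup>2"
      unfolding J N_def .
  qed
qed

end
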